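(* Let $(x,u)\in\mathcal S$ with mode insertion gradient $d$, let $J(\gamma):=J(\mathcal P(x,u-\gamma d))$, and let $\alpha,\beta\in(0,1)$. Suppose $\overline m=2$ and there exist $b_1>0$ and $b_2>0$ such that $\theta<-b_1$ and, for each $i\in I_2$, $\ddot d_{\sigma_{i+\omega_i}}(T_i(\gamma_0^+))>b_2$. Set $$\gamma_3:=\gamma_0\left(2-\frac{\sqrt[3]{\alpha\frac{3\sqrt2}{2}}}{3}\right),\qquad \gamma(j):=(\gamma_3-\gamma_0)\beta^j+\gamma_0,\qquad s_2:=-\sum_{i\in I_2}\frac{\sqrt2\,\theta^2}{\ddot d_{\sigma_{i+\omega_i}}(T_i(\gamma_0^+))^{1/2}}.$$ Then $$j^\ast:=\min\{j\in\{0,1,2,\dots\}: J(\gamma(j))-J(0)<\alpha\,s_2\,(\gamma(j)-\gamma_0)^{1/2}\}$$ is finite (i.e. the set is nonempty).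
   Context: Setting. Fix $T>0$, $x_0\in\mathbb R^n$, modes $f_1,\dots,f_N:\mathbb R^n\to\mathbb R^n$ and a running cost $\ell:\mathbb R^n\to\mathbb R$. Standing assumption: each $f_i$ and $\ell$ are $C^2$ on $\mathbb R^n$ with $\|D^2f_i(x)\|\le K_2$, $\|D^2\ell(x)\|\le\overline K_2$ for all $x$, for some constants. A switching control is a piecewise constant $u=[u_1,\dots,u_N]^T$ on $[0,T]$ with $u_i(t)\in\{0,1\}$ and $\sum_iu_i(t)=1$ for a.e. $t$. It is equivalently described by its mode schedule $(\Sigma,\mathcal T)$, $\Sigma=[\sigma_1,\dots,\sigma_M]$, $\mathcal T=[T_1<\dots<T_{M-1}]$, through $u(t)=e_{\sigma_i}$ for $t\in[T_{i-1},T_i)$, $T_0=0$, $T_M=T$ ($e_j$ is the $j$th standard basis vector); the $T_i$ are the switching times. $u$ is non-chattering if for some $\delta t>0$ all adjacent switching times differ by more than $\delta t$; $\Omega$ is the set of non-chattering switching controls. $\mathcal X$, $\mathcal U$ are the Lebesgue integrable functions from $[0,T]$ to $\mathbb R^n$, $\mathbb R^N$. With $F(x,u)=\sum_iu_if_i(x)$, $\mathcal S$ is the set of $(x,u)\in\mathcal X\times\mathcal U$ with $u\in\Omega$ and $\dot x=F(x,u)$, $x(0)=x_0$ (in integral form). The cost is $J(x,u)=\int_0^T\ell(x(\tau))\,d\tau$. The adjoint $\rho$ solves $\dot\rho=-D_1F(x,u)^T\rho-D\ell(x)^T$, $\rho(T)=0$. The mode insertion gradient of $J$ at $(x,u)$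 is $d=[d_1,\dots,d_N]^T$, $d_a(t)=\rho(t)^T(f_a(x(t))-F(x(t),u(t)))$. Double indices denote differences: $d_{ab}=d_a-d_b$. Projection. $\mathcal Q_i(\mu(t))=\prod_{j\ne i}1(\mu_i(t)-\mu_j(t))$ with $1(s)=1$ for $s\ge0$, $1(s)=0$ for $s<0$. $\mathcal R\subset\mathcal U$ is the set of $\mu$ with $\mathcal Q(\mu)\in\Omega$. $\mathcal P(\alpha,\mu)=(x,u)$ for $(\alpha,\mu)\in\mathcal X\times\mathcal R$, where $u=\mathcal Q(\mu)$ and $x$ solves $\dot x=F(x,u)$, $x(0)=x_0$. Standing assumption: $d$ is piecewise continuous and for $i\neq j$ the function $d_i-d_j$ has finitely many critical points in $[0,T]$ (points where its derivative vanishes or it is not differentiable); this guarantees $u-\gamma d\in\mathcal R$ for $\gamma>0$. Optimality function and schedule. $\theta=\theta(x,u):=\min_{\sigma\in\{1,\dots,N\},\,t\in[0,T]}d_\sigma(t)$ (the lower bound of $d$ over modes and times), and $\gamma_0:=-1/\theta$ when $\theta<0$. $(\Sigma(\gamma),\mathcal T(\gamma))$ is the mode schedule of $\mathcal Q(u-\gamma d)$, with $\mathcal T(\gamma)=[T_1(\gamma),\dots,T_{M-1}(\gamma)]$. The mode sequence $\Sigma(\gamma)=[\sigma_1,\dots,\sigma_M]$ is constant for $\gamma$ in some interval $(\gamma_0,\gamma_0+\delta)$. The superscript $+$ denotes a limit from the right: $T_i(\gamma_0^+)=\lim_{\gamma\downarrow\gamma_0}T_i(\gamma)$, and values of $d$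 and its time derivatives at $T_i(\gamma_0^+)$ are the limits of the values at $T_i(\gamma)$ as $\gamma\downarrow\gamma_0$. Types. $T_i(\gamma_0^+)$, between modes $\sigma_i$ and $\sigma_{i+1}$ of $\Sigma(\gamma_0^+)$, has type $m(T_i(\gamma_0^+))=0$ if $T_i(\gamma)$ is constant for $\gamma\in(\gamma_0,\gamma_0+\delta\gamma)$ for some $\delta\gamma>0$; otherwise $m(T_i(\gamma_0^+))=\min\{m\in\mathbb N: D^md_{\sigma_i\sigma_{i+1}}(T_i(\gamma_0^+))\ne0\}$. $I_2$ is the set of $i\in\{1,\dots,M-1\}$ with $m(T_i(\gamma_0^+))=2$, and $\overline m=\max_im(T_i(\gamma_0^+))$. $\omega_i=0$ if there is $\delta\gamma>0$ with $T_i(\gamma)>T_i(\gamma_0^+)$ for $\gamma\in(\gamma_0,\gamma_0+\delta\gamma)$, and $\omega_i=1$ if instead $T_i(\gamma)<T_i(\gamma_0^+)$ there. *)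

theory Defs
  imports "HOL-Analysis.Analysis" "HOL-Library.Extended_Nat"
begin

text \<open>
  The states live in \<open>real ^ 'n\<close> and the modes are the elements of the finite type \<open>'k\<close>, so that a
  control is a function \<open>real \<Rightarrow> real ^ 'k\<close>. Functions of time are total; only their values on
  \<open>{0..T}\<close> are relevant.
\<close>

subsection \<open>Dynamics and controls\<close>

definition C2_bounded :: "real \<Rightarrow> ('a::real_normed_vector \<Rightarrow> 'b::real_normed_vector) \<Rightarrow> bool" where
  "C2_bounded K g \<longleftrightarrow>
     (\<exists>(Dg :: 'a \<Rightarrow> ('a \<Rightarrow>\<^sub>L 'b)) (D2g :: 'a \<Rightarrow> ('a \<Rightarrow>\<^sub>L ('a \<Rightarrow>\<^sub>L 'b))).
        (\<forall>x. (g has_derivative blinfun_apply (Dg x)) (at x)) \<and>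
        (\<forall>x. (Dg has_derivative blinfun_apply (D2g x)) (at x)) \<and>
        continuous_on UNIV D2g \<and>
        (\<forall>x. norm (D2g x) \<le> K))"

definition vfield ::
  "('k::finite \<Rightarrow> real ^ 'n \<Rightarrow> real ^ 'n) \<Rightarrow> real ^ 'n \<Rightarrow> real ^ 'k \<Rightarrow> real ^ 'n" where
  "vfield f x u = (\<Sum>i\<in>UNIV. u $ i *\<^sub>R f i x)"

text \<open>The values at the finitely many exceptional points are arbitrary.\<close>

definition piecewise_constant :: "real \<Rightarrow> (real \<Rightarrow> 'a) \<Rightarrow> bool" where
  "piecewise_constant T u \<longleftrightarrow>
     (\<exists>S. finite S \<and> (\<forall>s t. 0 \<le> s \<and> s \<le> t \<and> t \<le> T \<and> {s..t} \<inter> S = {} \<longrightarrow> u s = u t))"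

definition switching_control :: "real \<Rightarrow> (real \<Rightarrow> real ^ 'k::finite) \<Rightarrow> bool" where
  "switching_control T u \<longleftrightarrow>
     piecewise_constant T u \<and>
     (AE t in lborel. t \<in> {0..T} \<longrightarrow> (\<forall>i. u t $ i \<in> {0, 1}) \<and> (\<Sum>i\<in>UNIV. u t $ i) = 1)"

text \<open>
  The mode sequence is \<open>\<sigma> 1, \<dots>, \<sigma> M\<close>; the switching times are \<open>\<tau> 1 < \<dots> < \<tau> (M - 1)\<close>, completed by
  \<open>\<tau> 0 = 0\<close> and \<open>\<tau> M = T\<close>. Consecutive modes differ, so every \<open>\<tau> i\<close> is a genuine switching time and
  the schedule is determined by the control. Equality with the control holds almost everywhere,
  because the control \<open>max_select \<mu>\<close> below has several active components at a tie.
\<close>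

definition mode_schedule ::
  "real \<Rightarrow> (real \<Rightarrow> real ^ 'k::finite) \<Rightarrow> nat \<Rightarrow> (nat \<Rightarrow> 'k) \<Rightarrow> (nat \<Rightarrow> real) \<Rightarrow> bool" where
  "mode_schedule T u M \<sigma> \<tau> \<longleftrightarrow>
     1 \<le> M \<and> \<tau> 0 = 0 \<and> \<tau> M = T \<and>
     (\<forall>i<M. \<tau> i < \<tau> (i + 1)) \<and>
     (\<forall>i\<in>{1..<M}. \<sigma> i \<noteq> \<sigma> (i + 1)) \<and>
     (\<forall>i\<in>{1..M}. AE t in lborel. t \<in> {\<tau> (i - 1)..<\<tau> i} \<longrightarrow> u t = axis (\<sigma> i) 1)"

definition nonchattering_controls :: "real \<Rightarrow> (real \<Rightarrow> real ^ 'k::finite) set" where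
  "nonchattering_controls T =
     {u. switching_control T u \<and>
         (\<exists>M \<sigma> \<tau>. mode_schedule T u M \<sigma> \<tau> \<and>
            (\<exists>\<delta>>0. \<forall>i. 1 \<le> i \<and> i + 1 < M \<longrightarrow> \<tau> (i + 1) - \<tau> i > \<delta>))}"

definition solves_state ::
  "('k::finite \<Rightarrow> real ^ 'n \<Rightarrow> real ^ 'n) \<Rightarrow> real ^ 'n \<Rightarrow> real \<Rightarrow>
   (real \<Rightarrow> real ^ 'k) \<Rightarrow> (real \<Rightarrow> real ^ 'n) \<Rightarrow> bool" where
  "solves_state f x0 T u x \<longleftrightarrow>
     x absolutely_integrable_on {0..T} \<and>
     (\<forall>t\<in>{0..T}. ((\<lambda>s. vfield f (x s) (u s)) has_integral (x t - x0)) {0..t})"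

definition feasible_pairs ::
  "('k::finite \<Rightarrow> real ^ 'n \<Rightarrow> real ^ 'n) \<Rightarrow> real ^ 'n \<Rightarrow> real \<Rightarrow>
   ((real \<Rightarrow> real ^ 'n) \<times> (real \<Rightarrow> real ^ 'k)) set" where
  "feasible_pairs f x0 T =
     {(x, u). u absolutely_integrable_on {0..T} \<and> u \<in> nonchattering_controls T \<and>
              solves_state f x0 T u x}"

definition cost ::
  "(real ^ 'n \<Rightarrow> real) \<Rightarrow> real \<Rightarrow> (real \<Rightarrow> real ^ 'n) \<times> (real \<Rightarrow> real ^ 'k) \<Rightarrow> real" where
  "cost l T = (\<lambda>(x, u). integral {0..T} (\<lambda>t. l (x t)))"

subsection \<open>Adjoint variable and mode insertion gradient\<close>

text \<open>
  Here \<^const>\<open>adjoint\<close> is the transpose of a linear map; for real-valued \<open>l\<close>, the transposed derivative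
  \<open>adjoint (frechet_derivative l (at x)) 1\<close> is the gradient of \<open>l\<close> at \<open>x\<close>.
\<close>

definition solves_costate ::
  "('k::finite \<Rightarrow> real ^ 'n \<Rightarrow> real ^ 'n) \<Rightarrow> (real ^ 'n \<Rightarrow> real) \<Rightarrow> real \<Rightarrow>
   (real \<Rightarrow> real ^ 'n) \<Rightarrow> (real \<Rightarrow> real ^ 'k) \<Rightarrow> (real \<Rightarrow> real ^ 'n) \<Rightarrow> bool" where
  "solves_costate f l T x u \<rho> \<longleftrightarrow>
     \<rho> T = 0 \<and>
     (\<forall>t\<in>{0..T}.
        ((\<lambda>s. - adjoint (frechet_derivative (\<lambda>y. vfield f y (u s)) (at (x s))) (\<rho> s)
              - adjoint (frechet_derivative l (at (x s))) 1)
         has_integral (\<rho> T - \<rho> t)) {t..T})"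

definition mode_insertion_gradient ::
  "('k::finite \<Rightarrow> real ^ 'n \<Rightarrow> real ^ 'n) \<Rightarrow> (real \<Rightarrow> real ^ 'n) \<Rightarrow>
   (real \<Rightarrow> real ^ 'n) \<Rightarrow> (real \<Rightarrow> real ^ 'k) \<Rightarrow> real \<Rightarrow> real ^ 'k" where
  "mode_insertion_gradient f \<rho> x u =
     (\<lambda>t. \<chi> a. \<rho> t \<bullet> (f a (x t) - vfield f (x t) (u t)))"

definition piecewise_continuous :: "real \<Rightarrow> (real \<Rightarrow> 'a::topological_space) \<Rightarrow> bool" where
  "piecewise_continuous T g \<longleftrightarrow>
     (\<exists>S. finite S \<and> continuous_on ({0..T} - S) g) \<and>
     (\<forall>t\<in>{0..<T}. \<exists>l. (g \<longlongrightarrow> l) (at_right t)) \<and>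
     (\<forall>t\<in>{0<..T}. \<exists>l. (g \<longlongrightarrow> l) (at_left t))"

text \<open>Points where the derivative vanishes or does not exist.\<close>

definition critical_points :: "real \<Rightarrow> (real \<Rightarrow> real) \<Rightarrow> real set" where
  "critical_points T g =
     {t\<in>{0..T}. \<not> (\<exists>D. D \<noteq> 0 \<and> (g has_real_derivative D) (at t within {0..T}))}"

text \<open>An infimum, since the gradient is only piecewise continuous.\<close>

definition optimality_function :: "real \<Rightarrow> (real \<Rightarrow> real ^ 'k::finite) \<Rightarrow> real" where
  "optimality_function T d = (INF (a, t)\<in>UNIV \<times> {0..T}. d t $ a)"

subsection \<open>Projection\<close>

definition step :: "real \<Rightarrow> real" where
  "step s = (if 0 \<le> s then 1 else 0)"

definition max_select :: "(real \<Rightarrow> real ^ 'k::finite) \<Rightarrow> real \<Rightarrow> real ^ 'k" where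
  "max_select \<mu> = (\<lambda>t. \<chi> i. \<Prod>j\<in>UNIV - {i}. step (\<mu> t $ i - \<mu> t $ j))"

text \<open>
  Where the state trajectory exists, it is unique on \<open>{0..T}\<close>, so the choice operator only fixes its
  irrelevant values outside of this interval. Where it does not exist (a bounded second derivative
  does not exclude blow-up before time \<open>T\<close>), the state component is unspecified. The first argument
  \<open>\<alpha>\<close> does not influence the result.
\<close>

definition projection ::
  "('k::finite \<Rightarrow> real ^ 'n \<Rightarrow> real ^ 'n) \<Rightarrow> real ^ 'n \<Rightarrow> real \<Rightarrow>
   (real \<Rightarrow> real ^ 'n) \<times> (real \<Rightarrow> real ^ 'k) \<Rightarrow> (real \<Rightarrow> real ^ 'n) \<times> (real \<Rightarrow> real ^ 'k)" where
  "projection f x0 T =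
     (\<lambda>(\<alpha>, \<mu>). (SOME x. solves_state f x0 T (max_select \<mu>) x, max_select \<mu>))"

subsection \<open>Switching times of the projected control as the step size decreases\<close>

text \<open>
  In this section \<open>\<tau> \<gamma> i\<close> is the \<open>i\<close>-th switching time at step size \<open>\<gamma>\<close>, and \<open>value_plus \<gamma>0 \<tau> i g\<close> is
  the value of \<open>g\<close> at the \<open>i\<close>-th switching time, in the limit from the right at \<open>\<gamma>0\<close>.
\<close>

definition time_plus :: "real \<Rightarrow> (real \<Rightarrow> nat \<Rightarrow> real) \<Rightarrow> nat \<Rightarrow> real" where
  "time_plus \<gamma>0 \<tau> i = Lim (at_right \<gamma>0) (\<lambda>\<gamma>. \<tau> \<gamma> i)"

definition value_plus :: "real \<Rightarrow> (real \<Rightarrow> nat \<Rightarrow> real) \<Rightarrow> nat \<Rightarrow> (real \<Rightarrow> real) \<Rightarrow> real" where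
  "value_plus \<gamma>0 \<tau> i g = Lim (at_right \<gamma>0) (\<lambda>\<gamma>. g (\<tau> \<gamma> i))"

text \<open>
  The order of a moving switching time ranges over positive integers: the difference of the two
  gradient components itself has absolute value \<open>1 / \<gamma>\<close> there. If no derivative is nonzero, the
  type is infinite.
\<close>

definition switch_type ::
  "(real \<Rightarrow> real ^ 'k::finite) \<Rightarrow> real \<Rightarrow> (nat \<Rightarrow> 'k) \<Rightarrow> (real \<Rightarrow> nat \<Rightarrow> real) \<Rightarrow> nat \<Rightarrow> enat" where
  "switch_type d \<gamma>0 \<sigma> \<tau> i =
     (if \<exists>c. \<forall>\<^sub>F \<gamma> in at_right \<gamma>0. \<tau> \<gamma> i = c then 0
      else Inf (enat ` {m. 1 \<le> m \<and>
             value_plus \<gamma>0 \<tau> i ((deriv ^^ m) (\<lambda>t. d t $ \<sigma> i - d t $ \<sigma> (i + 1))) \<noteq> 0}))"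

definition switch_side :: "real \<Rightarrow> (real \<Rightarrow> nat \<Rightarrow> real) \<Rightarrow> nat \<Rightarrow> nat" where
  "switch_side \<gamma>0 \<tau> i =
     (if \<forall>\<^sub>F \<gamma> in at_right \<gamma>0. \<tau> \<gamma> i > time_plus \<gamma>0 \<tau> i then 0
      else if \<forall>\<^sub>F \<gamma> in at_right \<gamma>0. \<tau> \<gamma> i < time_plus \<gamma>0 \<tau> i then 1
      else undefined)"

end

theory Submission
  imports Defs
begin

text \<open>
Let \<open>\<theta>\<close> be the infimum of the insertion gradient \<open>d\<close> and \<open>\<gamma>0 = - 1 / \<theta>\<close>. Where mode \<open>s\<close> is active the
component \<open>d\<^sub>s\<close> vanishes, so the vector \<open>u - \<gamma> d\<close> has the entry 1 at \<open>s\<close> and \<open>- \<gamma> d\<^sub>a\<close> at the other modes. The projected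
control therefore leaves \<open>u\<close> exactly where some component of \<open>d\<close> is below \<open>- 1 / \<gamma>\<close>. As \<open>\<gamma>\<close> decreases to
\<open>\<gamma>0\<close>, this threshold decreases to \<open>\<theta>\<close>, and the measure \<open>\<epsilon> \<gamma>\<close> of the set where the controls differ tends to 0.

The adjoint turns the cost difference, to first order, into the integral over this set of the component of \<open>d\<close>
that belongs to the inserted mode. As this component is below \<open>- 1 / \<gamma>\<close>, one obtains
\<open>J \<gamma> - J 0 \<le> - \<epsilon> \<gamma> / \<gamma> + C (\<epsilon> \<gamma>)\<^sup>2\<close> (\<open>cost_expansion\<close>, \<open>descent_estimate\<close>). The existence of the perturbed trajectory up to time
\<open>T\<close> is part of the argument (\<open>perturbed_trajectory\<close>), since the fields may grow quadratically.

It remains to bound \<open>\<epsilon> \<gamma>\<close> from below in terms of the switching times of type 2. The interval is cut at finitely many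
times (\<open>refined_partition\<close>) such that on each gap the components of \<open>d\<close> are \<open>C\<^sup>2\<close> up to the end points, keep their order, and
differ by strictly monotone functions. On a gap the projected control then differs from \<open>u\<close> at most on one interval of length \<open>r \<gamma>\<close> next to
an end \<open>z\<close> at which the smallest component attains \<open>\<theta>\<close> as a limit (\<open>gap_dichotomy\<close>). The switching points are
thus some fixed points and one moving edge \<open>z \<plusminus> r \<gamma>\<close> for each active gap, in an order that does not depend on \<open>\<gamma>\<close>.
Comparing orders, each switching time of the given schedules is one of these as a function of
\<open>\<gamma>\<close> (\<open>schedule_times_transport\<close>), which also shows that the limits in the definitions of the types exist where they are needed.

At an edge of type 2 the first derivative of the inserted component vanishes at \<open>z\<close> and the second one is \<open>D2 i\<close>, so
\<open>r \<gamma> / sqrt (\<gamma> - \<gamma>0)\<close> tends to \<open>sqrt 2 * \<bar>\<theta>\<bar> / sqrt (D2 i)\<close> (\<open>edge_rate\<close>). Summing over the type 2 edges, the upper bound of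
\<open>(J \<gamma> - J 0) / sqrt (\<gamma> - \<gamma>0)\<close> tends to at most \<open>s2 < 0\<close> (\<open>armijo_eventually\<close>). As \<open>\<alpha> < 1\<close>, the test is passed by all
\<open>\<gamma> > \<gamma>0\<close> close to \<open>\<gamma>0\<close>, and the steps \<open>\<gamma> j\<close> approach \<open>\<gamma>0\<close> from the right (\<open>armijo_steps\<close>).
\<close>


section \<open>Remainders and Lipschitz bounds of smooth maps\<close>

text \<open>
A bounded second derivative makes \<open>Dg\<close> Lipschitz with constant \<open>K\<close>; on the ball around \<open>x\<close> through \<open>y\<close>
the map \<open>z \<mapsto> g z - Dg x z\<close> then has derivative at most \<open>K * norm (y - x)\<close>. The constant is
twice the optimal one, which is harmless below.
\<close>

lemma quadratic_remainder:
  fixes g :: "'a::real_normed_vector \<Rightarrow> 'b::real_normed_vector"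
  assumes Dg: "\<And>x. (g has_derivative blinfun_apply (Dg x)) (at x)"
    and D2g: "\<And>x. (Dg has_derivative blinfun_apply (D2g x)) (at x)"
    and K: "\<And>x. norm (D2g x) \<le> K"
  shows "norm (g y - g x - blinfun_apply (Dg x) (y - x)) \<le> K * (norm (y - x))\<^sup>2"
proof -
  have K0: "0 \<le> K" using norm_ge_zero K order_trans by blast
  have lip: "norm (Dg z - Dg x) \<le> K * norm (z - x)" for z
    by (rule differentiable_bound[of UNIV Dg "\<lambda>x. blinfun_apply (D2g x)"])
      (use D2g K norm_blinfun.rep_eq in \<open>auto simp: norm_blinfun.rep_eq\<close>)
  let ?S = "cball x (norm (y - x))"
  have "norm ((g y - Dg x y) - (g x - Dg x x)) \<le> (K * norm (y - x)) * norm (y - x)"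
  proof (rule differentiable_bound[of ?S "\<lambda>z. g z - Dg x z" "\<lambda>z. blinfun_apply (Dg z - Dg x)"])
    show "((\<lambda>z. g z - Dg x z) has_derivative blinfun_apply (Dg z - Dg x)) (at z within ?S)" for z
      by (auto intro!: derivative_eq_intros has_derivative_at_withinI[OF Dg] simp: blinfun.bilinear_simps)
    show "onorm (blinfun_apply (Dg z - Dg x)) \<le> K * norm (y - x)" if "z \<in> ?S" for z
    proof -
      have "norm (Dg z - Dg x) \<le> K * norm (z - x)" by (rule lip)
      also have "\<dots> \<le> K * norm (y - x)"
        using that K0 by (intro mult_left_mono) (auto simp: dist_norm norm_minus_commute)
      finally show ?thesis by (simp add: norm_blinfun.rep_eq)
    qed
  qed (auto simp: dist_norm norm_minus_commute)
  then show ?thesis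
    by (simp add: blinfun.bilinear_simps power2_eq_square algebra_simps)
qed

lemma C1_lipschitz_on_cball:
  fixes g :: "'a::euclidean_space \<Rightarrow> 'b::real_normed_vector"
  assumes Dg: "\<And>x. (g has_derivative blinfun_apply (Dg x)) (at x)"
    and cont: "continuous_on UNIV Dg"
  shows "\<exists>L. \<forall>y\<in>cball 0 r. \<forall>z\<in>cball 0 r. norm (g y - g z) \<le> L * norm (y - z)"
proof -
  have "compact (Dg ` cball 0 r)"
    by (intro compact_continuous_image continuous_on_subset[OF cont]) auto
  then obtain L where L: "\<And>x. x \<in> cball 0 r \<Longrightarrow> norm (Dg x) \<le> L"
    using compact_imp_bounded bounded_iff by (metis image_eqI)
  have "norm (g y - g z) \<le> L * norm (y - z)" if "y \<in> cball 0 r" "z \<in> cball 0 r" for y z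
    by (rule differentiable_bound[of "cball 0 r" g "\<lambda>x. blinfun_apply (Dg x)"])
      (use that L in \<open>auto intro: has_derivative_at_withinI[OF Dg] simp: norm_blinfun.rep_eq[symmetric]\<close>)
  then show ?thesis by blast
qed

lemma continuous_on_Icc_bounded:
  fixes h :: "real \<Rightarrow> 'b::real_normed_vector"
  assumes "continuous_on {a..b} h"
  shows "\<exists>B. \<forall>t\<in>{a..b}. norm (h t) \<le> B"
  using compact_imp_bounded[OF compact_continuous_image[OF assms compact_Icc]]
  by (auto simp: bounded_iff)

section \<open>Integrands driven by finitely many switches\<close>

text \<open>
A control is represented by the function \<open>m\<close> from times to active modes. The finite set \<open>S\<close> of possible
switches is an explicit argument, since it is later chosen with more structure than a bare existence
statement would provide.
\<close>

definition constant_off :: "real \<Rightarrow> real set \<Rightarrow> (real \<Rightarrow> 'a) \<Rightarrow> bool" where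
  "constant_off T S m \<longleftrightarrow> finite S \<and>
     (\<forall>s t. 0 \<le> s \<and> s \<le> t \<and> t \<le> T \<and> {s..t} \<inter> S = {} \<longrightarrow> m s = m t)"

lemma constant_off_eq:
  assumes "constant_off T S m" "s \<in> {0..T}" "t \<in> {0..T}" "{min s t..max s t} \<inter> S = {}"
  shows "m s = m t"
proof (cases "s \<le> t")
  case True
  then show ?thesis using assms unfolding constant_off_def by (auto simp: min_def max_def)
next
  case False
  then have "m t = m s" using assms unfolding constant_off_def
    by (auto simp: min_def max_def)
  then show ?thesis by simp
qed

lemma constant_off_Pair:
  assumes "constant_off T S m" "constant_off T S' m'"
  shows "constant_off T (S \<union> S') (\<lambda>t. (m t, m' t))"
  using assms unfolding constant_off_def by (simp add: Int_Un_distrib)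

lemma constant_off_locally:
  assumes m: "constant_off T S m" and t: "t \<in> {0..T} - S"
  obtains e where "e > 0" "ball t e \<inter> S = {}" "\<And>s. s \<in> {0..T} \<Longrightarrow> \<bar>s - t\<bar> < e \<Longrightarrow> m s = m t"
proof -
  have "open (- S)" using m finite_imp_closed unfolding constant_off_def by blast
  then obtain e where e: "e > 0" "ball t e \<subseteq> - S"
    using t by (metis ComplI DiffD2 openE)
  have "m s = m t" if s: "s \<in> {0..T}" "\<bar>s - t\<bar> < e" for s
  proof (rule constant_off_eq[OF m])
    have "{min s t..max s t} \<subseteq> ball t e"
      using s(2) e by (auto simp: dist_real_def min_def max_def split: if_splits)
    then show "{min s t..max s t} \<inter> S = {}" using e by blast
  qed (use s t in auto)
  then show ?thesis using that e by blast
qed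

lemma continuous_on_switched:
  fixes G :: "'k \<Rightarrow> real \<Rightarrow> 'b::topological_space"
  assumes m: "constant_off T S m" and G: "\<And>k. continuous_on {0..T} (G k)"
  shows "continuous_on ({0..T} - S) (\<lambda>s. G (m s) s)"
proof (rule continuous_on_eq_continuous_within[THEN iffD2], rule ballI)
  fix t assume t: "t \<in> {0..T} - S"
  from m t obtain e where e: "e > 0" "ball t e \<inter> S = {}"
      "\<And>s. s \<in> {0..T} \<Longrightarrow> \<bar>s - t\<bar> < e \<Longrightarrow> m s = m t"
    by (rule constant_off_locally) blast
  have "((\<lambda>s. G (m t) s) \<longlongrightarrow> G (m t) t) (at t within {0..T} - S)"
    using G[of "m t"] t unfolding continuous_on_def
    by (meson DiffD1 Diff_subset tendsto_within_subset)
  then have "((\<lambda>s. G (m s) s) \<longlongrightarrow> G (m t) t) (at t within {0..T} - S)"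
    by (rule Lim_transform_within[OF _ e(1)]) (use e(3) in \<open>auto simp: dist_real_def\<close>)
  then show "continuous (at t within {0..T} - S) (\<lambda>s. G (m s) s)"
    by (simp add: continuous_within)
qed

text \<open>
This single lemma provides every integrability fact that follows: the integrand is continuous away from
finitely many times and bounded, because the finitely many branches are.
\<close>

lemma integrable_switched:
  fixes G :: "'k::finite \<Rightarrow> real \<Rightarrow> 'b::euclidean_space"
  assumes m: "constant_off T S m" and G: "\<And>k. continuous_on {0..T} (G k)"
  shows "(\<lambda>s. G (m s) s) absolutely_integrable_on {0..T}"
proof -
  obtain B where B: "\<And>k s. s \<in> {0..T} \<Longrightarrow> norm (G k s) \<le> B k"
    using continuous_on_Icc_bounded[OF G] by metis
  have fin: "finite S" using m by (simp add: constant_off_def)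
  have meas: "{0..T} - S \<in> sets lebesgue"
    by (intro sets.Diff negligible_imp_sets[OF negligible_finite[OF fin]]) auto
  have *: "(\<lambda>s. G (m s) s) absolutely_integrable_on ({0..T} - S)"
  proof (rule measurable_bounded_by_integrable_imp_absolutely_integrable)
    show "(\<lambda>s. G (m s) s) \<in> borel_measurable (lebesgue_on ({0..T} - S))"
      by (intro continuous_imp_measurable_on_sets_lebesgue continuous_on_switched[OF m G] meas)
    show "{0..T} - S \<in> sets lebesgue" by (rule meas)
    have "(\<lambda>s. \<Sum>k\<in>UNIV. \<bar>B k\<bar>) integrable_on {0..T}" by (rule integrable_const_ivl)
    then show "(\<lambda>s. \<Sum>k\<in>UNIV. \<bar>B k\<bar>) integrable_on ({0..T} - S)"
      by (rule integrable_spike_set)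
        (auto intro!: negligible_subset[OF negligible_finite[OF fin]])
    show "norm (G (m s) s) \<le> (\<Sum>k\<in>UNIV. \<bar>B k\<bar>)" if "s \<in> {0..T} - S" for s
    proof -
      have "norm (G (m s) s) \<le> \<bar>B (m s)\<bar>" using B[of s "m s"] that by auto
      also have "\<dots> \<le> (\<Sum>k\<in>UNIV. \<bar>B k\<bar>)" by (rule member_le_sum) auto
      finally show ?thesis .
    qed
  qed
  show ?thesis
    by (rule absolutely_integrable_spike_set_eq[THEN iffD1, OF _ _ *])
      (auto intro!: negligible_subset[OF negligible_finite[OF fin]])
qed

text \<open>
At the maximum \<open>W\<close> of \<open>exp (- 2 L t) q t\<close> the integral inequality
gives \<open>W \<le> E + W / 2\<close>. The price of this short argument, compared with the classical bound, is the factor 2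
in front of \<open>E\<close> and in the exponent.
\<close>

lemma weak_gronwall:
  fixes q :: "real \<Rightarrow> real"
  assumes q: "continuous_on {0..T} q" and L: "L > 0"
    and le: "\<And>t. t \<in> {0..T} \<Longrightarrow> q t \<le> E + integral {0..t} (\<lambda>s. L * q s)"
    and E: "0 \<le> E"
    and t: "t \<in> {0..T}"
  shows "q t \<le> 2 * E * exp (2 * L * t)"
proof -
  have "\<exists>a\<in>{0..T}. \<forall>s\<in>{0..T}. exp (- 2 * L * s) * q s \<le> exp (- 2 * L * a) * q a"
    by (intro continuous_attains_sup continuous_intros q) (use t in auto)
  then obtain a where a: "a \<in> {0..T}"
    and max: "\<And>s. s \<in> {0..T} \<Longrightarrow> exp (- 2 * L * s) * q s \<le> exp (- 2 * L * a) * q a" by blast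
  define W where "W = exp (- 2 * L * a) * q a"
  have qW: "q s \<le> W * exp (2 * L * s)" if "s \<in> {0..T}" for s
    using max[OF that] unfolding W_def by (simp add: exp_minus field_simps)
  show ?thesis
  proof (cases "W \<le> 0")
    case True
    then have "q t \<le> 0" using qW[OF t] by (meson exp_ge_zero mult_nonpos_nonneg order_trans)
    then show ?thesis using E by (smt (verit) exp_gt_zero mult_nonneg_nonneg)
  next
    case False
    have int: "((\<lambda>s. L * (W * exp (2 * L * s))) has_integral
        (W / 2 * exp (2 * L * a) - W / 2 * exp (2 * L * 0))) {0..a}"
      by (rule fundamental_theorem_of_calculus)
        (use a L in \<open>auto intro!: derivative_eq_intros simp: has_real_derivative_iff_has_vector_derivative[symmetric]\<close>)
    have "q a \<le> E + integral {0..a} (\<lambda>s. L * q s)" by (rule le[OF a])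
    also have "integral {0..a} (\<lambda>s. L * q s) \<le> integral {0..a} (\<lambda>s. L * (W * exp (2 * L * s)))"
    proof (rule integral_le)
      show "(\<lambda>s. L * q s) integrable_on {0..a}"
        by (intro integrable_continuous_real continuous_intros continuous_on_subset[OF q]) (use a in auto)
      show "(\<lambda>s. L * (W * exp (2 * L * s))) integrable_on {0..a}" using int by blast
    qed (use qW a L in auto)
    also have "\<dots> = W / 2 * exp (2 * L * a) - W / 2"
      unfolding integral_unique[OF int] by simp
    finally have "q a \<le> E + W / 2 * exp (2 * L * a)" using False by linarith
    then have "W \<le> exp (- 2 * L * a) * (E + W / 2 * exp (2 * L * a))"
      unfolding W_def by (intro mult_left_mono) auto
    also have "\<dots> = exp (- 2 * L * a) * E + W / 2" by (simp add: exp_minus field_simps)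
    finally have "W \<le> 2 * (exp (- 2 * L * a) * E)" by simp
    also have "\<dots> \<le> 2 * E" using E a L by (simp add: mult_left_le_one_le)
    finally have "W \<le> 2 * E" .
    then show ?thesis using qW[OF t] by (smt (verit) exp_gt_zero mult_right_mono)
  qed
qed

section \<open>State trajectories and their dependence on the control\<close>

definition trajectory ::
  "('k::finite \<Rightarrow> 'a \<Rightarrow> 'a) \<Rightarrow> 'a \<Rightarrow> real \<Rightarrow> (real \<Rightarrow> 'k) \<Rightarrow> (real \<Rightarrow> 'a::euclidean_space) \<Rightarrow> bool" where
  "trajectory f x0 T m x \<longleftrightarrow> continuous_on {0..T} x \<and>
     (\<forall>t\<in>{0..T}. ((\<lambda>s. f (m s) (x s)) has_integral (x t - x0)) {0..t})"

lemma trajectory_unique_lipschitz: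
  fixes f :: "'k::finite \<Rightarrow> 'a \<Rightarrow> 'a::euclidean_space"
  assumes x: "trajectory f x0 T m x" and y: "trajectory f x0 T m y"
    and L: "L > 0"
    and lip: "\<And>k s. s \<in> {0..T} \<Longrightarrow> norm (f k (y s) - f k (x s)) \<le> L * norm (y s - x s)"
    and t: "t \<in> {0..T}"
  shows "y t = x t"
proof -
  have cx: "continuous_on {0..T} x" and cy: "continuous_on {0..T} y"
    using x y by (auto simp: trajectory_def)
  have "norm (y t - x t) \<le> 2 * 0 * exp (2 * L * t)"
  proof (rule weak_gronwall[OF _ L _ _ t])
    show "continuous_on {0..T} (\<lambda>t. norm (y t - x t))" by (intro continuous_intros cx cy)
    fix t assume t: "t \<in> {0..T}"
    have int: "((\<lambda>s. f (m s) (y s) - f (m s) (x s)) has_integral (y t - x t)) {0..t}"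
      using has_integral_diff[of _ "y t - x0" "{0..t}" _ "x t - x0"] x y t
      by (fastforce simp: trajectory_def)
    have "norm (y t - x t) = norm (integral {0..t} (\<lambda>s. f (m s) (y s) - f (m s) (x s)))"
      using int by (simp add: integral_unique)
    also have "\<dots> \<le> integral {0..t} (\<lambda>s. L * norm (y s - x s))"
    proof (rule integral_norm_bound_integral)
      show "(\<lambda>s. L * norm (y s - x s)) integrable_on {0..t}"
        using t by (intro integrable_continuous_real continuous_intros
            continuous_on_subset[OF cx] continuous_on_subset[OF cy]) auto
    qed (use int lip t in auto)
    finally show "norm (y t - x t) \<le> 0 + integral {0..t} (\<lambda>s. L * norm (y s - x s))" by simp
  qed auto
  then show ?thesis by simp
qed

definition locally_lipschitz :: "('k \<Rightarrow> 'a \<Rightarrow> 'a::real_normed_vector) \<Rightarrow> bool" where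
  "locally_lipschitz f \<longleftrightarrow>
     (\<forall>k r. \<exists>L. \<forall>y\<in>cball 0 r. \<forall>z\<in>cball 0 r. norm (f k y - f k z) \<le> L * norm (y - z))"

lemma locally_lipschitz_uniform:
  fixes f :: "'k::finite \<Rightarrow> 'a \<Rightarrow> 'a::real_normed_vector"
  assumes "locally_lipschitz f"
  obtains L where "L > 0"
    "\<And>k y z. y \<in> cball 0 r \<Longrightarrow> z \<in> cball 0 r \<Longrightarrow> norm (f k y - f k z) \<le> L * norm (y - z)"
proof -
  have "\<forall>k. \<exists>L. \<forall>y\<in>cball 0 r. \<forall>z\<in>cball 0 r. norm (f k y - f k z) \<le> L * norm (y - z)"
    using assms unfolding locally_lipschitz_def by blast
  from choice[OF this] obtain L where
    L: "\<And>k y z. y \<in> cball 0 r \<Longrightarrow> z \<in> cball 0 r \<Longrightarrow> norm (f k y - f k z) \<le> L k * norm (y - z)"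
    by blast
  let ?L = "1 + (\<Sum>k\<in>UNIV. \<bar>L k\<bar>)"
  show ?thesis
  proof (rule that[of ?L])
    show "?L > 0" by (simp add: add_pos_nonneg sum_nonneg)
    fix k :: 'k and y z :: 'a assume yz: "y \<in> cball 0 r" "z \<in> cball 0 r"
    have "\<bar>L k\<bar> \<le> (\<Sum>k\<in>UNIV. \<bar>L k\<bar>)" by (rule member_le_sum) auto
    then have "L k \<le> ?L" by linarith
    then show "norm (f k y - f k z) \<le> ?L * norm (y - z)"
      using L[OF yz, of k] by (meson mult_right_mono norm_ge_zero order_trans)
  qed
qed

lemma trajectory_unique:
  fixes f :: "'k::finite \<Rightarrow> 'a \<Rightarrow> 'a::euclidean_space"
  assumes f: "locally_lipschitz f"
    and x: "trajectory f x0 T m x" and y: "trajectory f x0 T m y"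
    and t: "t \<in> {0..T}"
  shows "y t = x t"
proof -
  have "compact (x ` {0..T} \<union> y ` {0..T})"
    using x y by (auto simp: trajectory_def intro!: compact_Un compact_continuous_image)
  then have "bounded (x ` {0..T} \<union> y ` {0..T})" by (rule compact_imp_bounded)
  then obtain r where "\<forall>z\<in>x ` {0..T} \<union> y ` {0..T}. norm z \<le> r" unfolding bounded_iff by blast
  then have r: "x s \<in> cball 0 r" "y s \<in> cball 0 r" if "s \<in> {0..T}" for s
    using that by auto
  obtain L where "L > 0"
    "\<And>k y z. y \<in> cball 0 r \<Longrightarrow> z \<in> cball 0 r \<Longrightarrow> norm (f k y - f k z) \<le> L * norm (y - z)"
    using locally_lipschitz_uniform[OF f] by metis
  then show ?thesis using trajectory_unique_lipschitz[OF x y _ _ t, of L] r by blast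
qed

text \<open>
The integral operator is a contraction with factor 1/2 in the norm weighted by \<open>exp (- 2 L t)\<close>. To use
Banach's theorem on bounded continuous functions, the unknown is the weighted function \<open>w t = exp (- 2 L t) x t\<close>,
extended to the whole line by the retraction \<open>c\<close> onto \<open>{0..T}\<close>.
\<close>

lemma global_trajectory:
  fixes f :: "'k::finite \<Rightarrow> 'a \<Rightarrow> 'a::euclidean_space"
  assumes T: "T > 0" and m: "constant_off T S m" and L: "L > 0"
    and lip: "\<And>k y z. norm (f k y - f k z) \<le> L * norm (y - z)"
  obtains x where "trajectory f x0 T m x"
proof -
  define c where "c = (\<lambda>t. max 0 (min T t))"
  have c: "c t \<in> {0..T}" for t using T by (auto simp: c_def)
  have c_id: "c t = t" if "t \<in> {0..T}" for t using that by (auto simp: c_def)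
  have cf: "continuous_on A (f k)" for k A
    by (rule lipschitz_on_continuous_on[of L]) (use L lip in \<open>auto simp: lipschitz_on_def dist_norm\<close>)
  define R where "R = (\<lambda>(w :: real \<Rightarrow>\<^sub>C 'a) s. f (m s) (exp (2 * L * s) *\<^sub>R w s))"
  have R_int: "R w integrable_on {0..T}" for w
  proof -
    have "(\<lambda>s. (\<lambda>k s. f k (exp (2 * L * s) *\<^sub>R w s)) (m s) s) absolutely_integrable_on {0..T}"
      by (rule integrable_switched[OF m])
        (auto intro!: continuous_intros continuous_on_compose2[OF cf[of UNIV]])
    then show ?thesis unfolding R_def using set_lebesgue_integral_eq_integral(1) by auto
  qed
  have R_int': "R w integrable_on {0..t}" if "t \<in> {0..T}" for w t
    using integrable_subinterval_real[OF R_int] that by auto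
  define P where "P = (\<lambda>w t. exp (- 2 * L * t) *\<^sub>R (x0 + integral {0..t} (R w)))"
  have cP: "continuous_on {0..T} (P w)" for w
    unfolding P_def by (intro continuous_intros indefinite_integral_continuous_1 R_int)
  have bP: "(\<lambda>t. P w (c t)) \<in> bcontfun" for w
  proof -
    obtain b where b: "\<And>t. t \<in> {0..T} \<Longrightarrow> norm (P w t) \<le> b"
      using continuous_on_Icc_bounded[OF cP] by blast
    show ?thesis
    proof (rule bcontfun_normI)
      show "continuous_on UNIV (\<lambda>t. P w (c t))"
        by (rule continuous_on_compose2[OF cP]) (use c in \<open>auto simp: c_def intro!: continuous_intros\<close>)
    qed (use b c in auto)
  qed
  define Q where "Q = (\<lambda>w. Bcontfun (\<lambda>t. P w (c t)))"
  have Q: "Q w t = P w (c t)" for w t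
    unfolding Q_def using bP by (simp add: Bcontfun_inverse)
  have "dist (Q v) (Q w) \<le> 1/2 * dist v w" for v w
  proof (rule dist_bound)
    fix t0
    define t where "t = c t0"
    have t: "t \<in> {0..T}" unfolding t_def by (rule c)
    let ?D = "dist v w"
    have int: "((\<lambda>s. L * (exp (2 * L * s) * ?D)) has_integral
        (?D / 2 * exp (2 * L * t) - ?D / 2 * exp (2 * L * 0))) {0..t}"
      by (rule fundamental_theorem_of_calculus)
        (use t L in \<open>auto intro!: derivative_eq_intros simp: has_real_derivative_iff_has_vector_derivative[symmetric]\<close>)
    have "dist (Q v t0) (Q w t0) = norm (exp (- 2 * L * t) *\<^sub>R (integral {0..t} (\<lambda>s. R v s - R w s)))"
      unfolding Q t_def[symmetric] dist_norm P_def
      using R_int'[OF t] by (simp add: integral_diff algebra_simps)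
    also have "\<dots> = exp (- 2 * L * t) * norm (integral {0..t} (\<lambda>s. R v s - R w s))" by simp
    also have "norm (integral {0..t} (\<lambda>s. R v s - R w s)) \<le> integral {0..t} (\<lambda>s. L * (exp (2 * L * s) * ?D))"
    proof (rule integral_norm_bound_integral)
      show "(\<lambda>s. R v s - R w s) integrable_on {0..t}" by (intro integrable_diff R_int' t)
      show "(\<lambda>s. L * (exp (2 * L * s) * ?D)) integrable_on {0..t}" using int by blast
      fix s assume "s \<in> {0..t}"
      have "norm (R v s - R w s) \<le> L * norm (exp (2 * L * s) *\<^sub>R v s - exp (2 * L * s) *\<^sub>R w s)"
        unfolding R_def by (rule lip)
      also have "\<dots> = L * (exp (2 * L * s) * dist (v s) (w s))"
        by (simp add: scaleR_diff_right[symmetric] dist_norm del: scaleR_diff_right)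
      also have "\<dots> \<le> L * (exp (2 * L * s) * ?D)"
        using L by (intro mult_left_mono dist_bounded) auto
      finally show "norm (R v s - R w s) \<le> L * (exp (2 * L * s) * ?D)" .
    qed
    also have "\<dots> = ?D / 2 * exp (2 * L * t) - ?D / 2" unfolding integral_unique[OF int] by simp
    finally have "dist (Q v t0) (Q w t0) \<le> exp (- 2 * L * t) * (?D / 2 * exp (2 * L * t) - ?D / 2)"
      by simp
    also have "\<dots> \<le> exp (- 2 * L * t) * (?D / 2 * exp (2 * L * t))" by (intro mult_left_mono) auto
    also have "\<dots> = 1/2 * ?D" by (simp add: exp_minus)
    finally show "dist (Q v t0) (Q w t0) \<le> 1/2 * ?D" .
  qed
  then obtain w where w: "Q w = w"
    using banach_fix_type[of "1/2" Q] by auto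
  define x where "x = (\<lambda>t. exp (2 * L * t) *\<^sub>R w t)"
  have xR: "f (m s) (x s) = R w s" for s by (simp add: x_def R_def)
  have xt: "x t = x0 + integral {0..t} (R w)" if "t \<in> {0..T}" for t
  proof -
    have "w t = P w t" using Q[of w t] by (simp add: w c_id[OF that])
    then show ?thesis by (simp add: x_def P_def exp_minus)
  qed
  have "trajectory f x0 T m x"
    unfolding trajectory_def
  proof (intro conjI ballI)
    show "continuous_on {0..T} x" unfolding x_def by (intro continuous_intros) auto
    show "((\<lambda>s. f (m s) (x s)) has_integral (x t - x0)) {0..t}" if "t \<in> {0..T}" for t
      using integrable_integral[OF R_int'[OF that, of w]] by (simp add: xR xt[OF that])
  qed
  then show ?thesis by (rule that)
qed

text \<open>
The measure of the set of times at which two mode functions differ, as an integral.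
\<close>

definition switch_distance :: "real \<Rightarrow> (real \<Rightarrow> 'k) \<Rightarrow> (real \<Rightarrow> 'k) \<Rightarrow> real" where
  "switch_distance T m m' = integral {0..T} (\<lambda>t. if m' t = m t then 0 else 1)"

lemma mismatch_integrable:
  fixes m m' :: "real \<Rightarrow> 'k::finite"
  assumes m: "constant_off T S m" and m': "constant_off T S' m'"
  shows "(\<lambda>t. if m' t = m t then 0 else 1::real) integrable_on {0..T}"
proof -
  have "(\<lambda>t. (\<lambda>(a, b) t. if b = a then 0 else 1::real) (m t, m' t) t) absolutely_integrable_on {0..T}"
    by (rule integrable_switched[OF constant_off_Pair[OF m m']]) auto
  then show ?thesis using set_lebesgue_integral_eq_integral(1) by auto
qed

lemma switch_distance_nonneg: "0 \<le> switch_distance T m m'"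
  unfolding switch_distance_def
  by (cases "(\<lambda>t. if m' t = m t then 0 else 1::real) integrable_on {0..T}")
    (auto intro!: integral_nonneg simp: not_integrable_integral)

text \<open>
The fields are only locally Lipschitz, so a trajectory could blow up before \<open>T\<close>; existence must be part of the
conclusion. The fields are therefore made globally Lipschitz by projecting their argument onto a ball that contains
the nominal trajectory with margin 1. The trajectory of the truncated system stays within
\<open>C\<close> times the switch distance of the nominal one, hence inside the ball if that distance is small, where the
truncation has no effect.
\<close>

lemma perturbed_trajectory:
  fixes f :: "'k::finite \<Rightarrow> 'a \<Rightarrow> 'a::euclidean_space"
  assumes T: "T > 0" and f: "locally_lipschitz f"
    and m: "constant_off T S m" and x: "trajectory f x0 T m x"
  obtains C e where "C \<ge> 0" "e > 0"
    "\<And>m' S'. constant_off T S' m' \<Longrightarrow> switch_distance T m m' < e \<Longrightarrow>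
       \<exists>y. trajectory f x0 T m' y \<and> (\<forall>t\<in>{0..T}. norm (y t - x t) \<le> C * switch_distance T m m')"
proof -
  have cx: "continuous_on {0..T} x" using x by (simp add: trajectory_def)
  obtain r where r: "\<And>t. t \<in> {0..T} \<Longrightarrow> norm (x t) \<le> r"
    using continuous_on_Icc_bounded[OF cx] by blast
  define B where "B = cball (0::'a) (r + 1)"
  obtain L where L: "L > 0"
    and lip: "\<And>k y z. y \<in> B \<Longrightarrow> z \<in> B \<Longrightarrow> norm (f k y - f k z) \<le> L * norm (y - z)"
    unfolding B_def using locally_lipschitz_uniform[OF f] by metis
  have xB: "x t \<in> B" if "t \<in> {0..T}" for t using r[OF that] by (auto simp: B_def)
  have "0 \<in> {0..T}" using T by simp
  then have B0: "B \<noteq> {}" using xB by blast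
  \<comment> \<open>The nearest-point projection onto a convex set is nonexpansive, so truncation keeps the constant \<open>L\<close>.\<close>
  define g where "g = (\<lambda>k y. f k (closest_point B y))"
  have gf: "g k y = f k y" if "y \<in> B" for k y using that by (simp add: g_def closest_point_self)
  have glip: "norm (g k y - g k z) \<le> L * norm (y - z)" for k y z
  proof -
    have B: "convex B" "closed B" by (auto simp: B_def)
    have "norm (g k y - g k z) \<le> L * norm (closest_point B y - closest_point B z)"
      unfolding g_def by (intro lip closest_point_in_set B B0)
    also have "\<dots> \<le> L * norm (y - z)"
      using closest_point_lipschitz[OF B B0, of y z] L by (simp add: dist_norm)
    finally show ?thesis .
  qed
  have "\<exists>b. \<forall>t\<in>{0..T}. norm (f k (x t) - f j (x t)) \<le> b" for k j
  proof -
    have cf: "continuous_on B (f k)" for k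
      by (rule lipschitz_on_continuous_on[of L]) (use L lip in \<open>auto simp: lipschitz_on_def dist_norm\<close>)
    show ?thesis
      by (intro continuous_on_Icc_bounded continuous_intros continuous_on_compose2[OF cf cx])
        (use xB in auto)
  qed
  then obtain b where b: "\<And>k j t. t \<in> {0..T} \<Longrightarrow> norm (f k (x t) - f j (x t)) \<le> b k j" by metis
  define bb where "bb = (\<Sum>(k, j)\<in>UNIV. \<bar>b k j\<bar>)"
  have bb: "norm (f k (x t) - f j (x t)) \<le> bb" if "t \<in> {0..T}" for k j t
  proof -
    have "(\<lambda>(k, j). \<bar>b k j\<bar>) (k, j) \<le> bb" unfolding bb_def by (rule member_le_sum) auto
    then show ?thesis using b[OF that, of k j] by simp
  qed
  have bb0: "bb \<ge> 0" unfolding bb_def by (auto intro: sum_nonneg)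
  define C where "C = 2 * bb * exp (2 * L * T)"
  have C0: "C \<ge> 0" using bb0 by (simp add: C_def)
  show ?thesis
  proof (rule that[of C "1 / (C + 1)"])
    fix m' S' assume m': "constant_off T S' m'" and small: "switch_distance T m m' < 1 / (C + 1)"
    let ?\<epsilon> = "switch_distance T m m'"
    let ?\<chi> = "\<lambda>t. if m' t = m t then 0 else 1::real"
    have \<epsilon>0: "0 \<le> ?\<epsilon>" by (rule switch_distance_nonneg)
    have Csmall: "C * ?\<epsilon> \<le> 1"
    proof -
      have "C * ?\<epsilon> \<le> C * (1 / (C + 1))" using small C0 by (intro mult_left_mono) auto
      also have "\<dots> \<le> 1" using C0 by simp
      finally show ?thesis .
    qed
    obtain y where y: "trajectory g x0 T m' y" by (rule global_trajectory[OF T m' L glip])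
    have cy: "continuous_on {0..T} y" using y by (simp add: trajectory_def)
    have est: "norm (y t - x t) \<le> C * ?\<epsilon>" if t: "t \<in> {0..T}" for t
    proof -
      have "norm (y t - x t) \<le> 2 * (bb * ?\<epsilon>) * exp (2 * L * t)"
      proof (rule weak_gronwall[OF _ L _ _ t])
        show "continuous_on {0..T} (\<lambda>t. norm (y t - x t))" by (intro continuous_intros cx cy)
        show "0 \<le> bb * ?\<epsilon>" using bb0 \<epsilon>0 by simp
        fix t assume t: "t \<in> {0..T}"
        have int: "((\<lambda>s. g (m' s) (y s) - f (m s) (x s)) has_integral (y t - x t)) {0..t}"
          using has_integral_diff[of _ "y t - x0" "{0..t}" _ "x t - x0"] x y t
          by (fastforce simp: trajectory_def)
        have \<chi>: "?\<chi> integrable_on {0..T}" by (rule mismatch_integrable[OF m m'])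
        then have \<chi>t: "?\<chi> integrable_on {0..t}" using t integrable_subinterval_real by fastforce
        have dl: "(\<lambda>s. L * norm (y s - x s)) integrable_on {0..t}"
          using t by (intro integrable_continuous_real continuous_intros
            continuous_on_subset[OF cx] continuous_on_subset[OF cy]) auto
        have "norm (y t - x t) = norm (integral {0..t} (\<lambda>s. g (m' s) (y s) - f (m s) (x s)))"
          using int by (simp add: integral_unique)
        also have "\<dots> \<le> integral {0..t} (\<lambda>s. bb * ?\<chi> s + L * norm (y s - x s))"
        proof (rule integral_norm_bound_integral)
          show "(\<lambda>s. bb * ?\<chi> s + L * norm (y s - x s)) integrable_on {0..t}"
            by (intro integrable_add dl integrable_on_mult_right \<chi>t)
          fix s assume "s \<in> {0..t}"
          then have s: "s \<in> {0..T}" using t by auto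
          have "norm (g (m' s) (y s) - f (m s) (x s))
              \<le> norm (g (m' s) (y s) - g (m' s) (x s)) + norm (f (m' s) (x s) - f (m s) (x s))"
            using norm_triangle_ineq[of "g (m' s) (y s) - g (m' s) (x s)" "f (m' s) (x s) - f (m s) (x s)"]
            by (simp add: gf[OF xB[OF s]])
          also have "norm (f (m' s) (x s) - f (m s) (x s)) \<le> bb * ?\<chi> s" using bb[OF s] by simp
          also have "norm (g (m' s) (y s) - g (m' s) (x s)) \<le> L * norm (y s - x s)" by (rule glip)
          finally show "norm (g (m' s) (y s) - f (m s) (x s)) \<le> bb * ?\<chi> s + L * norm (y s - x s)"
            by simp
        qed (use int in auto)
        also have "\<dots> = bb * integral {0..t} ?\<chi> + integral {0..t} (\<lambda>s. L * norm (y s - x s))"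
          by (subst integral_add[OF integrable_on_mult_right[OF \<chi>t] dl]) simp
        also have "integral {0..t} ?\<chi> \<le> ?\<epsilon>"
          unfolding switch_distance_def by (rule integral_subset_le) (use t \<chi> \<chi>t in auto)
        then have "bb * integral {0..t} ?\<chi> \<le> bb * ?\<epsilon>" using bb0 by (rule mult_left_mono)
        finally show "norm (y t - x t) \<le> bb * ?\<epsilon> + integral {0..t} (\<lambda>s. L * norm (y s - x s))" by simp
      qed
      also have "\<dots> \<le> 2 * (bb * ?\<epsilon>) * exp (2 * L * T)"
        using t L bb0 \<epsilon>0 by (intro mult_left_mono) auto
      also have "\<dots> = C * ?\<epsilon>" by (simp add: C_def)
      finally show ?thesis .
    qed
    have yB: "y t \<in> B" if "t \<in> {0..T}" for t
      using norm_triangle_ineq[of "x t" "y t - x t"] est[OF that] r[OF that] Csmall by (simp add: B_def)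
    have "trajectory f x0 T m' y"
      unfolding trajectory_def
    proof (intro conjI ballI cy)
      fix t assume t: "t \<in> {0..T}"
      then have "((\<lambda>s. g (m' s) (y s)) has_integral (y t - x0)) {0..t}"
        using y by (simp add: trajectory_def)
      then show "((\<lambda>s. f (m' s) (y s)) has_integral (y t - x0)) {0..t}"
        by (rule has_integral_eq[rotated]) (use t gf yB in auto)
    qed
    then show "\<exists>y. trajectory f x0 T m' y \<and> (\<forall>t\<in>{0..T}. norm (y t - x t) \<le> C * ?\<epsilon>)"
      using est by blast
  qed (use C0 in auto)
qed

section \<open>The cost difference through the adjoint\<close>

text \<open>
The state equation is integrated from time 0 and the adjoint equation from time \<open>T\<close>; increments between
two arbitrary times treat both alike.
\<close>

definition primitive :: "real \<Rightarrow> (real \<Rightarrow> 'a::real_normed_vector) \<Rightarrow> (real \<Rightarrow> 'a) \<Rightarrow> bool" where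
  "primitive T \<phi> X \<longleftrightarrow> (\<forall>p t. 0 \<le> p \<and> p \<le> t \<and> t \<le> T \<longrightarrow> (\<phi> has_integral (X t - X p)) {p..t})"

lemma primitive_from_start:
  fixes X :: "real \<Rightarrow> 'a::banach"
  assumes "\<And>t. t \<in> {0..T} \<Longrightarrow> (\<phi> has_integral (X t - c)) {0..t}"
  shows "primitive T \<phi> X"
  unfolding primitive_def
proof (intro allI impI)
  fix p t assume pt: "0 \<le> p \<and> p \<le> t \<and> t \<le> T"
  have t: "(\<phi> has_integral (X t - c)) {0..t}" and p: "(\<phi> has_integral (X p - c)) {0..p}"
    using assms pt by auto
  have int: "\<phi> integrable_on {0..t}" using t by blast
  have "integral {0..p} \<phi> + integral {p..t} \<phi> = integral {0..t} \<phi>"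
    using Henstock_Kurzweil_Integration.integral_combine[OF _ _ int, of p] pt by auto
  then have "integral {p..t} \<phi> = X t - X p"
    using integral_unique[OF t] integral_unique[OF p] by (simp add: algebra_simps)
  moreover have "\<phi> integrable_on {p..t}"
    using integrable_subinterval_real[OF int] pt by auto
  ultimately show "(\<phi> has_integral (X t - X p)) {p..t}" by (metis integrable_integral)
qed

lemma primitive_to_end:
  fixes X :: "real \<Rightarrow> 'a::banach"
  assumes "\<And>t. t \<in> {0..T} \<Longrightarrow> (\<phi> has_integral (c - X t)) {t..T}"
  shows "primitive T \<phi> X"
  unfolding primitive_def
proof (intro allI impI)
  fix p t assume pt: "0 \<le> p \<and> p \<le> t \<and> t \<le> T"
  have t: "(\<phi> has_integral (c - X t)) {t..T}" and p: "(\<phi> has_integral (c - X p)) {p..T}"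
    using assms pt by auto
  have int: "\<phi> integrable_on {p..T}" using p by blast
  have "integral {p..t} \<phi> + integral {t..T} \<phi> = integral {p..T} \<phi>"
    using Henstock_Kurzweil_Integration.integral_combine[OF _ _ int, of t] pt by auto
  then have "integral {p..t} \<phi> = X t - X p"
    using integral_unique[OF t] integral_unique[OF p] by (simp add: algebra_simps)
  moreover have "\<phi> integrable_on {p..t}"
    using integrable_subinterval_real[OF int] pt by auto
  ultimately show "(\<phi> has_integral (X t - X p)) {p..t}" by (metis integrable_integral)
qed

lemma primitive_continuous:
  fixes X :: "real \<Rightarrow> 'a::banach"
  assumes "primitive T \<phi> X" "0 \<le> T"
  shows "continuous_on {0..T} X"
proof -
  have X: "(\<phi> has_integral (X t - X 0)) {0..t}" if "t \<in> {0..T}" for t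
    using assms that by (auto simp: primitive_def)
  have "continuous_on {0..T} (\<lambda>t. X 0 + integral {0..t} \<phi>)"
    using X[of T] assms by (intro continuous_intros indefinite_integral_continuous_1) auto
  then show ?thesis
    by (rule continuous_on_eq) (use integral_unique[OF X] in auto)
qed

lemma primitive_derivative:
  fixes X :: "real \<Rightarrow> 'a::banach"
  assumes X: "primitive T \<phi> X" and pq: "0 \<le> p" "q \<le> T"
    and \<psi>: "continuous_on {p..q} \<psi>" and eq: "\<And>s. s \<in> {p<..<q} \<Longrightarrow> \<phi> s = \<psi> s"
    and t: "t \<in> {p..q}"
  shows "(X has_vector_derivative \<psi> t) (at t within {p..q})"
proof -
  have eqX: "X s = X p + integral {p..s} \<psi>" if s: "s \<in> {p..q}" for s
  proof -
    have "(\<phi> has_integral (X s - X p)) {p..s}" using X s pq by (auto simp: primitive_def)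
    then have "(\<psi> has_integral (X s - X p)) {p..s}"
      by (rule has_integral_spike_finite[of "{p, q}", rotated 2]) (use eq s in auto)
    then show ?thesis by (simp add: integral_unique)
  qed
  have "((\<lambda>s. X p + integral {p..s} \<psi>) has_vector_derivative \<psi> t) (at t within {p..q})"
    using has_vector_derivative_add[OF has_vector_derivative_const
        integral_has_vector_derivative[OF \<psi> t], of "X p"] by simp
  then show ?thesis by (rule has_vector_derivative_transform[OF t eqX, rotated])
qed

lemma primitive_derivative_switched:
  fixes X :: "real \<Rightarrow> 'a::banach" and G :: "'k \<Rightarrow> real \<Rightarrow> 'a"
  assumes X: "primitive T \<phi> X" and m: "constant_off T S m"
    and G: "\<And>k. continuous_on {0..T} (G k)"
    and eq: "\<And>s. s \<in> {0..T} - S \<Longrightarrow> \<phi> s = G (m s) s"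
    and t: "t \<in> {0<..<T} - S"
  shows "(X has_vector_derivative G (m t) t) (at t)"
proof -
  have "t \<in> {0..T} - S" using t by auto
  with m obtain e where e: "e > 0" "ball t e \<inter> S = {}"
      "\<And>s. s \<in> {0..T} \<Longrightarrow> \<bar>s - t\<bar> < e \<Longrightarrow> m s = m t"
    by (rule constant_off_locally) blast
  define p q where "p = max 0 (t - e/2)" and "q = min T (t + e/2)"
  have pq: "0 \<le> p" "q \<le> T" "p < t" "t < q" using t e by (auto simp: p_def q_def)
  have near: "\<bar>s - t\<bar> < e \<and> s \<in> {0..T} \<and> s \<notin> S" if "s \<in> {p..q}" for s
  proof -
    have "\<bar>s - t\<bar> < e" "s \<in> {0..T}" using that e pq by (auto simp: p_def q_def)
    then show ?thesis using e(2) by (force simp: dist_real_def)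
  qed
  have "(X has_vector_derivative G (m t) t) (at t within {p..q})"
    by (rule primitive_derivative[OF X pq(1,2)])
      (use near e(3) eq pq in \<open>auto intro!: continuous_on_subset[OF G]\<close>)
  then show ?thesis
    using pq by (simp add: at_within_Icc_at)
qed

lemma trajectory_start:
  assumes "trajectory f x0 T m x" "0 \<le> T"
  shows "x 0 = x0"
proof -
  have "((\<lambda>s. f (m s) (x s)) has_integral (x 0 - x0)) {0..0}"
    using assms unfolding trajectory_def by (metis atLeastAtMost_iff order_refl)
  then show ?thesis using has_integral_unique[OF _ has_integral_refl(2)] by fastforce
qed

text \<open>
With \<open>z = y - x\<close>, the product \<open>\<rho> \<bullet> z\<close> vanishes at time 0 because \<open>z\<close> does and at time \<open>T\<close> because \<open>\<rho>\<close>
does, so the integral of its derivative is 0. Adding this derivative to \<open>l y - l x\<close> cancels the terms that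
are linear in \<open>z\<close>; what remains is \<open>\<rho> \<bullet> (f m' x - f m x)\<close> where the controls differ, plus errors. The errors are
quadratic in \<open>z\<close>, or linear in \<open>z\<close> but confined to the times where the controls differ; since \<open>z\<close> is of the
order of the switch distance, both contribute only to second order. The constant does not depend on the perturbed
control.
\<close>

lemma cost_expansion:
  fixes f :: "'k::finite \<Rightarrow> 'a \<Rightarrow> 'a::euclidean_space" and l :: "'a \<Rightarrow> real"
  assumes T: "T > 0"
    and f_quad: "\<And>k y z. norm (f k z - f k y - blinfun_apply (Df k y) (z - y)) \<le> K * (norm (z - y))\<^sup>2"
    and f_cont: "\<And>k. continuous_on UNIV (f k)" and Df_cont: "\<And>k. continuous_on UNIV (Df k)"
    and l_quad: "\<And>y z. norm (l z - l y - blinfun_apply (Dl y) (z - y)) \<le> K' * (norm (z - y))\<^sup>2"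
    and l_cont: "continuous_on UNIV l"
    and m: "constant_off T S m" and x: "trajectory f x0 T m x"
    and \<rho>_cont: "continuous_on {0..T} \<rho>" and \<rho>_end: "\<rho> T = 0"
    and \<rho>_deriv: "\<And>t. t \<in> {0<..<T} - S \<Longrightarrow> (\<rho> has_vector_derivative \<rho>' t) (at t)"
    and \<rho>': "\<And>t v. t \<in> {0<..<T} - S \<Longrightarrow>
      \<rho>' t \<bullet> v = - (\<rho> t \<bullet> blinfun_apply (Df (m t) (x t)) v) - blinfun_apply (Dl (x t)) v"
    and C0: "C0 \<ge> 0"
  obtains C where "C \<ge> 0"
    "\<And>m' S' y F \<eta>. constant_off T S' m' \<Longrightarrow> trajectory f x0 T m' y \<Longrightarrow>
       (\<forall>t\<in>{0..T}. norm (y t - x t) \<le> C0 * switch_distance T m m') \<Longrightarrow> finite F \<Longrightarrow>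
       (\<And>t. t \<in> {0..T} - F \<Longrightarrow> m' t \<noteq> m t \<Longrightarrow> \<rho> t \<bullet> (f (m' t) (x t) - f (m t) (x t)) \<le> - \<eta>) \<Longrightarrow>
       integral {0..T} (\<lambda>t. l (y t)) - integral {0..T} (\<lambda>t. l (x t))
         \<le> - \<eta> * switch_distance T m m' + C * (switch_distance T m m')\<^sup>2"
proof -
  have cx: "continuous_on {0..T} x" using x by (simp add: trajectory_def)
  obtain R where R: "\<And>t. t \<in> {0..T} \<Longrightarrow> norm (\<rho> t) \<le> R"
    using continuous_on_Icc_bounded[OF \<rho>_cont] by blast
  have R0: "R \<ge> 0" using order_trans[OF norm_ge_zero R[of 0]] T by simp
  have "\<forall>k. \<exists>b. \<forall>t\<in>{0..T}. norm (Df k (x t)) \<le> b"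
    by (intro allI continuous_on_Icc_bounded continuous_on_compose2[OF Df_cont cx]) auto
  from choice[OF this] obtain b where
    b: "\<And>k t. t \<in> {0..T} \<Longrightarrow> norm (Df k (x t)) \<le> b k" by blast
  define B where "B = (\<Sum>k\<in>UNIV. \<bar>b k\<bar>)"
  have B: "norm (Df k (x t)) \<le> B" if "t \<in> {0..T}" for k t
  proof -
    have "\<bar>b k\<bar> \<le> B" unfolding B_def by (rule member_le_sum) auto
    then show ?thesis using b[OF that, of k] by simp
  qed
  have B0: "B \<ge> 0" unfolding B_def by (auto intro: sum_nonneg)
  obtain a :: 'a where a: "norm a = 1" using vector_choose_size[of 1] by auto
  have K0: "K \<ge> 0" "K' \<ge> 0"
    using f_quad[of undefined a 0] l_quad[of a 0] a by (auto intro: order_trans[OF norm_ge_zero])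
  define C where "C = T * ((K' + R * K) * C0\<^sup>2) + 2 * R * B * C0"
  show ?thesis
  proof (rule that[of C])
    show "C \<ge> 0" using T K0 R0 B0 C0 by (simp add: C_def)
    fix m' S' y F \<eta>
    assume m': "constant_off T S' m'" and y: "trajectory f x0 T m' y"
      and close: "\<forall>t\<in>{0..T}. norm (y t - x t) \<le> C0 * switch_distance T m m'" and F: "finite F"
      and \<eta>: "\<And>t. t \<in> {0..T} - F \<Longrightarrow> m' t \<noteq> m t \<Longrightarrow> \<rho> t \<bullet> (f (m' t) (x t) - f (m t) (x t)) \<le> - \<eta>"
    let ?\<epsilon> = "switch_distance T m m'"
    let ?\<chi> = "\<lambda>t. if m' t = m t then 0 else 1::real"
    have cy: "continuous_on {0..T} y" using y by (simp add: trajectory_def)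
    have fin: "finite (S \<union> S' \<union> F \<union> {0, T})" using m m' F by (simp add: constant_off_def)
    have dx: "(x has_vector_derivative f (m t) (x t)) (at t)" if "t \<in> {0<..<T} - S" for t
    proof (rule primitive_derivative_switched[OF _ m _ refl that, of "\<lambda>k t. f k (x t)"])
      show "primitive T (\<lambda>s. f (m s) (x s)) x"
        by (rule primitive_from_start) (use x in \<open>auto simp: trajectory_def\<close>)
    qed (intro continuous_on_compose2[OF f_cont cx], auto)
    have dy: "(y has_vector_derivative f (m' t) (y t)) (at t)" if "t \<in> {0<..<T} - S'" for t
    proof (rule primitive_derivative_switched[OF _ m' _ refl that, of "\<lambda>k t. f k (y t)"])
      show "primitive T (\<lambda>s. f (m' s) (y s)) y"
        by (rule primitive_from_start) (use y in \<open>auto simp: trajectory_def\<close>)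
    qed (intro continuous_on_compose2[OF f_cont cy], auto)
    \<comment> \<open>The derivative of \<open>\<rho> \<bullet> (y - x)\<close>.\<close>
    let ?Z = "\<lambda>t. \<rho> t \<bullet> (f (m' t) (y t) - f (m t) (x t)) + \<rho>' t \<bullet> (y t - x t)"
    have "(?Z has_integral (\<rho> T \<bullet> (y T - x T) - \<rho> 0 \<bullet> (y 0 - x 0))) {0..T}"
    proof (rule fundamental_theorem_of_calculus_interior_strong[where S = "S \<union> S'"])
      show "finite (S \<union> S')" using fin by simp
      show "((\<lambda>t. \<rho> t \<bullet> (y t - x t)) has_vector_derivative ?Z t) (at t)"
        if t: "t \<in> {0<..<T} - (S \<union> S')" for t
      proof -
        have "(\<rho> has_vector_derivative \<rho>' t) (at t)"
          "((\<lambda>t. y t - x t) has_vector_derivative f (m' t) (y t) - f (m t) (x t)) (at t)"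
          using t by (auto intro!: \<rho>_deriv has_vector_derivative_diff[OF dy dx])
        then show ?thesis by (rule bounded_bilinear.has_vector_derivative[OF bounded_bilinear_inner])
      qed
      show "continuous_on {0..T} (\<lambda>t. \<rho> t \<bullet> (y t - x t))" by (intro continuous_intros \<rho>_cont cx cy)
    qed (use T in auto)
    moreover have "y 0 = x 0"
      using trajectory_start[OF x] trajectory_start[OF y] T by simp
    ultimately have Z: "(?Z has_integral 0) {0..T}" using \<rho>_end by simp
    have ly: "(\<lambda>t. l (y t)) integrable_on {0..T}" and lx: "(\<lambda>t. l (x t)) integrable_on {0..T}"
      by (intro integrable_continuous_real continuous_on_compose2[OF l_cont] cx cy; simp)+
    let ?lhs = "\<lambda>t. l (y t) - l (x t) + ?Z t"
    let ?rhs = "\<lambda>t. (K' + R * K) * (C0 * ?\<epsilon>)\<^sup>2 + (- \<eta> + 2 * R * B * (C0 * ?\<epsilon>)) * ?\<chi> t"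
    have lhs: "(?lhs has_integral (integral {0..T} (\<lambda>t. l (y t)) - integral {0..T} (\<lambda>t. l (x t)) + 0)) {0..T}"
      by (intro has_integral_add has_integral_diff Z integrable_integral lx ly)
    have rhs: "(?rhs has_integral ((T - 0) *\<^sub>R ((K' + R * K) * (C0 * ?\<epsilon>)\<^sup>2)
        + (- \<eta> + 2 * R * B * (C0 * ?\<epsilon>)) * ?\<epsilon>)) {0..T}"
    proof (intro has_integral_add has_integral_mult_right)
      show "((\<lambda>t. (K' + R * K) * (C0 * ?\<epsilon>)\<^sup>2) has_integral ((T - 0) *\<^sub>R ((K' + R * K) * (C0 * ?\<epsilon>)\<^sup>2))) {0..T}"
        using has_integral_const_real[of "(K' + R * K) * (C0 * ?\<epsilon>)\<^sup>2" 0 T] T by simp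
      show "(?\<chi> has_integral ?\<epsilon>) {0..T}"
        unfolding switch_distance_def by (intro integrable_integral mismatch_integrable[OF m m'])
    qed
    have point: "?lhs t \<le> ?rhs t" if t: "t \<in> {0..T} - (S \<union> S' \<union> F \<union> {0, T})" for t
    proof -
      define z where "z = y t - x t"
      have tI: "t \<in> {0..T}" "t \<in> {0<..<T} - S" "t \<in> {0..T} - F" using t by auto
      have z: "norm z \<le> C0 * ?\<epsilon>" using close tI by (simp add: z_def)
      have z2: "(norm z)\<^sup>2 \<le> (C0 * ?\<epsilon>)\<^sup>2" using z by (simp add: power_mono)
      have el: "l (y t) - l (x t) - Dl (x t) z \<le> K' * (C0 * ?\<epsilon>)\<^sup>2"
      proof -
        have "l (y t) - l (x t) - Dl (x t) z \<le> K' * (norm z)\<^sup>2"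
          using l_quad[of "y t" "x t"] by (simp add: z_def)
        also have "\<dots> \<le> K' * (C0 * ?\<epsilon>)\<^sup>2" using z2 K0 by (intro mult_left_mono)
        finally show ?thesis .
      qed
      have inner_le: "\<rho> t \<bullet> w \<le> R * c" if "norm w \<le> c" for w c
      proof -
        have "\<rho> t \<bullet> w \<le> norm (\<rho> t) * norm w" by (rule norm_cauchy_schwarz)
        also have "\<dots> \<le> R * c" using R[OF tI(1)] that R0 by (intro mult_mono) auto
        finally show ?thesis .
      qed
      have quad: "\<rho> t \<bullet> (f k (y t) - f k (x t) - Df k (x t) z) \<le> R * (K * (C0 * ?\<epsilon>)\<^sup>2)" for k
      proof (rule inner_le)
        have "norm (f k (y t) - f k (x t) - Df k (x t) z) \<le> K * (norm z)\<^sup>2"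
          using f_quad by (simp add: z_def)
        also have "\<dots> \<le> K * (C0 * ?\<epsilon>)\<^sup>2" using z2 K0 by (intro mult_left_mono)
        finally show "norm (f k (y t) - f k (x t) - Df k (x t) z) \<le> K * (C0 * ?\<epsilon>)\<^sup>2" .
      qed
      have "\<rho> t \<bullet> (f (m' t) (y t) - f (m t) (x t) - Df (m t) (x t) z)
          \<le> R * (K * (C0 * ?\<epsilon>)\<^sup>2) + (- \<eta> + 2 * R * B * (C0 * ?\<epsilon>)) * ?\<chi> t"
      proof (cases "m' t = m t")
        case True
        then show ?thesis using quad by simp
      next
        case False
        have "\<rho> t \<bullet> (Df (m' t) (x t) z - Df (m t) (x t) z) \<le> R * (2 * B * (C0 * ?\<epsilon>))"
        proof (rule inner_le)
          have Dz: "norm (Df k (x t) z) \<le> B * (C0 * ?\<epsilon>)" for k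
          proof -
            have "norm (Df k (x t) z) \<le> norm (Df k (x t)) * norm z" by (rule norm_blinfun)
            also have "\<dots> \<le> B * (C0 * ?\<epsilon>)" using B[OF tI(1)] z B0 by (intro mult_mono) auto
            finally show ?thesis .
          qed
          show "norm (Df (m' t) (x t) z - Df (m t) (x t) z) \<le> 2 * B * (C0 * ?\<epsilon>)"
            using norm_triangle_ineq4[of "Df (m' t) (x t) z" "Df (m t) (x t) z"]
              Dz[of "m' t"] Dz[of "m t"] by linarith
        qed
        moreover have "\<rho> t \<bullet> (f (m' t) (x t) - f (m t) (x t)) \<le> - \<eta>" by (rule \<eta>[OF tI(3) False])
        moreover have "\<rho> t \<bullet> (f (m' t) (y t) - f (m t) (x t) - Df (m t) (x t) z)
          = \<rho> t \<bullet> (f (m' t) (x t) - f (m t) (x t)) + \<rho> t \<bullet> (Df (m' t) (x t) z - Df (m t) (x t) z)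
            + \<rho> t \<bullet> (f (m' t) (y t) - f (m' t) (x t) - Df (m' t) (x t) z)"
          by (simp add: inner_diff_right)
        ultimately show ?thesis using quad[of "m' t"] False by (simp add: algebra_simps)
      qed
      moreover have "?lhs t = (l (y t) - l (x t) - Dl (x t) z)
          + \<rho> t \<bullet> (f (m' t) (y t) - f (m t) (x t) - Df (m t) (x t) z)"
        using \<rho>'[OF tI(2), of z] by (simp add: z_def[symmetric] inner_diff_right)
      ultimately show ?thesis using el by (simp add: algebra_simps)
    qed
    have "((\<lambda>t. if t \<in> S \<union> S' \<union> F \<union> {0, T} then ?rhs t else ?lhs t) has_integral
        (integral {0..T} (\<lambda>t. l (y t)) - integral {0..T} (\<lambda>t. l (x t)) + 0)) {0..T}"
      by (rule has_integral_spike_finite[OF fin _ lhs]) auto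
    then have "integral {0..T} (\<lambda>t. l (y t)) - integral {0..T} (\<lambda>t. l (x t)) + 0
       \<le> (T - 0) *\<^sub>R ((K' + R * K) * (C0 * ?\<epsilon>)\<^sup>2) + (- \<eta> + 2 * R * B * (C0 * ?\<epsilon>)) * ?\<epsilon>"
      by (rule has_integral_le[OF _ rhs]) (use point in \<open>auto simp del: Un_iff insert_iff\<close>)
    then show "integral {0..T} (\<lambda>t. l (y t)) - integral {0..T} (\<lambda>t. l (x t))
         \<le> - \<eta> * ?\<epsilon> + C * ?\<epsilon>\<^sup>2"
      by (simp add: C_def algebra_simps power2_eq_square)
  qed
qed

section \<open>Gaps of a finite set of times\<close>

definition gaps :: "real set \<Rightarrow> (real \<times> real) set" where
  "gaps P = {(p, q). p \<in> P \<and> q \<in> P \<and> p < q \<and> {p<..<q} \<inter> P = {}}"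

lemma finite_gaps: "finite P \<Longrightarrow> finite (gaps P)"
  by (rule finite_subset[of _ "P \<times> P"]) (auto simp: gaps_def)

lemma gap_exists:
  assumes "finite P" "0 \<in> P" "T \<in> P" "t \<in> {0..T} - P"
  shows "\<exists>I\<in>gaps P. fst I < t \<and> t < snd I"
proof -
  let ?A = "{p \<in> P. p < t}" and ?B = "{p \<in> P. t < p}"
  have A: "finite ?A" "0 \<in> ?A" and B: "finite ?B" "T \<in> ?B"
    using assms by (auto simp: less_le)
  have MA: "Max ?A \<in> ?A" using Max_in[of ?A] A by blast
  have MB: "Min ?B \<in> ?B" using Min_in[of ?B] B by blast
  have "s \<notin> P" if s: "Max ?A < s" "s < Min ?B" for s
  proof
    assume sP: "s \<in> P"
    show False
    proof (cases "s < t")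
      case True
      then show False using Max_ge[OF A(1), of s] sP s by auto
    next
      case False
      then have "t < s" using sP assms(4) by (cases "s = t") auto
      then show False using Min_le[OF B(1), of s] sP s by auto
    qed
  qed
  then have disj: "{Max ?A<..<Min ?B} \<inter> P = {}" by (meson disjoint_iff greaterThanLessThan_iff)
  obtain a b where ab: "a = Max ?A" "b = Min ?B" by blast
  have "a \<in> P" "a < t" "b \<in> P" "t < b" using MA MB unfolding ab by blast+
  moreover have "{a<..<b} \<inter> P = {}" using disj unfolding ab .
  ultimately have "(a, b) \<in> gaps P" by (auto simp: gaps_def)
  then show ?thesis using \<open>a < t\<close> \<open>t < b\<close> by (metis fst_conv snd_conv)
qed

lemma gap_unique:
  assumes "I \<in> gaps P" "I' \<in> gaps P" "fst I < t" "t < snd I" "fst I' < t" "t < snd I'"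
  shows "I = I'"
proof -
  obtain p q p' q' where I: "I = (p, q)" "I' = (p', q')" by (metis surj_pair)
  have *: "p \<in> P" "q \<in> P" "\<And>v. p < v \<Longrightarrow> v < q \<Longrightarrow> v \<notin> P"
    "p' \<in> P" "q' \<in> P" "\<And>v. p' < v \<Longrightarrow> v < q' \<Longrightarrow> v \<notin> P"
    "p < t" "t < q" "p' < t" "t < q'"
    using assms unfolding gaps_def I by auto
  have "\<not> p < p'" using *(3)[of p'] * by auto
  moreover have "\<not> p' < p" using *(6)[of p] * by auto
  moreover have "\<not> q' < q" using *(3)[of q'] * by auto
  moreover have "\<not> q < q'" using *(6)[of q] * by auto
  ultimately have "p = p'" "q = q'" by linarith+
  then show ?thesis by (simp add: I)
qed

text \<open>
Elements of \<open>Z\<close> are told apart by the sets of elements of \<open>P\<close> below them. With Rolle's theorem this makes the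
zeros of a function with finitely many critical points finite.
\<close>

lemma finite_separated:
  fixes P Z :: "real set"
  assumes P: "finite P" and sep: "\<And>s t. s \<in> Z \<Longrightarrow> t \<in> Z \<Longrightarrow> s < t \<Longrightarrow> \<exists>p\<in>P. s \<le> p \<and> p < t"
  shows "finite Z"
proof (rule finite_imageD)
  show "finite ((\<lambda>t. P \<inter> {..<t}) ` Z)" by (rule finite_subset[of _ "Pow P"]) (use P in auto)
  have neq: "P \<inter> {..<s} \<noteq> P \<inter> {..<t}" if "s \<in> Z" "t \<in> Z" "s < t" for s t
  proof
    assume eq: "P \<inter> {..<s} = P \<inter> {..<t}"
    from sep[OF that] obtain p where p: "p \<in> P" "s \<le> p" "p < t" by blast
    then have "p \<in> P \<inter> {..<s}" unfolding eq by simp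
    then show False using p by simp
  qed
  show "inj_on (\<lambda>t. P \<inter> {..<t}) Z"
  proof (rule inj_onI)
    fix s t assume st: "s \<in> Z" "t \<in> Z" "P \<inter> {..<s} = P \<inter> {..<t}"
    then show "s = t" using neq[of s t] neq[of t s] by (metis linorder_neqE)
  qed
qed

section \<open>Regularity of the insertion gradient on a gap\<close>

text \<open>
Derivatives are relative to the set \<open>A\<close>, a closed gap below, so that one-sided limits at its end points are values
of continuous functions.
\<close>

definition C1_on :: "real set \<Rightarrow> (real \<Rightarrow> 'a::real_normed_vector) \<Rightarrow> bool" where
  "C1_on A \<phi> \<longleftrightarrow>
     (\<exists>\<phi>'. (\<forall>t\<in>A. (\<phi> has_vector_derivative \<phi>' t) (at t within A)) \<and> continuous_on A \<phi>')"

lemma C1_on_continuous: "C1_on A \<phi> \<Longrightarrow> continuous_on A \<phi>"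
  unfolding C1_on_def by (meson continuous_on_eq_continuous_within has_vector_derivative_continuous)

lemma C1_on_bilinear:
  assumes b: "bounded_bilinear b" and "C1_on A \<phi>" "C1_on A \<psi>"
  shows "C1_on A (\<lambda>t. b (\<phi> t) (\<psi> t))"
proof -
  obtain \<phi>' \<psi>' where *: "\<And>t. t \<in> A \<Longrightarrow> (\<phi> has_vector_derivative \<phi>' t) (at t within A)" "continuous_on A \<phi>'"
      "\<And>t. t \<in> A \<Longrightarrow> (\<psi> has_vector_derivative \<psi>' t) (at t within A)" "continuous_on A \<psi>'"
    using assms unfolding C1_on_def by blast
  show ?thesis
    unfolding C1_on_def
  proof (intro exI conjI ballI)
    show "((\<lambda>t. b (\<phi> t) (\<psi> t)) has_vector_derivative b (\<phi> t) (\<psi>' t) + b (\<phi>' t) (\<psi> t)) (at t within A)"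
      if "t \<in> A" for t
      by (rule bounded_bilinear.has_vector_derivative[OF b *(1)[OF that] *(3)[OF that]])
    show "continuous_on A (\<lambda>t. b (\<phi> t) (\<psi>' t) + b (\<phi>' t) (\<psi> t))"
      by (intro continuous_on_add bounded_bilinear.continuous_on[OF b] * C1_on_continuous assms)
  qed
qed

lemma has_vector_derivative_compose_blinfun:
  assumes x: "(x has_vector_derivative x') (at t within A)"
    and h: "(h has_derivative blinfun_apply D) (at (x t))"
  shows "((\<lambda>t. h (x t)) has_vector_derivative blinfun_apply D x') (at t within A)"
proof -
  have "((\<lambda>t. h (x t)) has_derivative (\<lambda>s. blinfun_apply D (s *\<^sub>R x'))) (at t within A)"
    using x h unfolding has_vector_derivative_def by (rule has_derivative_compose)
  then show ?thesis by (simp add: has_vector_derivative_def blinfun.scaleR_right)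
qed

lemma C1_on_compose:
  assumes h: "\<And>y. (h has_derivative blinfun_apply (Dh y)) (at y)" and Dh: "continuous_on UNIV Dh"
    and "C1_on A x"
  shows "C1_on A (\<lambda>t. h (x t))"
proof -
  obtain x' where *: "\<And>t. t \<in> A \<Longrightarrow> (x has_vector_derivative x' t) (at t within A)" "continuous_on A x'"
    using assms unfolding C1_on_def by blast
  show ?thesis
    unfolding C1_on_def
  proof (intro exI conjI ballI)
    show "((\<lambda>t. h (x t)) has_vector_derivative Dh (x t) (x' t)) (at t within A)" if "t \<in> A" for t
      by (rule has_vector_derivative_compose_blinfun) (rule *(1)[OF that] h)+
    show "continuous_on A (\<lambda>t. Dh (x t) (x' t))"
      by (intro continuous_intros continuous_on_compose2[OF Dh] * C1_on_continuous[OF assms(3)]) auto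
  qed
qed

lemma C1_on_add:
  assumes "C1_on A \<phi>" "C1_on A \<psi>"
  shows "C1_on A (\<lambda>t. \<phi> t + \<psi> t)"
proof -
  obtain \<phi>' \<psi>' where "\<And>t. t \<in> A \<Longrightarrow> (\<phi> has_vector_derivative \<phi>' t) (at t within A)" "continuous_on A \<phi>'"
      "\<And>t. t \<in> A \<Longrightarrow> (\<psi> has_vector_derivative \<psi>' t) (at t within A)" "continuous_on A \<psi>'"
    using assms unfolding C1_on_def by blast
  then show ?thesis
    unfolding C1_on_def
    by (intro exI[of _ "\<lambda>t. \<phi>' t + \<psi>' t"]) (auto intro!: has_vector_derivative_add continuous_on_add)
qed

lemma C1_on_minus:
  assumes "C1_on A \<phi>"
  shows "C1_on A (\<lambda>t. - \<phi> t)"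
proof -
  obtain \<phi>' where "\<And>t. t \<in> A \<Longrightarrow> (\<phi> has_vector_derivative \<phi>' t) (at t within A)" "continuous_on A \<phi>'"
    using assms unfolding C1_on_def by blast
  then show ?thesis
    unfolding C1_on_def
    by (intro exI[of _ "\<lambda>t. - \<phi>' t"]) (auto intro!: has_vector_derivative_minus continuous_on_minus)
qed

lemma C1_on_diff:
  assumes "C1_on A \<phi>" "C1_on A \<psi>"
  shows "C1_on A (\<lambda>t. \<phi> t - \<psi> t)"
  using C1_on_add[OF assms(1) C1_on_minus[OF assms(2)]] by simp

text \<open>
Differentiating \<open>\<rho> \<bullet> (f a x - f s x)\<close> along the flow of the active mode \<open>s\<close> gives an expression in
\<open>x\<close>, \<open>\<rho>\<close>, the fields and their first derivatives, because the adjoint equation expresses \<open>\<rho>'\<close> through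
first derivatives. All of these are continuously differentiable in time, so a second derivative exists and is continuous.
\<close>

lemma insertion_gradient_C2:
  fixes f :: "'k \<Rightarrow> 'a \<Rightarrow> 'a::euclidean_space" and l :: "'a \<Rightarrow> real"
  assumes Df: "\<And>k y. (f k has_derivative blinfun_apply (Df k y)) (at y)"
    and D2f: "\<And>k y. (Df k has_derivative blinfun_apply (D2f k y)) (at y)"
    and D2f_cont: "\<And>k. continuous_on UNIV (D2f k)"
    and D2l: "\<And>y. (Dl has_derivative blinfun_apply (D2l y)) (at y)"
    and D2l_cont: "continuous_on UNIV D2l"
    and x: "\<And>t. t \<in> A \<Longrightarrow> (x has_vector_derivative f s (x t)) (at t within A)"
    and \<rho>: "\<And>t. t \<in> A \<Longrightarrow> (\<rho> has_vector_derivative \<rho>' t) (at t within A)"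
    and \<rho>'_cont: "continuous_on A \<rho>'"
    and \<rho>': "\<And>t v. t \<in> A \<Longrightarrow>
      \<rho>' t \<bullet> v = - (\<rho> t \<bullet> blinfun_apply (Df s (x t)) v) - blinfun_apply (Dl (x t)) v"
  obtains g1 g2 where
    "\<And>t. t \<in> A \<Longrightarrow> ((\<lambda>t. \<rho> t \<bullet> (f a (x t) - f s (x t))) has_real_derivative g1 t) (at t within A)"
    "\<And>t. t \<in> A \<Longrightarrow> (g1 has_real_derivative g2 t) (at t within A)"
    "continuous_on A g2"
proof -
  have Df_cont: "continuous_on UNIV (Df k)" for k
    by (rule has_derivative_continuous_on) (rule has_derivative_at_withinI[OF D2f])
  have f_cont: "continuous_on UNIV (f k)" for k
    by (rule has_derivative_continuous_on) (rule has_derivative_at_withinI[OF Df])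
  have cx: "continuous_on A x"
    using x by (meson continuous_on_eq_continuous_within has_vector_derivative_continuous)
  have C1x: "C1_on A x" unfolding C1_on_def
    by (intro exI[of _ "\<lambda>t. f s (x t)"] conjI ballI x continuous_on_compose2[OF f_cont cx]) auto
  have C1\<rho>: "C1_on A \<rho>" unfolding C1_on_def using \<rho> \<rho>'_cont by blast
  have C1f: "C1_on A (\<lambda>t. f k (x t))" for k by (rule C1_on_compose[OF Df Df_cont C1x])
  have C1Df: "C1_on A (\<lambda>t. Df k (x t))" for k by (rule C1_on_compose[OF D2f D2f_cont C1x])
  have C1Dl: "C1_on A (\<lambda>t. Dl (x t))" by (rule C1_on_compose[OF D2l D2l_cont C1x])
  let ?h = "\<lambda>t. f a (x t) - f s (x t)"
  let ?g1 = "\<lambda>t. \<rho> t \<bullet> (Df a (x t) (f s (x t)) - Df s (x t) (f s (x t)))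
      + (- (\<rho> t \<bullet> Df s (x t) (?h t)) - Dl (x t) (?h t))"
  have "C1_on A ?g1"
    by (intro C1_on_add C1_on_diff C1_on_minus C1_on_bilinear[OF bounded_bilinear_inner]
        C1_on_bilinear[OF bounded_bilinear_blinfun_apply] C1\<rho> C1f C1Df C1Dl)
  then obtain g2 where g2: "\<And>t. t \<in> A \<Longrightarrow> (?g1 has_vector_derivative g2 t) (at t within A)"
      "continuous_on A g2" unfolding C1_on_def by blast
  have dh: "(?h has_vector_derivative (Df a (x t) (f s (x t)) - Df s (x t) (f s (x t)))) (at t within A)"
    if "t \<in> A" for t
  proof -
    have "((\<lambda>t. f k (x t)) has_vector_derivative Df k (x t) (f s (x t))) (at t within A)" for k
      by (rule has_vector_derivative_compose_blinfun) (rule x[OF that] Df)+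
    then show ?thesis by (intro has_vector_derivative_diff)
  qed
  show ?thesis
  proof (rule that[of ?g1 g2])
    show "((\<lambda>t. \<rho> t \<bullet> ?h t) has_real_derivative ?g1 t) (at t within A)" if "t \<in> A" for t
      using bounded_bilinear.has_vector_derivative[OF bounded_bilinear_inner \<rho>[OF that] dh[OF that]]
      unfolding has_real_derivative_iff_has_vector_derivative \<rho>'[OF that] .
  qed (use g2 in \<open>auto simp: has_real_derivative_iff_has_vector_derivative\<close>)
qed

section \<open>Where a function crosses a rising threshold\<close>

text \<open>
As \<open>\<gamma>\<close> decreases to \<open>-1 / \<theta>\<close>, the threshold \<open>- 1 / \<gamma>\<close> decreases to the minimum \<open>\<theta>\<close> of \<open>h\<close>,
so the point \<open>r \<gamma>\<close> where \<open>h\<close> crosses it moves to 0.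
\<close>

lemma threshold_crossing:
  fixes h :: "real \<Rightarrow> real"
  assumes w: "w > 0" and h: "continuous_on {0..w} h"
    and mono: "\<And>u v. 0 \<le> u \<Longrightarrow> u < v \<Longrightarrow> v \<le> w \<Longrightarrow> h u < h v"
    and h0: "h 0 = \<theta>" and \<theta>: "\<theta> < 0"
  obtains \<gamma>1 r where "\<gamma>1 > - 1 / \<theta>"
    "\<And>\<gamma>. \<gamma> \<in> {- 1 / \<theta><..<\<gamma>1} \<Longrightarrow> 0 < r \<gamma> \<and> r \<gamma> < w \<and> h (r \<gamma>) = - 1 / \<gamma>"
    "(r \<longlongrightarrow> 0) (at_right (- 1 / \<theta>))"
proof -
  let ?\<gamma>0 = "- 1 / \<theta>"
  have lim: "((\<lambda>\<gamma>. - 1 / \<gamma>) \<longlongrightarrow> \<theta>) (at_right ?\<gamma>0)"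
    by (rule tendsto_eq_intros refl | use \<theta> in simp)+
  have ev: "\<forall>\<^sub>F \<gamma> in at_right ?\<gamma>0. - 1 / \<gamma> < h v" if "0 < v" "v \<le> w" for v
    using order_tendstoD(2)[OF lim, of "h v"] mono[of 0 v] that h0 by simp
  have gt: "\<theta> < - 1 / \<gamma>" if "\<gamma> > ?\<gamma>0" for \<gamma>
  proof -
    have "?\<gamma>0 > 0" using \<theta> by simp
    then have "inverse \<gamma> < inverse ?\<gamma>0" using that by (rule less_imp_inverse_less[rotated])
    then show ?thesis using \<theta> by (simp add: inverse_eq_divide)
  qed
  obtain \<gamma>1 where \<gamma>1: "\<gamma>1 > ?\<gamma>0" "\<And>\<gamma>. ?\<gamma>0 < \<gamma> \<Longrightarrow> \<gamma> < \<gamma>1 \<Longrightarrow> - 1 / \<gamma> < h w"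
    using ev[OF w] unfolding eventually_at_right_field by blast
  have ex: "\<exists>r. 0 < r \<and> r < w \<and> h r = - 1 / \<gamma>" if \<gamma>: "\<gamma> \<in> {?\<gamma>0<..<\<gamma>1}" for \<gamma>
  proof -
    have "\<exists>r\<ge>0. r \<le> w \<and> h r = - 1 / \<gamma>"
      by (rule IVT') (use \<gamma> gt[of \<gamma>] \<gamma>1(2)[of \<gamma>] h0 h w in auto)
    then obtain r where r: "0 \<le> r" "r \<le> w" "h r = - 1 / \<gamma>" by blast
    moreover have "r \<noteq> 0" using r gt[of \<gamma>] \<gamma> h0 by auto
    moreover have "r \<noteq> w" using r \<gamma>1(2)[of \<gamma>] \<gamma> by auto
    ultimately show ?thesis by (intro exI[of _ r]) auto
  qed
  define r where "r = (\<lambda>\<gamma>. SOME r. 0 < r \<and> r < w \<and> h r = - 1 / \<gamma>)"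
  have r: "0 < r \<gamma> \<and> r \<gamma> < w \<and> h (r \<gamma>) = - 1 / \<gamma>" if "\<gamma> \<in> {?\<gamma>0<..<\<gamma>1}" for \<gamma>
    unfolding r_def by (rule someI_ex[OF ex[OF that]])
  have ev\<gamma>: "\<forall>\<^sub>F \<gamma> in at_right ?\<gamma>0. \<gamma> \<in> {?\<gamma>0<..<\<gamma>1}"
    by (rule eventually_at_rightI[OF _ \<gamma>1(1)])
  have "(r \<longlongrightarrow> 0) (at_right ?\<gamma>0)"
  proof (rule order_tendstoI)
    fix e :: real assume "e < 0"
    show "\<forall>\<^sub>F \<gamma> in at_right ?\<gamma>0. e < r \<gamma>"
      using ev\<gamma> by eventually_elim (use r \<open>e < 0\<close> in force)
  next
    fix e :: real assume e: "0 < e"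
    have "\<forall>\<^sub>F \<gamma> in at_right ?\<gamma>0. - 1 / \<gamma> < h (min e w)" by (rule ev) (use e w in auto)
    with ev\<gamma> show "\<forall>\<^sub>F \<gamma> in at_right ?\<gamma>0. r \<gamma> < e"
    proof eventually_elim
      fix \<gamma> assume \<gamma>: "\<gamma> \<in> {?\<gamma>0<..<\<gamma>1}" "- 1 / \<gamma> < h (min e w)"
      then have "h (r \<gamma>) < h (min e w)" using r by simp
      then have "r \<gamma> < min e w" using mono[of "min e w" "r \<gamma>"] r[OF \<gamma>(1)] e w
        by (metis less_eq_real_def linorder_neqE not_less_iff_gr_or_eq min_less_iff_conj less_imp_le)
      then show "r \<gamma> < e" by simp
    qed
  qed
  then show ?thesis using that[of \<gamma>1 r] \<gamma>1(1) r by blast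
qed

lemma quadratic_growth:
  fixes h h1 :: "real \<Rightarrow> real"
  assumes w: "w > 0"
    and h: "\<And>v. v \<in> {0..w} \<Longrightarrow> (h has_real_derivative h1 v) (at v within {0..w})"
    and h1: "(h1 has_real_derivative D) (at 0 within {0..w})" and h1_0: "h1 0 = 0"
  shows "((\<lambda>v. (h v - h 0) / v\<^sup>2) \<longlongrightarrow> D / 2) (at_right 0)"
proof (rule lhopital_right_0)
  have ev: "\<forall>\<^sub>F v in at_right 0. v \<in> {0<..<w}" by (rule eventually_at_rightI[OF _ w])
  have r0: "at 0 within {0..w} = at_right 0" using at_within_Icc_at_right[OF w] by simp
  have "continuous (at 0 within {0..w}) h" using h[of 0] w DERIV_continuous by fastforce
  then have "(h \<longlongrightarrow> h 0) (at_right 0)" by (simp add: continuous_within r0)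
  then show "((\<lambda>v. h v - h 0) \<longlongrightarrow> 0) (at_right 0)" by (simp add: LIM_zero_iff)
  show "((\<lambda>v. v\<^sup>2) \<longlongrightarrow> (0::real)) (at_right 0)" by (rule tendsto_eq_intros refl | simp)+
  show "\<forall>\<^sub>F v in at_right 0. v\<^sup>2 \<noteq> (0::real)" using ev by eventually_elim auto
  show "\<forall>\<^sub>F v in at_right 0. 2 * v \<noteq> (0::real)" using ev by eventually_elim auto
  show "\<forall>\<^sub>F v in at_right 0. ((\<lambda>v. h v - h 0) has_real_derivative h1 v) (at v)"
    using ev
  proof eventually_elim
    fix v assume v: "v \<in> {0<..<w}"
    then have "(h has_real_derivative h1 v) (at v)" using h[of v] by (simp add: at_within_Icc_at)
    then show "((\<lambda>v. h v - h 0) has_real_derivative h1 v) (at v)"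
      by (auto intro!: derivative_eq_intros)
  qed
  show "\<forall>\<^sub>F v in at_right 0. ((\<lambda>v. v\<^sup>2) has_real_derivative 2 * v) (at v :: real filter)"
    by (auto intro!: always_eventually derivative_eq_intros)
  have "((\<lambda>v. (h1 v - h1 0) / (v - 0)) \<longlongrightarrow> D) (at_right 0)"
    using h1 by (simp add: has_field_derivative_iff r0)
  then have "((\<lambda>v. h1 v / v / 2) \<longlongrightarrow> D / 2) (at_right 0)"
    by (intro tendsto_divide) (auto simp: h1_0)
  then show "((\<lambda>v. h1 v / (2 * v)) \<longlongrightarrow> D / 2) (at_right 0)" by (simp add: field_simps)
qed

text \<open>
The threshold exceeds \<open>\<theta> = - 1 / \<gamma>0\<close> by \<open>(\<gamma> - \<gamma>0) / (\<gamma> \<gamma>0)\<close>, and \<open>h - \<theta>\<close> grows like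
\<open>D / 2 * v\<^sup>2\<close>; equating the two at \<open>v = r \<gamma>\<close> gives the square-root law.
\<close>

lemma crossing_rate:
  fixes h r :: "real \<Rightarrow> real"
  assumes \<theta>: "\<theta> < 0" and D: "D > 0"
    and growth: "((\<lambda>v. (h v - \<theta>) / v\<^sup>2) \<longlongrightarrow> D / 2) (at_right 0)"
    and r: "\<forall>\<^sub>F \<gamma> in at_right (- 1 / \<theta>). 0 < r \<gamma> \<and> h (r \<gamma>) = - 1 / \<gamma>"
    and r0: "(r \<longlongrightarrow> 0) (at_right (- 1 / \<theta>))"
  shows "((\<lambda>\<gamma>. r \<gamma> / sqrt (\<gamma> - (- 1 / \<theta>))) \<longlongrightarrow> sqrt 2 * \<bar>\<theta>\<bar> / sqrt D) (at_right (- 1 / \<theta>))"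
proof -
  let ?\<gamma>0 = "- 1 / \<theta>"
  have \<gamma>0: "?\<gamma>0 > 0" using \<theta> by simp
  have "filterlim r (at_right 0) (at_right ?\<gamma>0)"
    by (rule tendsto_imp_filterlim_at_right[OF r0]) (use r in eventually_elim, auto)
  from filterlim_compose[OF growth this]
  have lim: "((\<lambda>\<gamma>. (h (r \<gamma>) - \<theta>) / (r \<gamma>)\<^sup>2) \<longlongrightarrow> D / 2) (at_right ?\<gamma>0)" .
  have "((\<lambda>\<gamma>. sqrt (1 / (\<gamma> * ?\<gamma>0 * ((h (r \<gamma>) - \<theta>) / (r \<gamma>)\<^sup>2))))
      \<longlongrightarrow> sqrt (1 / (?\<gamma>0 * ?\<gamma>0 * (D / 2)))) (at_right ?\<gamma>0)"
    by (rule tendsto_real_sqrt, rule tendsto_divide[OF tendsto_const],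
        rule tendsto_mult[OF tendsto_mult[OF tendsto_ident_at tendsto_const] lim])
      (use \<theta> D in auto)
  moreover have "sqrt (1 / (?\<gamma>0 * ?\<gamma>0 * (D / 2))) = sqrt 2 * \<bar>\<theta>\<bar> / sqrt D"
  proof -
    have "1 / (?\<gamma>0 * ?\<gamma>0 * (D / 2)) = 2 * \<theta>\<^sup>2 / D" by (simp add: field_simps power2_eq_square)
    then show ?thesis by (simp add: real_sqrt_divide real_sqrt_mult)
  qed
  moreover have "\<forall>\<^sub>F \<gamma> in at_right ?\<gamma>0.
      sqrt (1 / (\<gamma> * ?\<gamma>0 * ((h (r \<gamma>) - \<theta>) / (r \<gamma>)\<^sup>2))) = r \<gamma> / sqrt (\<gamma> - ?\<gamma>0)"
    using r eventually_at_right_less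
  proof eventually_elim
    fix \<gamma> assume r: "0 < r \<gamma> \<and> h (r \<gamma>) = - 1 / \<gamma>" and \<gamma>: "?\<gamma>0 < \<gamma>"
    then have "\<gamma> > 0" using \<gamma>0 by linarith
    then have "\<gamma> * ?\<gamma>0 * (h (r \<gamma>) - \<theta>) = \<gamma> - ?\<gamma>0"
      using r \<theta> by (simp add: field_simps)
    then have "1 / (\<gamma> * ?\<gamma>0 * ((h (r \<gamma>) - \<theta>) / (r \<gamma>)\<^sup>2)) = (r \<gamma>)\<^sup>2 / (\<gamma> - ?\<gamma>0)"
      by (metis (no_types, opaque_lifting) divide_divide_eq_right mult.left_neutral times_divide_eq_right)
    then show "sqrt (1 / (\<gamma> * ?\<gamma>0 * ((h (r \<gamma>) - \<theta>) / (r \<gamma>)\<^sup>2))) = r \<gamma> / sqrt (\<gamma> - ?\<gamma>0)"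
      using r by (simp add: real_sqrt_divide)
  qed
  ultimately show ?thesis by (auto intro: Lim_transform_eventually)
qed

section \<open>Switching times as intrinsic points of a control\<close>

lemma eventually_notin_finite:
  fixes t :: real
  assumes "finite E"
  shows "\<forall>\<^sub>F s in at t. s \<notin> E"
proof -
  have "closed (E - {t})" using assms by (intro finite_imp_closed) auto
  then have "open (- (E - {t}))" by (rule open_Compl)
  then show ?thesis unfolding eventually_at_topological by blast
qed

lemma eventually_at_interval:
  fixes t :: real
  assumes "a < t" "t < b"
  shows "\<forall>\<^sub>F s in at t. a < s \<and> s < b"
  unfolding eventually_at_topological
  by (rule exI[of _ "{a<..<b}"]) (use assms in auto)

lemma at_left_le_at: "at_left (t::real) \<le> at t" and at_right_le_at: "at_right (t::real) \<le> at t"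
  by (simp_all add: at_le)

lemma eventually_at_both:
  fixes t :: real
  assumes "\<forall>\<^sub>F s in at t. P s"
  shows "\<forall>\<^sub>F s in at_left t. P s" "\<forall>\<^sub>F s in at_right t. P s"
  using assms at_left_le_at at_right_le_at filter_leD by blast+

lemma eventually_const_eq:
  assumes "\<forall>\<^sub>F s in F. \<mu> s = k" "\<forall>\<^sub>F s in F. \<mu> s = k'" "F \<noteq> bot"
  shows "k = k'"
  using eventually_happens'[OF assms(3) eventually_conj[OF assms(1,2)]] by auto

lemma AE_lborel_open_witness:
  fixes U :: "real set"
  assumes AE: "AE t in lborel. Q t" and U: "open U" "U \<noteq> {}"
  shows "\<exists>t\<in>U. Q t"
proof (rule ccontr)
  assume none: "\<not> (\<exists>t\<in>U. Q t)"
  from AE obtain N where N: "{t \<in> space lborel. \<not> Q t} \<subseteq> N" "N \<in> null_sets lborel"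
    by (auto elim!: AE_E simp: null_sets_def)
  have "negligible N" unfolding negligible_iff_null_sets using N(2) by (rule null_sets_completionI)
  moreover have "U \<subseteq> N" using none N(1) by auto
  ultimately have "negligible U" by (rule negligible_subset)
  then show False using open_not_negligible U by blast
qed

text \<open>
The punctured neighbourhoods make the set independent of the values of \<open>\<mu>\<close> at exceptional points, which
a schedule does not determine.
\<close>

definition switch_points :: "real \<Rightarrow> (real \<Rightarrow> 'k) \<Rightarrow> real set" where
  "switch_points T \<mu> = {t \<in> {0<..<T}. \<not> (\<exists>k. \<forall>\<^sub>F s in at t. \<mu> s = k)}"

lemma switch_points_subset:
  assumes \<mu>: "constant_off T E \<mu>"
  shows "switch_points T \<mu> \<subseteq> E"
proof
  fix t assume t: "t \<in> switch_points T \<mu>"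
  show "t \<in> E"
  proof (rule ccontr)
    assume "t \<notin> E"
    then have "t \<in> {0..T} - E" using t by (auto simp: switch_points_def)
    with \<mu> obtain e where e: "e > 0" "\<And>s. s \<in> {0..T} \<Longrightarrow> \<bar>s - t\<bar> < e \<Longrightarrow> \<mu> s = \<mu> t"
      by (rule constant_off_locally) blast
    have "\<forall>\<^sub>F s in at t. 0 < s \<and> s < T" "\<forall>\<^sub>F s in at t. t - e < s \<and> s < t + e"
      using t e by (auto intro!: eventually_at_interval simp: switch_points_def)
    then have "\<forall>\<^sub>F s in at t. \<mu> s = \<mu> t" by eventually_elim (use e(2) in auto)
    then show False using t by (auto simp: switch_points_def)
  qed
qed

context
  fixes T :: real and v :: "real \<Rightarrow> real ^ 'k::finite" and M :: nat and \<sigma> :: "nat \<Rightarrow> 'k"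
    and \<tau> :: "nat \<Rightarrow> real"
  assumes sch: "mode_schedule T v M \<sigma> \<tau>"
begin

lemma schedule_mono: "i < j \<Longrightarrow> j \<le> M \<Longrightarrow> \<tau> i < \<tau> j"
proof (induction j)
  case (Suc j)
  have "\<tau> j < \<tau> (Suc j)" using sch Suc.prems by (auto simp: mode_schedule_def)
  then show ?case using Suc by (cases "i = j") auto
qed simp

lemma schedule_range: "i \<le> M \<Longrightarrow> \<tau> i \<in> {0..T}"
  using schedule_mono[of 0 i] schedule_mono[of i M] sch
  by (cases "i = 0"; cases "i = M") (auto simp: mode_schedule_def)

lemma schedule_interior: "i \<in> {1..<M} \<Longrightarrow> \<tau> i \<in> {0<..<T}"
  using schedule_mono[of 0 i] schedule_mono[of i M] sch by (auto simp: mode_schedule_def)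

lemma schedule_interval:
  assumes "t \<in> {0<..<T}" "t \<notin> \<tau> ` {1..<M}"
  shows "\<exists>i\<in>{1..M}. \<tau> (i - 1) < t \<and> t < \<tau> i"
proof -
  have ends: "\<tau> 0 = 0" "\<tau> M = T" using sch by (auto simp: mode_schedule_def)
  define i where "i = (LEAST i. t < \<tau> i)"
  have TM: "t < \<tau> M" using assms ends by auto
  have i: "t < \<tau> i" unfolding i_def by (rule LeastI[of "\<lambda>i. t < \<tau> i", OF TM])
  have iM: "i \<le> M" unfolding i_def by (rule Least_le[of "\<lambda>i. t < \<tau> i", OF TM])
  have i0: "i \<noteq> 0" using i ends assms by (metis greaterThanLessThan_iff less_asym)
  have "\<not> t < \<tau> (i - 1)" using not_less_Least[of "i - 1" "\<lambda>i. t < \<tau> i"] i0 unfolding i_def[symmetric] by simp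
  moreover have "t \<noteq> \<tau> (i - 1)"
  proof (cases "i = 1")
    case True
    then show ?thesis using ends assms by auto
  next
    case False
    then have "i - 1 \<in> {1..<M}" using i0 iM by auto
    then show ?thesis using assms by blast
  qed
  ultimately show ?thesis using i i0 iM by (intro bexI[of _ i]) auto
qed

context
  fixes E :: "real set" and \<mu> :: "real \<Rightarrow> 'k"
  assumes \<mu>: "constant_off T E \<mu>" and v: "\<And>t. t \<in> {0..T} - E \<Longrightarrow> v t = axis (\<mu> t) 1"
begin

lemma schedule_mode:
  assumes i: "i \<in> {1..M}" and t: "\<tau> (i - 1) < t" "t < \<tau> i" "t \<notin> E"
  shows "\<mu> t = \<sigma> i"
proof (rule ccontr)
  assume neq: "\<mu> t \<noteq> \<sigma> i"
  have range: "\<tau> (i - 1) \<in> {0..T}" "\<tau> i \<in> {0..T}" 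
  proof -
    have "i - 1 \<le> M" "i \<le> M" using i by auto
    then show "\<tau> (i - 1) \<in> {0..T}" "\<tau> i \<in> {0..T}" using schedule_range by blast+
  qed
  then have "t \<in> {0..T} - E" using t by auto
  with \<mu> obtain e where e: "e > 0" "ball t e \<inter> E = {}" "\<And>s. s \<in> {0..T} \<Longrightarrow> \<bar>s - t\<bar> < e \<Longrightarrow> \<mu> s = \<mu> t"
    by (rule constant_off_locally) blast
  define U where "U = ball t e \<inter> {\<tau> (i - 1)<..<\<tau> i}"
  have U: "open U" "t \<in> U" using t e by (auto simp: U_def)
  have "AE s in lborel. s \<in> {\<tau> (i - 1)..<\<tau> i} \<longrightarrow> v s = axis (\<sigma> i) 1"
    using sch i by (auto simp: mode_schedule_def)
  from AE_lborel_open_witness[OF this U(1)] obtain w where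
    w: "w \<in> U" "w \<in> {\<tau> (i - 1)..<\<tau> i} \<longrightarrow> v w = axis (\<sigma> i) 1"
    using U(2) by blast
  then have "w \<in> {\<tau> (i - 1)..<\<tau> i}" "w \<in> ball t e" "w \<in> {0..T}" using range by (auto simp: U_def)
  moreover from this have "w \<in> {0..T} - E" "\<bar>w - t\<bar> < e" using e(2) by (blast, simp add: dist_real_def)
  ultimately have "axis (\<mu> t) 1 = (axis (\<sigma> i) 1 :: real ^ 'k)" using v[of w] e(3)[of w] w(2) by simp
  then show False using neq by (simp add: axis_eq_axis)
qed

lemma schedule_before:
  assumes i: "i \<in> {1..M}"
  shows "\<forall>\<^sub>F s in at_left (\<tau> i). \<mu> s = \<sigma> i"
proof -
  have "\<tau> (i - 1) < \<tau> i" using schedule_mono[of "i - 1" i] i by auto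
  then have "\<forall>\<^sub>F s in at_left (\<tau> i). s \<in> {\<tau> (i - 1)<..<\<tau> i}"
    by (rule eventually_at_leftI[rotated])
  moreover have "\<forall>\<^sub>F s in at_left (\<tau> i). s \<notin> E"
    using \<mu> eventually_at_both(1)[OF eventually_notin_finite] by (auto simp: constant_off_def)
  ultimately show ?thesis by eventually_elim (use schedule_mode[OF i] in auto)
qed

lemma schedule_after:
  assumes i: "i < M"
  shows "\<forall>\<^sub>F s in at_right (\<tau> i). \<mu> s = \<sigma> (i + 1)"
proof -
  have i': "i + 1 \<in> {1..M}" using i by auto
  have "\<tau> i < \<tau> (i + 1)" using schedule_mono[of i "i + 1"] i by auto
  then have "\<forall>\<^sub>F s in at_right (\<tau> i). s \<in> {\<tau> i<..<\<tau> (i + 1)}"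
    by (rule eventually_at_rightI[rotated])
  moreover have "\<forall>\<^sub>F s in at_right (\<tau> i). s \<notin> E"
    using \<mu> eventually_at_both(2)[OF eventually_notin_finite] by (auto simp: constant_off_def)
  ultimately show ?thesis by eventually_elim (use schedule_mode[OF i'] in auto)
qed

text \<open>
The switching times do not depend on the schedule: they are the times near which the control is not
constant. In one direction this uses that consecutive modes of a schedule differ.
\<close>

lemma schedule_switch_points: "\<tau> ` {1..<M} = switch_points T \<mu>"
proof (intro equalityI subsetI)
  fix t assume "t \<in> \<tau> ` {1..<M}"
  then obtain i where i: "i \<in> {1..<M}" and t: "t = \<tau> i" by blast
  have neq: "\<sigma> i \<noteq> \<sigma> (i + 1)" using sch i by (auto simp: mode_schedule_def)
  have "\<not> (\<forall>\<^sub>F s in at t. \<mu> s = k)" for k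
  proof
    assume "\<forall>\<^sub>F s in at t. \<mu> s = k"
    from eventually_at_both[OF this]
    have kl: "\<forall>\<^sub>F s in at_left (\<tau> i). \<mu> s = k" and kr: "\<forall>\<^sub>F s in at_right (\<tau> i). \<mu> s = k"
      unfolding t .
    have "\<forall>\<^sub>F s in at_left (\<tau> i). \<mu> s = \<sigma> i" "\<forall>\<^sub>F s in at_right (\<tau> i). \<mu> s = \<sigma> (i + 1)"
      using schedule_before[of i] schedule_after[of i] i by auto
    then have "k = \<sigma> i" "k = \<sigma> (i + 1)"
      using eventually_const_eq[OF kl] eventually_const_eq[OF kr] by auto
    then show False using neq by simp
  qed
  then show "t \<in> switch_points T \<mu>" using schedule_interior[OF i] by (auto simp: switch_points_def t)
next
  fix t assume t: "t \<in> switch_points T \<mu>"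
  show "t \<in> \<tau> ` {1..<M}"
  proof (rule ccontr)
    assume "t \<notin> \<tau> ` {1..<M}"
    then obtain i where i: "i \<in> {1..M}" "\<tau> (i - 1) < t" "t < \<tau> i"
      using schedule_interval t unfolding switch_points_def by blast
    have "\<forall>\<^sub>F s in at t. s \<notin> E" using \<mu> eventually_notin_finite by (auto simp: constant_off_def)
    with eventually_at_interval[OF i(2,3)] have "\<forall>\<^sub>F s in at t. \<mu> s = \<sigma> i"
      by eventually_elim (use schedule_mode[OF i(1)] in auto)
    then show False using t by (auto simp: switch_points_def)
  qed
qed

end

end

lemma strict_mono_self_map:
  fixes h :: "nat \<Rightarrow> nat"
  assumes h: "\<And>i. i \<in> {1..<M} \<Longrightarrow> h i \<in> {1..<M}"
    and mono: "\<And>i j. i \<in> {1..<M} \<Longrightarrow> j \<in> {1..<M} \<Longrightarrow> i < j \<Longrightarrow> h i < h j"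
    and i: "i \<in> {1..<M}"
  shows "h i = i"
proof -
  have lower: "j \<in> {1..<M} \<Longrightarrow> j \<le> h j" for j
  proof (induction j)
    case (Suc j)
    show ?case
    proof (cases "j = 0")
      case False
      then have "h j < h (Suc j)" "j \<le> h j" using Suc mono[of j "Suc j"] by auto
      then show ?thesis by simp
    qed (use h[OF Suc.prems] in auto)
  qed simp
  have upper: "M - j \<in> {1..<M} \<Longrightarrow> h (M - j) \<le> M - j" for j
  proof (induction j)
    case (Suc j)
    show ?case
    proof (cases "j = 0")
      case False
      then have "M - Suc j < M - j" "M - j \<in> {1..<M}" using Suc.prems by auto
      then have "h (M - Suc j) < h (M - j)" "h (M - j) \<le> M - j"
        using Suc mono[OF Suc.prems, of "M - j"] by auto
      then show ?thesis using Suc.prems by simp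
    qed (use h[OF Suc.prems] Suc.prems in auto)
  qed simp
  show ?thesis using lower[OF i] upper[of "M - i"] i by auto
qed

text \<open>
Two increasing enumerations with the same number of elements are matched, index by index, by any increasing map
from the first into the second.
\<close>

lemma increasing_enumerations_correspond:
  fixes f g :: "nat \<Rightarrow> real"
  assumes f: "\<And>i j. i \<in> {1..<M} \<Longrightarrow> j \<in> {1..<M} \<Longrightarrow> i < j \<Longrightarrow> f i < f j"
    and g: "\<And>i j. i \<in> {1..<M} \<Longrightarrow> j \<in> {1..<M} \<Longrightarrow> i < j \<Longrightarrow> g i < g j"
    and \<phi>_in: "\<And>i. i \<in> {1..<M} \<Longrightarrow> \<phi> (f i) \<in> g ` {1..<M}"
    and \<phi>_mono: "\<And>i j. i \<in> {1..<M} \<Longrightarrow> j \<in> {1..<M} \<Longrightarrow> i < j \<Longrightarrow> \<phi> (f i) < \<phi> (f j)"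
    and i: "i \<in> {1..<M}"
  shows "\<phi> (f i) = g i"
proof -
  have "\<forall>i\<in>{1..<M}. \<exists>j. j \<in> {1..<M} \<and> \<phi> (f i) = g j" using \<phi>_in by blast
  from bchoice[OF this] obtain h where h: "\<And>i. i \<in> {1..<M} \<Longrightarrow> h i \<in> {1..<M} \<and> \<phi> (f i) = g (h i)"
    by blast
  have "h i = i"
  proof (rule strict_mono_self_map[OF _ _ i])
    fix i j assume ij: "i \<in> {1..<M}" "j \<in> {1..<M}" "i < j"
    have lt: "g (h i) < g (h j)" using \<phi>_mono[OF ij] h ij by simp
    show "h i < h j"
    proof (rule ccontr)
      assume "\<not> h i < h j"
      then consider "h i = h j" | "h j < h i" by linarith
      then show False
        using lt g[of "h j" "h i"] h[OF ij(1)] h[OF ij(2)] by cases auto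
    qed
  qed (use h in blast)
  then show ?thesis using h[OF i] by simp
qed

section \<open>Modes that change at the end of a gap\<close>

locale gap_partition =
  fixes T :: real and P :: "real set"
  assumes P: "finite P" "P \<subseteq> {0..T}" "0 \<in> P" "T \<in> P"
begin

definition gap_of :: "real \<Rightarrow> real \<times> real" where
  "gap_of t = (SOME I. I \<in> gaps P \<and> fst I < t \<and> t < snd I)"

lemma gap_of_eq: "I \<in> gaps P \<Longrightarrow> fst I < t \<Longrightarrow> t < snd I \<Longrightarrow> gap_of t = I"
  unfolding gap_of_def by (rule some_equality) (use gap_unique in blast)+

lemma gap_of: "t \<in> {0..T} - P \<Longrightarrow> gap_of t \<in> gaps P \<and> fst (gap_of t) < t \<and> t < snd (gap_of t)"
  using gap_exists[OF P(1,3,4)] gap_of_eq by metis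

lemma gap_bounds: "I \<in> gaps P \<Longrightarrow> 0 \<le> fst I \<and> fst I < snd I \<and> snd I \<le> T"
  using P(2) by (auto simp: gaps_def)

lemma gap_disjoint: "I \<in> gaps P \<Longrightarrow> fst I < t \<Longrightarrow> t < snd I \<Longrightarrow> t \<notin> P"
  by (auto simp: gaps_def)

lemma gap_ends: "I \<in> gaps P \<Longrightarrow> fst I \<in> P \<and> snd I \<in> P"
  by (auto simp: gaps_def)

definition base_mode :: "(real \<times> real \<Rightarrow> 'k) \<Rightarrow> real \<Rightarrow> 'k" where
  "base_mode s t = s (gap_of t)"

lemma base_mode_eq: "I \<in> gaps P \<Longrightarrow> fst I < t \<Longrightarrow> t < snd I \<Longrightarrow> base_mode s t = s I"
  by (simp add: base_mode_def gap_of_eq)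

lemma same_gap:
  assumes "t \<in> {0..T}" "t' \<in> {0..T}" "t \<le> t'" "{t..t'} \<inter> P = {}"
  shows "gap_of t' = gap_of t" "gap_of t \<in> gaps P" "fst (gap_of t) < t" "t' < snd (gap_of t)"
proof -
  have I: "gap_of t \<in> gaps P" "fst (gap_of t) < t" "t < snd (gap_of t)" 
  proof -
    have "t \<in> {t..t'}" using assms by simp
    then have "t \<in> {0..T} - P" using assms by blast
    then show "gap_of t \<in> gaps P" "fst (gap_of t) < t" "t < snd (gap_of t)" using gap_of by blast+
  qed
  then show "gap_of t \<in> gaps P" "fst (gap_of t) < t" by auto
  show lt: "t' < snd (gap_of t)"
  proof (rule ccontr)
    assume "\<not> t' < snd (gap_of t)"
    then have "snd (gap_of t) \<in> {t..t'} \<inter> P" using I gap_ends[OF I(1)] by auto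
    then show False using assms by blast
  qed
  show "gap_of t' = gap_of t" by (rule gap_of_eq) (use I lt assms in auto)
qed

lemma base_mode_constant_off: "constant_off T P (base_mode s)"
  unfolding constant_off_def base_mode_def using P(1) same_gap(1) by auto

end

text \<open>
A family of mode functions indexed by \<open>\<gamma>\<close>. On the gap \<open>I\<close> the mode is \<open>a I\<close> within distance \<open>r \<gamma> I\<close> of the
end point \<open>z I\<close> and \<open>s I\<close> elsewhere. A vanishing \<open>r \<gamma> I\<close> describes a gap on which \<open>s I\<close> is kept; by
\<open>r_pos\<close> this is a property of the gap and not of \<open>\<gamma>\<close>, so all members of the family have the same
combinatorial structure.
\<close>

locale gap_switching = gap_partition T P for T :: real and P :: "real set" +
  fixes s a :: "real \<times> real \<Rightarrow> 'k::finite"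
    and z :: "real \<times> real \<Rightarrow> real" and r :: "real \<Rightarrow> real \<times> real \<Rightarrow> real" and \<Gamma> :: "real set"
  assumes z: "\<And>I. I \<in> gaps P \<Longrightarrow> z I = fst I \<or> z I = snd I"
    and r: "\<And>\<gamma> I. \<gamma> \<in> \<Gamma> \<Longrightarrow> I \<in> gaps P \<Longrightarrow> 0 \<le> r \<gamma> I \<and> r \<gamma> I < snd I - fst I"
    and r_pos: "\<And>\<gamma> \<gamma>' I. \<gamma> \<in> \<Gamma> \<Longrightarrow> \<gamma>' \<in> \<Gamma> \<Longrightarrow> I \<in> gaps P \<Longrightarrow> 0 < r \<gamma> I \<Longrightarrow> 0 < r \<gamma>' I"
    and a_s: "\<And>\<gamma> I. \<gamma> \<in> \<Gamma> \<Longrightarrow> I \<in> gaps P \<Longrightarrow> 0 < r \<gamma> I \<Longrightarrow> a I \<noteq> s I"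
begin

definition mode :: "real \<Rightarrow> real \<Rightarrow> 'k" where
  "mode \<gamma> t = (let I = gap_of t in if \<bar>t - z I\<bar> < r \<gamma> I then a I else s I)"

definition edge :: "real \<Rightarrow> real \<times> real \<Rightarrow> real" where
  "edge \<gamma> I = (if z I = fst I then z I + r \<gamma> I else z I - r \<gamma> I)"

definition exceptional :: "real \<Rightarrow> real set" where
  "exceptional \<gamma> = P \<union> edge \<gamma> ` gaps P"

lemma finite_exceptional: "finite (exceptional \<gamma>)"
  using P finite_gaps by (simp add: exceptional_def)

lemma mode_eq: "I \<in> gaps P \<Longrightarrow> fst I < t \<Longrightarrow> t < snd I \<Longrightarrow>
    mode \<gamma> t = (if \<bar>t - z I\<bar> < r \<gamma> I then a I else s I)"
  by (simp add: mode_def gap_of_eq)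

lemma edge_in_gap:
  assumes "\<gamma> \<in> \<Gamma>" "I \<in> gaps P" "0 < r \<gamma> I"
  shows "fst I < edge \<gamma> I \<and> edge \<gamma> I < snd I"
  using r[OF assms(1,2)] z[OF assms(2)] gap_bounds[OF assms(2)] assms(3) by (auto simp: edge_def)

lemma mode_constant_off:
  assumes \<gamma>: "\<gamma> \<in> \<Gamma>"
  shows "constant_off T (exceptional \<gamma>) (mode \<gamma>)"
  unfolding constant_off_def
proof (intro conjI allI impI finite_exceptional)
  fix t t' assume t: "0 \<le> t \<and> t \<le> t' \<and> t' \<le> T \<and> {t..t'} \<inter> exceptional \<gamma> = {}"
  define I where "I = gap_of t"
  have PI: "{t..t'} \<inter> P = {}" using t by (auto simp: exceptional_def)
  note g = same_gap[of t t', folded I_def]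
  have I: "I \<in> gaps P" "fst I < t" "t' < snd I" using g t PI by auto
  have "edge \<gamma> I \<notin> {t..t'}" using t I by (auto simp: exceptional_def)
  then have "\<bar>t - z I\<bar> < r \<gamma> I \<longleftrightarrow> \<bar>t' - z I\<bar> < r \<gamma> I"
    using z[OF I(1)] I t r[OF \<gamma> I(1)] by (auto simp: edge_def split: if_splits)
  then show "mode \<gamma> t = mode \<gamma> t'" using I t by (simp add: mode_eq)
qed

lemma mode_before_edge:
  assumes "\<gamma> \<in> \<Gamma>" "I \<in> gaps P" "0 < r \<gamma> I"
  shows "\<forall>\<^sub>F t in at_left (edge \<gamma> I). mode \<gamma> t = (if z I = fst I then a I else s I)"
proof -
  have "fst I < edge \<gamma> I" using edge_in_gap[OF assms] by simp
  then have "\<forall>\<^sub>F t in at_left (edge \<gamma> I). t \<in> {fst I<..<edge \<gamma> I}"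
    by (rule eventually_at_leftI[rotated])
  then show ?thesis
  proof eventually_elim
    case (elim t)
    then have "t < snd I" using edge_in_gap[OF assms] by auto
    then show ?case using elim z[OF assms(2)] gap_bounds[OF assms(2)]
      by (auto simp: mode_eq[OF assms(2)] edge_def)
  qed
qed

lemma mode_after_edge:
  assumes "\<gamma> \<in> \<Gamma>" "I \<in> gaps P" "0 < r \<gamma> I"
  shows "\<forall>\<^sub>F t in at_right (edge \<gamma> I). mode \<gamma> t = (if z I = fst I then s I else a I)"
proof -
  have "edge \<gamma> I < snd I" using edge_in_gap[OF assms] by simp
  then have "\<forall>\<^sub>F t in at_right (edge \<gamma> I). t \<in> {edge \<gamma> I<..<snd I}"
    by (rule eventually_at_rightI[rotated])
  then show ?thesis
  proof eventually_elim
    case (elim t)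
    then have "fst I < t" using edge_in_gap[OF assms] by auto
    then show ?case using elim z[OF assms(2)] gap_bounds[OF assms(2)]
      by (auto simp: mode_eq[OF assms(2)] edge_def)
  qed
qed

lemma edge_switch_point:
  assumes "\<gamma> \<in> \<Gamma>" "I \<in> gaps P" "0 < r \<gamma> I"
  shows "edge \<gamma> I \<in> switch_points T (mode \<gamma>)"
proof -
  have "\<not> (\<forall>\<^sub>F t in at (edge \<gamma> I). mode \<gamma> t = k)" for k
  proof
    assume "\<forall>\<^sub>F t in at (edge \<gamma> I). mode \<gamma> t = k"
    note k = eventually_at_both[OF this]
    have "k = (if z I = fst I then a I else s I)" "k = (if z I = fst I then s I else a I)"
      using eventually_const_eq[OF k(1) mode_before_edge[OF assms]]
        eventually_const_eq[OF k(2) mode_after_edge[OF assms]] by simp_all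
    then show False using a_s[OF assms] by (auto split: if_splits)
  qed
  then show ?thesis
    using edge_in_gap[OF assms] gap_bounds[OF assms(2)] by (auto simp: switch_points_def)
qed

text \<open>
Near a point of \<open>P\<close> two members of the family agree, because a length \<open>r\<close> is positive for both or for neither
and is smaller than the gap.
\<close>

lemma mode_germ_at_P:
  assumes \<gamma>: "\<gamma> \<in> \<Gamma>" "\<gamma>' \<in> \<Gamma>" and p: "p \<in> P" "0 < p" "p < T"
  shows "\<forall>\<^sub>F t in at p. mode \<gamma> t = mode \<gamma>' t"
proof -
  have "\<forall>\<^sub>F t in at p. fst I < t \<and> t < snd I \<longrightarrow> (\<bar>t - z I\<bar> < r \<gamma> I \<longleftrightarrow> \<bar>t - z I\<bar> < r \<gamma>' I)"
    if I: "I \<in> gaps P" for I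
  proof -
    note rI = r[OF \<gamma>(1) I] r[OF \<gamma>(2) I] and rp = r_pos[OF \<gamma> I] r_pos[OF \<gamma>(2,1) I]
    have "p \<le> fst I \<or> snd I \<le> p" using gap_disjoint[OF I, of p] p by force
    then consider "p = z I" | "p < fst I" | "snd I < p" | "p \<noteq> z I" "p = fst I" | "p \<noteq> z I" "p = snd I"
      by linarith
    then show ?thesis
    proof cases
      case 1
      show ?thesis
      proof (cases "0 < r \<gamma> I")
        case True
        then have "0 < r \<gamma>' I" by (rule rp)
        then have "\<forall>\<^sub>F t in at p. p - min (r \<gamma> I) (r \<gamma>' I) < t \<and> t < p + min (r \<gamma> I) (r \<gamma>' I)"
          using True by (intro eventually_at_interval) auto
        then show ?thesis by eventually_elim (use 1 in auto)
      next
        case False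
        then have "\<not> 0 < r \<gamma>' I" using rp(2) by blast
        with False have "r \<gamma> I = 0" "r \<gamma>' I = 0" using rI by linarith+
        then show ?thesis by simp
      qed
    next
      case 2
      have "\<forall>\<^sub>F t in at p. p - 1 < t \<and> t < fst I" by (rule eventually_at_interval) (use 2 in auto)
      then show ?thesis by eventually_elim auto
    next
      case 3
      have "\<forall>\<^sub>F t in at p. snd I < t \<and> t < p + 1" by (rule eventually_at_interval) (use 3 in auto)
      then show ?thesis by eventually_elim auto
    next
      case 4
      define m where "m = max (r \<gamma> I) (r \<gamma>' I)"
      have m: "m < snd I - fst I" "r \<gamma> I \<le> m" "r \<gamma>' I \<le> m" using rI by (auto simp: m_def)
      have zI: "z I = snd I" using 4 z[OF I] by auto
      have "\<forall>\<^sub>F t in at p. p - 1 < t \<and> t < snd I - m" by (rule eventually_at_interval) (use 4 m in auto)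
      then show ?thesis by eventually_elim (use zI m in auto)
    next
      case 5
      define m where "m = max (r \<gamma> I) (r \<gamma>' I)"
      have m: "m < snd I - fst I" "r \<gamma> I \<le> m" "r \<gamma>' I \<le> m" using rI by (auto simp: m_def)
      have zI: "z I = fst I" using 5 z[OF I] by auto
      have "\<forall>\<^sub>F t in at p. fst I + m < t \<and> t < p + 1" by (rule eventually_at_interval) (use 5 m in auto)
      then show ?thesis by eventually_elim (use zI m in auto)
    qed
  qed
  then have "\<forall>\<^sub>F t in at p. \<forall>I\<in>gaps P. fst I < t \<and> t < snd I \<longrightarrow>
      (\<bar>t - z I\<bar> < r \<gamma> I \<longleftrightarrow> \<bar>t - z I\<bar> < r \<gamma>' I)"
    by (intro eventually_ball_finite finite_gaps P) auto
  moreover have "\<forall>\<^sub>F t in at p. 0 < t \<and> t < T" by (rule eventually_at_interval[OF p(2,3)])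
  moreover have "\<forall>\<^sub>F t in at p. t \<notin> P" by (rule eventually_notin_finite[OF P(1)])
  ultimately show ?thesis
  proof eventually_elim
    case (elim t)
    then have "gap_of t \<in> gaps P \<and> fst (gap_of t) < t \<and> t < snd (gap_of t)" using gap_of[of t] by auto
    then show ?case using elim(1) by (auto simp: mode_def Let_def)
  qed
qed

lemma switch_point_cases:
  assumes \<gamma>: "\<gamma> \<in> \<Gamma>" and t: "t \<in> switch_points T (mode \<gamma>)" "t \<notin> P"
  shows "gap_of t \<in> gaps P" "0 < r \<gamma> (gap_of t)" "t = edge \<gamma> (gap_of t)"
proof -
  have "t \<in> exceptional \<gamma>" using switch_points_subset[OF mode_constant_off[OF \<gamma>]] t by blast
  then obtain I where I: "I \<in> gaps P" "t = edge \<gamma> I" using t by (auto simp: exceptional_def)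
  have "0 < r \<gamma> I"
  proof (rule ccontr)
    assume "\<not> 0 < r \<gamma> I"
    then have "edge \<gamma> I = z I" using r[OF \<gamma> I(1)] by (simp add: edge_def)
    then show False using I t(2) z[OF I(1)] gap_ends[OF I(1)] by auto
  qed
  moreover from this have "gap_of t = I"
    using edge_in_gap[OF \<gamma> I(1)] I by (intro gap_of_eq) auto
  ultimately show "gap_of t \<in> gaps P" "0 < r \<gamma> (gap_of t)" "t = edge \<gamma> (gap_of t)" using I by auto
qed

text \<open>
The correspondence between the switching points of two members of the family: points of \<open>P\<close> stay, the moving
edge of a gap goes to the moving edge of the same gap.
\<close>

definition transport :: "real \<Rightarrow> real \<Rightarrow> real" where
  "transport \<gamma>' t = (if t \<in> P then t else edge \<gamma>' (gap_of t))"

lemma transport_switch_point: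
  assumes \<gamma>: "\<gamma> \<in> \<Gamma>" "\<gamma>' \<in> \<Gamma>" and t: "t \<in> switch_points T (mode \<gamma>)"
  shows "transport \<gamma>' t \<in> switch_points T (mode \<gamma>')"
proof (cases "t \<in> P")
  case True
  have ev: "\<forall>\<^sub>F s in at t. mode \<gamma>' s = mode \<gamma> s"
    by (rule mode_germ_at_P[OF \<gamma>(2,1) True]) (use t in \<open>auto simp: switch_points_def\<close>)
  have "\<not> (\<forall>\<^sub>F s in at t. mode \<gamma>' s = k)" for k
  proof
    assume "\<forall>\<^sub>F s in at t. mode \<gamma>' s = k"
    with ev have "\<forall>\<^sub>F s in at t. mode \<gamma> s = k" by eventually_elim auto
    then show False using t by (auto simp: switch_points_def)
  qed
  then show ?thesis using t True by (auto simp: transport_def switch_points_def)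
next
  case False
  note c = switch_point_cases[OF \<gamma>(1) t False]
  show ?thesis using edge_switch_point[OF \<gamma>(2) c(1) r_pos[OF \<gamma> c(1,2)]] False
    by (simp add: transport_def)
qed

lemma transport_position:
  assumes \<gamma>: "\<gamma> \<in> \<Gamma>" "\<gamma>' \<in> \<Gamma>" and t: "t \<in> switch_points T (mode \<gamma>)" and p: "p \<in> P"
  shows "t < p \<Longrightarrow> transport \<gamma>' t < p" "p < t \<Longrightarrow> p < transport \<gamma>' t"
    "t = p \<Longrightarrow> transport \<gamma>' t = p"
proof -
  have "(t < p \<longrightarrow> transport \<gamma>' t < p) \<and> (p < t \<longrightarrow> p < transport \<gamma>' t) \<and> (t = p \<longrightarrow> transport \<gamma>' t = p)"
  proof (cases "t \<in> P")
    case False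
    let ?I = "gap_of t"
    note c = switch_point_cases[OF \<gamma>(1) t False]
    have I: "fst ?I < t" "t < snd ?I" using edge_in_gap[OF \<gamma>(1) c(1,2)] c(3) by auto
    have I': "fst ?I < transport \<gamma>' t" "transport \<gamma>' t < snd ?I"
      using edge_in_gap[OF \<gamma>(2) c(1) r_pos[OF \<gamma> c(1,2)]] False by (auto simp: transport_def)
    have "p \<le> fst ?I \<or> snd ?I \<le> p" using gap_disjoint[OF c(1), of p] p by force
    then show ?thesis using I I' by auto
  qed (auto simp: transport_def)
  then show "t < p \<Longrightarrow> transport \<gamma>' t < p" "p < t \<Longrightarrow> p < transport \<gamma>' t"
    "t = p \<Longrightarrow> transport \<gamma>' t = p" by auto
qed

text \<open>
Each gap contains at most one switching point, so two switching points are separated by a point of \<open>P\<close>, and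
transport does not move points across \<open>P\<close>.
\<close>

lemma transport_mono:
  assumes \<gamma>: "\<gamma> \<in> \<Gamma>" "\<gamma>' \<in> \<Gamma>"
    and t: "t \<in> switch_points T (mode \<gamma>)" "t' \<in> switch_points T (mode \<gamma>)" "t < t'"
  shows "transport \<gamma>' t < transport \<gamma>' t'"
proof -
  have "\<exists>p\<in>P. t \<le> p \<and> p \<le> t'"
  proof (rule ccontr)
    assume *: "\<not> (\<exists>p\<in>P. t \<le> p \<and> p \<le> t')"
    then have P': "t \<notin> P" "t' \<notin> P" "{t..t'} \<inter> P = {}" using t(3) by auto
    have "t \<in> {0..T}" "t' \<in> {0..T}" using t by (auto simp: switch_points_def)
    then have "gap_of t' = gap_of t" using same_gap(1) P'(3) t(3) by auto
    then show False
      using switch_point_cases(3)[OF \<gamma>(1) t(1) P'(1)] switch_point_cases(3)[OF \<gamma>(1) t(2) P'(2)] t(3) by simp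
  qed
  then obtain p where p: "p \<in> P" "t \<le> p" "p \<le> t'" by blast
  note 1 = transport_position[OF \<gamma> t(1) p(1)] and 2 = transport_position[OF \<gamma> t(2) p(1)]
  consider "t < p" | "p < t'" using p t(3) by linarith
  then show ?thesis using 1 2 p by cases (metis order_le_less order_less_trans order_less_le_trans)+
qed

text \<open>
The schedules of two members have the same length, hence their switching times correspond by index. This
identifies each switching time, as a function of \<open>\<gamma>\<close>, either as a fixed point of \<open>P\<close> or as the edge of a fixed gap.
\<close>

lemma schedule_times_transport:
  assumes \<gamma>: "\<gamma> \<in> \<Gamma>" "\<gamma>' \<in> \<Gamma>"
    and sch: "mode_schedule T v M \<sigma> \<tau>" "mode_schedule T v' M \<sigma>' \<tau>'"
    and v: "\<And>t. t \<in> {0..T} - exceptional \<gamma> \<Longrightarrow> v t = axis (mode \<gamma> t) 1"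
    and v': "\<And>t. t \<in> {0..T} - exceptional \<gamma>' \<Longrightarrow> v' t = axis (mode \<gamma>' t) 1"
    and i: "i \<in> {1..<M}"
  shows "\<tau>' i = transport \<gamma>' (\<tau> i)"
proof -
  have sp: "\<tau> ` {1..<M} = switch_points T (mode \<gamma>)" "\<tau>' ` {1..<M} = switch_points T (mode \<gamma>')"
    by (rule schedule_switch_points[OF sch(1) mode_constant_off[OF \<gamma>(1)]],
        erule v, rule schedule_switch_points[OF sch(2) mode_constant_off[OF \<gamma>(2)]], erule v')
  have "transport \<gamma>' (\<tau> i) = \<tau>' i"
  proof (rule increasing_enumerations_correspond[where f = \<tau> and g = \<tau>' and \<phi> = "transport \<gamma>'", OF _ _ _ _ i])
    fix i j assume ij: "i \<in> {1..<M}" "j \<in> {1..<M}" "i < j"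
    show lt: "\<tau> i < \<tau> j" using schedule_mono[OF sch(1)] ij by auto
    show "\<tau>' i < \<tau>' j" using schedule_mono[OF sch(2)] ij by auto
    show "transport \<gamma>' (\<tau> i) < transport \<gamma>' (\<tau> j)"
      by (rule transport_mono[OF \<gamma> _ _ lt]) (use sp ij in blast)+
  next
    fix i assume "i \<in> {1..<M}"
    then show "transport \<gamma>' (\<tau> i) \<in> \<tau>' ` {1..<M}"
      unfolding sp(2) by (intro transport_switch_point[OF \<gamma>]) (use sp(1) in blast)
  qed
  then show ?thesis by simp
qed

lemma schedule_modes_at_edge:
  assumes \<gamma>: "\<gamma> \<in> \<Gamma>" and sch: "mode_schedule T v M \<sigma> \<tau>"
    and v: "\<And>t. t \<in> {0..T} - exceptional \<gamma> \<Longrightarrow> v t = axis (mode \<gamma> t) 1"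
    and i: "i \<in> {1..<M}" and I: "I \<in> gaps P" "0 < r \<gamma> I" "\<tau> i = edge \<gamma> I"
  shows "\<sigma> i = (if z I = fst I then a I else s I)" "\<sigma> (i + 1) = (if z I = fst I then s I else a I)"
proof -
  note m = mode_constant_off[OF \<gamma>]
  have "\<forall>\<^sub>F t in at_left (\<tau> i). mode \<gamma> t = \<sigma> i"
    by (rule schedule_before[OF sch m v]) (use i in auto)
  then show "\<sigma> i = (if z I = fst I then a I else s I)"
    by (rule eventually_const_eq) (use mode_before_edge[OF \<gamma> I(1,2)] I(3) in auto)
  have "\<forall>\<^sub>F t in at_right (\<tau> i). mode \<gamma> t = \<sigma> (i + 1)"
    by (rule schedule_after[OF sch m v]) (use i in auto)
  then show "\<sigma> (i + 1) = (if z I = fst I then s I else a I)"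
    by (rule eventually_const_eq) (use mode_after_edge[OF \<gamma> I(1,2)] I(3) in auto)
qed

lemma switch_distance_mode:
  assumes \<gamma>: "\<gamma> \<in> \<Gamma>"
  shows "switch_distance T (base_mode s) (mode \<gamma>) = (\<Sum>I\<in>gaps P. r \<gamma> I)"
proof -
  define A where "A = (\<lambda>I. {min (z I) (edge \<gamma> I)..max (z I) (edge \<gamma> I)})"
  have A: "((\<lambda>t. if t \<in> A I then 1 else 0::real) has_integral r \<gamma> I) {0..T}" if I: "I \<in> gaps P" for I
  proof -
    have sub: "A I \<subseteq> {0..T}"
      using z[OF I] r[OF \<gamma> I] gap_bounds[OF I] by (auto simp: A_def edge_def split: if_splits)
    have le: "min (z I) (edge \<gamma> I) \<le> max (z I) (edge \<gamma> I)" by simp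
    have "((\<lambda>t. 1::real) has_integral (max (z I) (edge \<gamma> I) - min (z I) (edge \<gamma> I))) (A I)"
      using has_integral_const_real[of "1::real" "min (z I) (edge \<gamma> I)" "max (z I) (edge \<gamma> I)"]
      unfolding A_def content_real[OF le] by simp
    moreover have "max (z I) (edge \<gamma> I) - min (z I) (edge \<gamma> I) = r \<gamma> I"
      using r[OF \<gamma> I] by (auto simp: edge_def)
    ultimately show ?thesis using has_integral_restrict[OF sub] by fastforce
  qed
  have "((\<lambda>t. \<Sum>I\<in>gaps P. if t \<in> A I then 1 else 0::real) has_integral (\<Sum>I\<in>gaps P. r \<gamma> I)) {0..T}"
    by (intro has_integral_sum finite_gaps P A)
  then have "((\<lambda>t. if mode \<gamma> t = base_mode s t then 0 else 1::real) has_integral (\<Sum>I\<in>gaps P. r \<gamma> I)) {0..T}"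
  proof (rule has_integral_spike_finite[OF finite_exceptional[of \<gamma>], rotated])
    fix t assume t: "t \<in> {0..T} - exceptional \<gamma>"
    define I where "I = gap_of t"
    have I: "I \<in> gaps P" "fst I < t" "t < snd I" using gap_of[of t] t by (auto simp: I_def exceptional_def)
    have off: "t \<noteq> edge \<gamma> I" using t I by (auto simp: exceptional_def)
    have other: "t \<notin> A J" if "J \<in> gaps P" "J \<noteq> I" for J
    proof
      assume "t \<in> A J"
      then have "fst J \<le> t" "t \<le> snd J"
        using z[OF that(1)] r[OF \<gamma> that(1)] gap_bounds[OF that(1)]
        by (auto simp: A_def edge_def split: if_splits)
      moreover have "t \<notin> P" using t by (auto simp: exceptional_def)
      ultimately have "fst J < t" "t < snd J" using gap_ends[OF that(1)] by (auto simp: less_le)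
      then show False using gap_unique[OF that(1) I(1)] I that(2) by blast
    qed
    have "(\<Sum>J\<in>gaps P. if t \<in> A J then 1 else 0::real) = (if t \<in> A I then 1 else 0)"
      using finite_gaps[OF P(1)] I(1) other by (subst sum.remove[of _ I]) auto
    moreover have "t \<in> A I \<longleftrightarrow> \<bar>t - z I\<bar> < r \<gamma> I"
      using off z[OF I(1)] r[OF \<gamma> I(1)] I by (auto simp: A_def edge_def split: if_splits)
    moreover have "a I \<noteq> s I" if "\<bar>t - z I\<bar> < r \<gamma> I" using a_s[OF \<gamma> I(1)] that by linarith
    ultimately show "(if mode \<gamma> t = base_mode s t then 0 else 1::real) = (\<Sum>J\<in>gaps P. if t \<in> A J then 1 else 0)"
      by (simp add: mode_eq[OF I] base_mode_def I_def[symmetric])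
  qed
  then show ?thesis unfolding switch_distance_def by (rule integral_unique)
qed

end

section \<open>The dominant mode on a gap\<close>

lemma max_select_eq_axis:
  fixes \<mu> :: "real \<Rightarrow> real ^ 'k::finite"
  assumes "\<And>b. b \<noteq> k \<Longrightarrow> \<mu> t $ b < \<mu> t $ k"
  shows "max_select \<mu> t = axis k 1"
proof (rule vec_eq_iff[THEN iffD2], rule allI)
  fix i
  show "max_select \<mu> t $ i = axis k 1 $ i"
  proof (cases "i = k")
    case True
    have "step (\<mu> t $ k - \<mu> t $ j) = 1" if "j \<noteq> k" for j using assms[OF that] by (simp add: step_def)
    then show ?thesis using True by (simp add: max_select_def axis_def)
  next
    case False
    then have "step (\<mu> t $ i - \<mu> t $ k) = 0" using assms[OF False] by (simp add: step_def)
    then have "(\<Prod>j\<in>UNIV - {i}. step (\<mu> t $ i - \<mu> t $ j)) = 0"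
      using False by (intro prod_zero) auto
    then show ?thesis using False by (simp add: max_select_def axis_def)
  qed
qed

lemma nonvanishing_keeps_sign:
  fixes h :: "real \<Rightarrow> real"
  assumes h: "continuous_on {p<..<q} h" and nz: "\<And>t. t \<in> {p<..<q} \<Longrightarrow> h t \<noteq> 0"
    and m: "m \<in> {p<..<q}" "h m > 0" and t: "t \<in> {p<..<q}"
  shows "h t > 0"
proof (rule ccontr)
  assume "\<not> h t > 0"
  have "connected (h ` {p<..<q})" by (rule connected_continuous_image[OF h]) simp
  then have "0 \<in> h ` {p<..<q}"
    by (rule connectedD_interval[of _ "h t" "h m"]) (use m t \<open>\<not> h t > 0\<close> in auto)
  then show False using nz by auto
qed

text \<open>
If mode \<open>s\<close> is active and \<open>v\<close> is the insertion gradient, then \<open>if b = s then 1 else - \<gamma> * v b\<close> is the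
component \<open>b\<close> of the control minus \<open>\<gamma>\<close> times the gradient, as \<open>v s = 0\<close>. Strict dominance leaves no tie, so the projection selects \<open>k\<close>
alone.
\<close>

definition dominates :: "'k \<Rightarrow> real \<Rightarrow> ('k \<Rightarrow> real) \<Rightarrow> 'k \<Rightarrow> bool" where
  "dominates s \<gamma> v k \<longleftrightarrow>
     (\<forall>b. b \<noteq> k \<longrightarrow> (if b = s then 1 else - \<gamma> * v b) < (if k = s then 1 else - \<gamma> * v k))"

text \<open>
On a gap the components \<open>g b\<close> never meet, so one of them, \<open>a\<close>, is the smallest throughout. If \<open>a = s\<close> no
component is negative and \<open>s\<close> stays dominant. Otherwise \<open>g a\<close> is negative and, having no critical point, monotone, so its
infimum is its value at one end \<open>z\<close>. If that value exceeds \<open>\<theta>\<close>, then \<open>- \<gamma> * g a\<close> stays below 1 for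
\<open>\<gamma>\<close> close to \<open>-1 / \<theta>\<close>. If it equals \<open>\<theta>\<close>, then \<open>a\<close> wins exactly on the part of the gap next to \<open>z\<close> where
\<open>g a\<close> is below \<open>- 1 / \<gamma>\<close>. The first two cases are expressed by \<open>r \<gamma> = 0\<close>.
\<close>

lemma gap_dichotomy:
  fixes g g' :: "'k::finite \<Rightarrow> real \<Rightarrow> real"
  assumes pq: "p < q"
    and cont: "\<And>b. continuous_on {p..q} (g b)" and cont': "\<And>b. continuous_on {p..q} (g' b)"
    and der: "\<And>b t. t \<in> {p<..<q} \<Longrightarrow> (g b has_real_derivative g' b t) (at t)"
    and nz: "\<And>b t. b \<noteq> s \<Longrightarrow> t \<in> {p<..<q} \<Longrightarrow> g' b t \<noteq> 0"
    and gs: "\<And>t. g s t = 0"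
    and neq: "\<And>b c t. b \<noteq> c \<Longrightarrow> t \<in> {p<..<q} \<Longrightarrow> g b t \<noteq> g c t"
    and \<theta>: "\<theta> < 0" and lower: "\<And>b t. t \<in> {p<..<q} \<Longrightarrow> \<theta> \<le> g b t"
  shows "\<exists>z a r \<gamma>1. (z = p \<or> z = q) \<and> \<gamma>1 > - 1 / \<theta> \<and>
    (\<forall>\<gamma>\<in>{- 1 / \<theta><..<\<gamma>1}. 0 \<le> r \<gamma> \<and> r \<gamma> < q - p \<and>
       (\<forall>t\<in>{p<..<q}. t \<noteq> (if z = p then z + r \<gamma> else z - r \<gamma>) \<longrightarrow>
          dominates s \<gamma> (\<lambda>b. g b t) (if \<bar>t - z\<bar> < r \<gamma> then a else s))) \<and>
    ((\<forall>\<gamma>\<in>{- 1 / \<theta><..<\<gamma>1}. r \<gamma> = 0) \<or>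
     a \<noteq> s \<and> g a z = \<theta> \<and> (r \<longlongrightarrow> 0) (at_right (- 1 / \<theta>)) \<and>
     (\<forall>\<gamma>\<in>{- 1 / \<theta><..<\<gamma>1}. 0 < r \<gamma> \<and> g a (if z = p then z + r \<gamma> else z - r \<gamma>) = - 1 / \<gamma>))"
    (is "\<exists>z a r \<gamma>1. ?Q z a r \<gamma>1")
proof -
  define m where "m = (p + q) / 2"
  have m: "m \<in> {p<..<q}" using pq by (auto simp: m_def)
  have \<gamma>_pos: "\<gamma> > 0" if "- 1 / \<theta> < \<gamma>" for \<gamma>
  proof -
    have "0 < - 1 / \<theta>" using \<theta> by simp
    then show ?thesis using that by (rule less_trans)
  qed
  obtain a where a: "\<And>b. g a m \<le> g b m"
  proof -
    have "Min (range (\<lambda>b. g b m)) \<in> range (\<lambda>b. g b m)" by (rule Min_in) auto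
    then obtain a where "g a m = Min (range (\<lambda>b. g b m))" by (metis rangeE)
    then show ?thesis by (intro that[of a]) auto
  qed
  have least: "g a t < g b t" if t: "t \<in> {p<..<q}" and b: "b \<noteq> a" for b t
  proof -
    have "0 < g b t - g a t"
    proof (rule nonvanishing_keeps_sign[where h = "\<lambda>t. g b t - g a t", OF _ _ m _ t])
      show "continuous_on {p<..<q} (\<lambda>t. g b t - g a t)"
        by (intro continuous_intros continuous_on_subset[OF cont]) auto
      show "0 < g b m - g a m" using a[of b] neq[OF b m] by simp
    qed (use neq[OF b] in auto)
    then show ?thesis by simp
  qed
  show ?thesis
  proof (cases "a = s")
    case True
    have "- \<gamma> * g b t < 1" if "\<gamma> \<in> {- 1 / \<theta><..<- 1 / \<theta> + 1}" "t \<in> {p<..<q}" "b \<noteq> s" for \<gamma> t b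
    proof -
      have "0 < g b t" using least[OF that(2)] that(3) gs True by fastforce
      moreover have "0 < \<gamma>" using that(1) by (intro \<gamma>_pos) auto
      ultimately have "0 < \<gamma> * g b t" by simp
      then show ?thesis by simp
    qed
    then have "?Q p s (\<lambda>\<gamma>. 0) (- 1 / \<theta> + 1)" using pq by (simp add: dominates_def)
    then show ?thesis by (intro exI)
  next
    case False
    have neg: "g a t < 0" if "t \<in> {p<..<q}" for t using least[OF that, of s] False gs by auto
    have ends: "\<theta> \<le> g a p" "\<theta> \<le> g a q"
      using continuous_ge_on_closure[of "{p<..<q}" "g a" _ \<theta>] cont pq lower by auto
    have still: "?Q p s (\<lambda>\<gamma>. 0) (- 1 / \<kappa>)"
      if \<kappa>: "\<theta> < \<kappa>" "\<kappa> < 0" "\<And>t. t \<in> {p<..<q} \<Longrightarrow> \<kappa> < g a t" for \<kappa>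
    proof -
      have "- 1 / \<theta> < - 1 / \<kappa>" using \<kappa> \<theta> by (simp add: field_simps)
      moreover have "- \<gamma> * g b t < 1" if "\<gamma> \<in> {- 1 / \<theta><..<- 1 / \<kappa>}" "t \<in> {p<..<q}" for \<gamma> t b
      proof -
        have "\<kappa> < g b t" using \<kappa>(3)[OF that(2)] least[OF that(2), of b] by (cases "b = a") auto
        moreover have "\<gamma> > 0" using that(1) by (intro \<gamma>_pos) auto
        ultimately have "- \<gamma> * g b t < - \<gamma> * \<kappa>" by simp
        also have "\<dots> < 1" using that(1) \<kappa> by (simp add: field_simps)
        finally show ?thesis .
      qed
      ultimately show ?thesis using pq by (auto simp: dominates_def)
    qed
    have moving: "?Q z a r \<gamma>1"
      if z: "z = p \<or> z = q" "g a z = \<theta>" and \<gamma>1: "\<gamma>1 > - 1 / \<theta>"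
        and r0: "(r \<longlongrightarrow> 0) (at_right (- 1 / \<theta>))"
        and r: "\<And>\<gamma>. \<gamma> \<in> {- 1 / \<theta><..<\<gamma>1} \<Longrightarrow> 0 < r \<gamma> \<and> r \<gamma> < q - p \<and>
          g a (if z = p then z + r \<gamma> else z - r \<gamma>) = - 1 / \<gamma>"
        and sides: "\<And>\<gamma> t. \<gamma> \<in> {- 1 / \<theta><..<\<gamma>1} \<Longrightarrow> t \<in> {p<..<q} \<Longrightarrow>
          t \<noteq> (if z = p then z + r \<gamma> else z - r \<gamma>) \<Longrightarrow>
          (if \<bar>t - z\<bar> < r \<gamma> then g a t < - 1 / \<gamma> else - 1 / \<gamma> < g a t)" for z r \<gamma>1
    proof -
      have "dominates s \<gamma> (\<lambda>b. g b t) (if \<bar>t - z\<bar> < r \<gamma> then a else s)"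
        if \<gamma>: "\<gamma> \<in> {- 1 / \<theta><..<\<gamma>1}" and t: "t \<in> {p<..<q}"
          "t \<noteq> (if z = p then z + r \<gamma> else z - r \<gamma>)" for \<gamma> t
      proof -
        have \<gamma>p: "\<gamma> > 0" using \<gamma> by (intro \<gamma>_pos) auto
        have side: "(1 < - \<gamma> * g a t) = (g a t < - 1 / \<gamma>)" "(- \<gamma> * g a t < 1) = (- 1 / \<gamma> < g a t)"
          using \<gamma>p by (auto simp: field_simps)
        have le: "- \<gamma> * g b t \<le> - \<gamma> * g a t" "b \<noteq> a \<Longrightarrow> - \<gamma> * g b t < - \<gamma> * g a t" for b
          using least[OF t(1), of b] \<gamma>p by (cases "b = a"; simp)+
        have lt1: "- \<gamma> * g b t < 1" if "- \<gamma> * g a t < 1" for b using le(1)[of b] that by linarith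
        show ?thesis
          unfolding dominates_def using sides[OF \<gamma> t] side le lt1 False by (auto split: if_splits)
      qed
      moreover have "0 \<le> r \<gamma>" if "\<gamma> \<in> {- 1 / \<theta><..<\<gamma>1}" for \<gamma> using r[OF that] by simp
      ultimately show ?thesis using z \<gamma>1 r0 r False by simp
    qed
    show ?thesis
    proof (cases "g' a m > 0")
      case True
      have pos: "g' a t > 0" if "t \<in> {p<..<q}" for t
        by (rule nonvanishing_keeps_sign[where h = "g' a", OF _ _ m True that])
          (use nz False in \<open>auto intro: continuous_on_subset[OF cont']\<close>)
      have inc: "g a t < g a t'" if "p \<le> t" "t < t'" "t' \<le> q" for t t'
        by (rule DERIV_pos_imp_increasing_open[OF that(2)])
          (use that der pos in \<open>force intro: continuous_on_subset[OF cont]\<close>)+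
      show ?thesis
      proof (cases "g a p = \<theta>")
        case True
        obtain \<gamma>1 r where \<gamma>1: "\<gamma>1 > - 1 / \<theta>"
          and r: "\<And>\<gamma>. \<gamma> \<in> {- 1 / \<theta><..<\<gamma>1} \<Longrightarrow> 0 < r \<gamma> \<and> r \<gamma> < q - p \<and> g a (p + r \<gamma>) = - 1 / \<gamma>"
          and r0: "(r \<longlongrightarrow> 0) (at_right (- 1 / \<theta>))"
        proof (rule threshold_crossing[of "q - p" "\<lambda>v. g a (p + v)" \<theta>])
          show "continuous_on {0..q - p} (\<lambda>v. g a (p + v))"
            by (rule continuous_on_compose2[OF cont]) (auto intro!: continuous_intros)
        qed (use pq inc True \<theta> in auto)
        have "?Q p a r \<gamma>1"
        proof (rule moving[OF _ True \<gamma>1 r0])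
          fix \<gamma> t assume \<gamma>: "\<gamma> \<in> {- 1 / \<theta><..<\<gamma>1}" and t: "t \<in> {p<..<q}" "t \<noteq> (if p = p then p + r \<gamma> else p - r \<gamma>)"
          consider "t < p + r \<gamma>" | "p + r \<gamma> < t" using t by (auto simp: neq_iff)
          then show "if \<bar>t - p\<bar> < r \<gamma> then g a t < - 1 / \<gamma> else - 1 / \<gamma> < g a t"
            using inc[of t "p + r \<gamma>"] inc[of "p + r \<gamma>" t] r[OF \<gamma>] t by cases auto
        qed (use r in auto)
        then show ?thesis by (intro exI)
      next
        case False
        then have "?Q p s (\<lambda>\<gamma>. 0) (- 1 / g a p)"
        proof (intro still)
          have "p \<le> p" "p < m" "m \<le> q" using m by auto
          from inc[OF this] show "g a p < 0" using neg[OF m] by linarith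
        qed (use ends inc in auto)
        then show ?thesis by (intro exI)
      qed
    next
      case False2: False
      have m': "- g' a m > 0" using False2 nz[OF False m] by simp
      have pos: "- g' a t > 0" if "t \<in> {p<..<q}" for t
        by (rule nonvanishing_keeps_sign[where h = "\<lambda>t. - g' a t", OF _ _ m m' that])
          (use nz False in \<open>auto intro!: continuous_intros continuous_on_subset[OF cont']\<close>)
      have dec: "g a t' < g a t" if "p \<le> t" "t < t'" "t' \<le> q" for t t'
        by (rule DERIV_neg_imp_decreasing_open[OF that(2)])
          (use that der pos in \<open>force intro: continuous_on_subset[OF cont]\<close>)+
      show ?thesis
      proof (cases "g a q = \<theta>")
        case True
        obtain \<gamma>1 r where \<gamma>1: "\<gamma>1 > - 1 / \<theta>"
          and r: "\<And>\<gamma>. \<gamma> \<in> {- 1 / \<theta><..<\<gamma>1} \<Longrightarrow> 0 < r \<gamma> \<and> r \<gamma> < q - p \<and> g a (q - r \<gamma>) = - 1 / \<gamma>"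
          and r0: "(r \<longlongrightarrow> 0) (at_right (- 1 / \<theta>))"
        proof (rule threshold_crossing[of "q - p" "\<lambda>v. g a (q - v)" \<theta>])
          show "continuous_on {0..q - p} (\<lambda>v. g a (q - v))"
            by (rule continuous_on_compose2[OF cont]) (auto intro!: continuous_intros)
        qed (use pq dec True \<theta> in auto)
        have "?Q q a r \<gamma>1"
        proof (rule moving[OF _ True \<gamma>1 r0])
          fix \<gamma> t assume \<gamma>: "\<gamma> \<in> {- 1 / \<theta><..<\<gamma>1}" and t: "t \<in> {p<..<q}" "t \<noteq> (if q = p then q + r \<gamma> else q - r \<gamma>)"
          have "t \<noteq> q - r \<gamma>" using t pq by auto
          then consider "t < q - r \<gamma>" | "q - r \<gamma> < t" by linarith
          then show "if \<bar>t - q\<bar> < r \<gamma> then g a t < - 1 / \<gamma> else - 1 / \<gamma> < g a t"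
            using dec[of t "q - r \<gamma>"] dec[of "q - r \<gamma>" t] r[OF \<gamma>] t by cases auto
        qed (use r pq in auto)
        then show ?thesis by (intro exI)
      next
        case False
        then have "?Q p s (\<lambda>\<gamma>. 0) (- 1 / g a q)"
        proof (intro still)
          have "p \<le> m" "m < q" "q \<le> q" using m by auto
          from dec[OF this] show "g a q < 0" using neg[OF m] by linarith
        qed (use ends dec in auto)
        then show ?thesis by (intro exI)
      qed
    qed
  qed
qed

lemma edge_rate:
  fixes h h1 h2 r :: "real \<Rightarrow> real"
  assumes pq: "p < q" and z: "z = p \<or> z = q"
    and h: "\<And>t. t \<in> {p..q} \<Longrightarrow> (h has_real_derivative h1 t) (at t within {p..q})"
    and h1: "\<And>t. t \<in> {p..q} \<Longrightarrow> (h1 has_real_derivative h2 t) (at t within {p..q})"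
    and \<theta>: "\<theta> < 0" "h z = \<theta>" and h1z: "h1 z = 0" and h2z: "h2 z > 0"
    and r: "\<forall>\<^sub>F \<gamma> in at_right (- 1 / \<theta>). 0 < r \<gamma> \<and> h (if z = p then z + r \<gamma> else z - r \<gamma>) = - 1 / \<gamma>"
    and r0: "(r \<longlongrightarrow> 0) (at_right (- 1 / \<theta>))"
  shows "((\<lambda>\<gamma>. r \<gamma> / sqrt (\<gamma> - (- 1 / \<theta>))) \<longlongrightarrow> sqrt 2 * \<bar>\<theta>\<bar> / sqrt (h2 z)) (at_right (- 1 / \<theta>))"
proof -
  define e :: real where "e = (if z = p then 1 else - 1)"
  let ?A = "{0..q - p}"
  have zv: "z + e * v \<in> {p..q}" if "v \<in> ?A" for v using that z pq by (auto simp: e_def)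
  have aff: "((\<lambda>v. z + e * v) has_real_derivative e) (at v within ?A)" for v
    by (auto intro!: derivative_eq_intros)
  have chain: "((\<lambda>v. \<phi> (z + e * v)) has_real_derivative D * e) (at v within ?A)"
    if "(\<phi> has_real_derivative D) (at (z + e * v) within {p..q})" for \<phi> D v
  proof (rule DERIV_image_chain[OF _ aff, unfolded comp_def])
    show "(\<phi> has_real_derivative D) (at (z + e * v) within (\<lambda>v. z + e * v) ` ?A)"
      by (rule DERIV_subset[OF that]) (use zv in auto)
  qed
  have "((\<lambda>v. (h (z + e * v) - h (z + e * 0)) / v\<^sup>2) \<longlongrightarrow> h2 z / 2) (at_right 0)"
  proof (rule quadratic_growth[of "q - p" _ "\<lambda>v. h1 (z + e * v) * e"])
    show "((\<lambda>v. h (z + e * v)) has_real_derivative h1 (z + e * v) * e) (at v within ?A)" if "v \<in> ?A" for v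
      by (rule chain[OF h[OF zv[OF that]]])
    have "z + e * 0 \<in> {p..q}" using zv[of 0] pq by auto
    then have "((\<lambda>v. h1 (z + e * v) * e) has_real_derivative (h2 (z + e * 0) * e) * e) (at 0 within ?A)"
      by (intro DERIV_cmult_right chain h1)
    then show "((\<lambda>v. h1 (z + e * v) * e) has_real_derivative h2 z) (at 0 within ?A)"
      by (auto simp: e_def split: if_splits)
  qed (use pq h1z in auto)
  then have "((\<lambda>v. (h (z + e * v) - \<theta>) / v\<^sup>2) \<longlongrightarrow> h2 z / 2) (at_right 0)" using \<theta> by simp
  then show ?thesis
  proof (rule crossing_rate[OF \<theta>(1) h2z _ _ r0])
    show "\<forall>\<^sub>F \<gamma> in at_right (- 1 / \<theta>). 0 < r \<gamma> \<and> h (z + e * r \<gamma>) = - 1 / \<gamma>"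
      using r by eventually_elim (auto simp: e_def split: if_splits)
  qed
qed

section \<open>A partition adapted to a control and its gradient\<close>

lemma binary_sum_one_is_axis:
  fixes c :: "real ^ 'k::finite"
  assumes c: "\<And>i. c $ i \<in> {0, 1}" and sum: "(\<Sum>i\<in>UNIV. c $ i) = 1"
  shows "\<exists>k. c = axis k 1"
proof -
  have "\<exists>k. c $ k \<noteq> 0"
  proof (rule ccontr)
    assume "\<not> (\<exists>k. c $ k \<noteq> 0)"
    then show False using sum by simp
  qed
  then obtain k where k: "c $ k = 1" using c by fastforce
  have "(\<Sum>i\<in>UNIV - {k}. c $ i) = 0" using sum k by (simp add: sum.remove[of _ k])
  moreover have "0 \<le> c $ i" for i using c[of i] by auto
  ultimately have "c $ i = 0" if "i \<noteq> k" for i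
    using that by (subst (asm) sum_nonneg_eq_0_iff) auto
  then have "c = axis k 1" using k by (simp add: vec_eq_iff axis_def)
  then show ?thesis by blast
qed

text \<open>
The set \<open>P\<close> consists of 0, \<open>T\<close>, the exceptional times of the control, the critical points of all differences of
components, and their zeros. The zeros are finite in number by Rolle's theorem, as a critical point lies between
any two of them.
\<close>

lemma refined_partition:
  fixes u d :: "real \<Rightarrow> real ^ 'k::finite"
  assumes T: "T > 0" and sw: "switching_control T u"
    and crit: "\<And>i j. i \<noteq> j \<Longrightarrow> finite (critical_points T (\<lambda>t. d t $ i - d t $ j))"
  obtains P s where "gap_partition T P"
    "\<And>I t. I \<in> gaps P \<Longrightarrow> fst I < t \<Longrightarrow> t < snd I \<Longrightarrow> u t = axis (s I) 1"
    "\<And>I t i j. I \<in> gaps P \<Longrightarrow> fst I < t \<Longrightarrow> t < snd I \<Longrightarrow> i \<noteq> j \<Longrightarrow> d t $ i \<noteq> d t $ j"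
    "\<And>I t i j. I \<in> gaps P \<Longrightarrow> fst I < t \<Longrightarrow> t < snd I \<Longrightarrow> i \<noteq> j \<Longrightarrow>
       \<exists>D. D \<noteq> 0 \<and> ((\<lambda>t. d t $ i - d t $ j) has_real_derivative D) (at t)"
proof -
  from sw obtain S where S: "finite S"
    and const: "\<And>s t. 0 \<le> s \<Longrightarrow> s \<le> t \<Longrightarrow> t \<le> T \<Longrightarrow> {s..t} \<inter> S = {} \<Longrightarrow> u s = u t"
    unfolding switching_control_def piecewise_constant_def by blast
  from sw have AE: "AE t in lborel. t \<in> {0..T} \<longrightarrow> (\<forall>i. u t $ i \<in> {0, 1}) \<and> (\<Sum>i\<in>UNIV. u t $ i) = 1"
    unfolding switching_control_def by blast
  define C where "C = (\<Union>(i, j)\<in>{(i, j). i \<noteq> j}. critical_points T (\<lambda>t. d t $ i - d t $ j))"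
  define P0 where "P0 = (S \<inter> {0..T}) \<union> {0, T} \<union> C"
  have "finite C" unfolding C_def using crit by auto
  then have P0: "finite P0" using S by (simp add: P0_def)
  have C_sub: "C \<subseteq> {0..T}" by (auto simp: C_def critical_points_def)
  have noncrit: "\<exists>D. D \<noteq> 0 \<and> ((\<lambda>t. d t $ i - d t $ j) has_real_derivative D) (at t)"
    if t: "t \<in> {0<..<T} - P0" and ij: "i \<noteq> j" for t i j
  proof -
    have "t \<notin> critical_points T (\<lambda>t. d t $ i - d t $ j)" using t ij by (auto simp: P0_def C_def)
    then have "\<exists>D. D \<noteq> 0 \<and> ((\<lambda>t. d t $ i - d t $ j) has_real_derivative D) (at t within {0..T})"
      using t by (auto simp: critical_points_def)
    then show ?thesis using t by (simp add: at_within_Icc_at)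
  qed
  define Z where "Z = (\<lambda>i j. {t \<in> {0<..<T} - P0. d t $ i = d t $ j})"
  have fin_Z: "finite (Z i j)" if ij: "i \<noteq> j" for i j
  proof (rule finite_separated[OF P0])
    fix s t assume st: "s \<in> Z i j" "t \<in> Z i j" "s < t"
    show "\<exists>p\<in>P0. s \<le> p \<and> p < t"
    proof (rule ccontr)
      assume no: "\<not> (\<exists>p\<in>P0. s \<le> p \<and> p < t)"
      let ?h = "\<lambda>t. d t $ i - d t $ j"
      have in_gap: "v \<in> {0<..<T} - P0" if "v \<in> {s..t}" for v
        using that st no by (cases "v = t") (auto simp: Z_def)
      have der: "\<exists>D. D \<noteq> 0 \<and> (?h has_real_derivative D) (at v)" if "v \<in> {s..t}" for v
        by (rule noncrit[OF in_gap[OF that] ij])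
      have "\<exists>w. s < w \<and> w < t \<and> (?h has_real_derivative 0) (at w)"
      proof (rule Rolle[OF st(3)])
        show "?h s = ?h t" using st by (simp add: Z_def)
        show "continuous_on {s..t} ?h"
          using der by (intro continuous_at_imp_continuous_on ballI) (blast intro: DERIV_isCont)
        show "?h differentiable (at v)" if "s < v" "v < t" for v
          using der[of v] that real_differentiable_def by auto
      qed
      then obtain w where w: "s < w" "w < t" "(?h has_real_derivative 0) (at w)" by blast
      then show False using der[of w] DERIV_unique by fastforce
    qed
  qed
  define P where "P = P0 \<union> (\<Union>(i, j)\<in>{(i, j). i \<noteq> j}. Z i j)"
  have part: "gap_partition T P"
  proof
    show "finite P" unfolding P_def using P0 fin_Z by auto
    show "P \<subseteq> {0..T}" using C_sub T by (auto simp: P_def P0_def Z_def)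
  qed (auto simp: P_def P0_def)
  interpret gap_partition T P by (rule part)
  have inside: "t \<in> {0<..<T} - P" if "I \<in> gaps P" "fst I < t" "t < snd I" for I t
    using gap_bounds[OF that(1)] gap_disjoint[OF that] that by auto
  have "\<exists>k. \<forall>t. fst I < t \<and> t < snd I \<longrightarrow> u t = axis k 1" if I: "I \<in> gaps P" for I
  proof -
    have "{fst I<..<snd I} \<noteq> {}" using gap_bounds[OF I] by auto
    from AE_lborel_open_witness[OF AE _ this] obtain c where c: "fst I < c" "c < snd I"
        "(\<forall>i. u c $ i \<in> {0, 1}) \<and> (\<Sum>i\<in>UNIV. u c $ i) = 1"
      using gap_bounds[OF I] by fastforce
    obtain k where k: "u c = axis k 1" using binary_sum_one_is_axis c(3) by blast
    have "u t = u t'" if t: "fst I < t" "t \<le> t'" "t' < snd I" for t t'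
    proof (rule const)
      show "{t..t'} \<inter> S = {}"
      proof (rule ccontr)
        assume "{t..t'} \<inter> S \<noteq> {}"
        then obtain v where "v \<in> {t..t'}" "v \<in> S" by blast
        then show False using inside[OF I, of v] t by (auto simp: P_def P0_def)
      qed
    qed (use t gap_bounds[OF I] in auto)
    then have "u t = u c" if "fst I < t" "t < snd I" for t
      using that c by (metis linear)
    then show ?thesis using k by auto
  qed
  then have "\<forall>I. \<exists>k. I \<in> gaps P \<longrightarrow> (\<forall>t. fst I < t \<and> t < snd I \<longrightarrow> u t = axis k 1)" by blast
  from choice[OF this] obtain s where
    s: "\<And>I t. I \<in> gaps P \<Longrightarrow> fst I < t \<Longrightarrow> t < snd I \<Longrightarrow> u t = axis (s I) 1" by blast
  show ?thesis
  proof (rule that[OF part])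
    show "u t = axis (s I) 1" if "I \<in> gaps P" "fst I < t" "t < snd I" for I t using s that .
  next
    fix I t and i j :: 'k assume *: "I \<in> gaps P" "fst I < t" "t < snd I" "i \<noteq> j"
    have t: "t \<in> {0<..<T} - P" by (rule inside[OF *(1-3)])
    then show "\<exists>D. D \<noteq> 0 \<and> ((\<lambda>t. d t $ i - d t $ j) has_real_derivative D) (at t)"
      by (intro noncrit *) (auto simp: P_def)
    show "d t $ i \<noteq> d t $ j" using t *(4) by (auto simp: P_def Z_def)
  qed
qed

section \<open>The nominal trajectory and the first-order decrease\<close>

lemma vfield_axis: "vfield f y (axis k 1) = f k y"
  by (simp add: vfield_def axis_def if_distrib if_distribR sum.delta cong: if_cong)

lemma adjoint_eq_sum:
  fixes D :: "'a::euclidean_space \<Rightarrow>\<^sub>L 'b::euclidean_space"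
  shows "adjoint (blinfun_apply D) v = (\<Sum>b\<in>Basis. (v \<bullet> D b) *\<^sub>R b)"
proof -
  have lin: "linear (blinfun_apply D)" by (rule bounded_linear.linear[OF blinfun.bounded_linear_right])
  have "adjoint (blinfun_apply D) v = (\<Sum>b\<in>Basis. (adjoint (blinfun_apply D) v \<bullet> b) *\<^sub>R b)"
    by (simp add: euclidean_representation)
  then show ?thesis by (simp add: adjoint_clauses[OF lin])
qed

lemma solves_state_iff_trajectory:
  fixes f :: "'k::finite \<Rightarrow> real ^ 'n \<Rightarrow> real ^ 'n"
  assumes T: "T > 0" and F: "finite F" and v: "\<And>t. t \<in> {0..T} - F \<Longrightarrow> v t = axis (m t) 1"
  shows "solves_state f x0 T v y \<longleftrightarrow> trajectory f x0 T m y"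
proof -
  have eq: "((\<lambda>s. vfield f (y s) (v s)) has_integral c) {0..t}
      \<longleftrightarrow> ((\<lambda>s. f (m s) (y s)) has_integral c) {0..t}" if "t \<in> {0..T}" for t c
    by (rule has_integral_spike_finite_eq[OF F]) (use that v in \<open>auto simp: vfield_axis\<close>)
  have cont: "continuous_on {0..T} y"
    if "\<And>t. t \<in> {0..T} \<Longrightarrow> ((\<lambda>s. f (m s) (y s)) has_integral (y t - x0)) {0..t}"
    by (rule primitive_continuous[OF primitive_from_start[OF that]]) (use T in auto)
  show ?thesis
    unfolding solves_state_def trajectory_def
    using eq cont absolutely_integrable_continuous_real by blast
qed

text \<open>
The projection chooses some trajectory of the projected control; by uniqueness all of them agree on
\<open>{0..T}\<close>, so any known one computes the cost.
\<close>

lemma projection_cost: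
  fixes f :: "'k::finite \<Rightarrow> real ^ 'n \<Rightarrow> real ^ 'n"
  assumes T: "T > 0" and f: "locally_lipschitz f" and F: "finite F"
    and v: "\<And>t. t \<in> {0..T} - F \<Longrightarrow> max_select \<mu> t = axis (m t) 1"
    and y: "trajectory f x0 T m y"
  shows "cost l T (projection f x0 T (\<alpha>, \<mu>)) = integral {0..T} (\<lambda>t. l (y t))"
proof -
  let ?x = "SOME x. solves_state f x0 T (max_select \<mu>) x"
  have iff: "solves_state f x0 T (max_select \<mu>) z \<longleftrightarrow> trajectory f x0 T m z" for z
    by (rule solves_state_iff_trajectory[OF T F v])
  have "solves_state f x0 T (max_select \<mu>) ?x"
    by (rule someI[of _ y]) (use y iff in blast)
  then have "trajectory f x0 T m ?x" unfolding iff .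
  from trajectory_unique[OF f y this]
  have "integral {0..T} (\<lambda>t. l (?x t)) = integral {0..T} (\<lambda>t. l (y t))"
    by (intro integral_cong) simp
  then show ?thesis by (simp add: cost_def projection_def)
qed

text \<open>
A nominal state \<open>x\<close> with its adjoint \<open>\<rho>\<close>, for a control \<open>u\<close> that is in mode \<open>s I\<close> on the gap \<open>I\<close>. The
derivatives are parameters so that they can be named in the estimates.
\<close>

locale insertion_setup = gap_partition T P for T :: real and P :: "real set" +
  fixes f :: "'k::finite \<Rightarrow> real ^ 'n \<Rightarrow> real ^ 'n" and l :: "real ^ 'n \<Rightarrow> real"
    and x0 :: "real ^ 'n" and x \<rho> :: "real \<Rightarrow> real ^ 'n" and u :: "real \<Rightarrow> real ^ 'k"
    and Df :: "'k \<Rightarrow> real ^ 'n \<Rightarrow> ((real ^ 'n) \<Rightarrow>\<^sub>L (real ^ 'n))"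
    and D2f :: "'k \<Rightarrow> real ^ 'n \<Rightarrow> ((real ^ 'n) \<Rightarrow>\<^sub>L ((real ^ 'n) \<Rightarrow>\<^sub>L (real ^ 'n)))"
    and Dl :: "real ^ 'n \<Rightarrow> ((real ^ 'n) \<Rightarrow>\<^sub>L real)"
    and D2l :: "real ^ 'n \<Rightarrow> ((real ^ 'n) \<Rightarrow>\<^sub>L ((real ^ 'n) \<Rightarrow>\<^sub>L real))"
    and K K' :: real and s :: "real \<times> real \<Rightarrow> 'k"
  assumes T: "T > 0"
    and Df: "\<And>k y. (f k has_derivative blinfun_apply (Df k y)) (at y)"
    and D2f: "\<And>k y. (Df k has_derivative blinfun_apply (D2f k y)) (at y)"
    and D2f_cont: "\<And>k. continuous_on UNIV (D2f k)"
    and D2f_bound: "\<And>k y. norm (D2f k y) \<le> K"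
    and Dl: "\<And>y. (l has_derivative blinfun_apply (Dl y)) (at y)"
    and D2l: "\<And>y. (Dl has_derivative blinfun_apply (D2l y)) (at y)"
    and D2l_cont: "continuous_on UNIV D2l"
    and D2l_bound: "\<And>y. norm (D2l y) \<le> K'"
    and state: "solves_state f x0 T u x"
    and costate: "solves_costate f l T x u \<rho>"
    and u: "\<And>I t. I \<in> gaps P \<Longrightarrow> fst I < t \<Longrightarrow> t < snd I \<Longrightarrow> u t = axis (s I) 1"
begin

abbreviation "m \<equiv> base_mode s"

lemma u_off_P: "t \<in> {0..T} - P \<Longrightarrow> u t = axis (m t) 1"
  using gap_of[of t] u by (simp add: base_mode_def)

lemma f_cont: "continuous_on UNIV (f k)"
  by (rule has_derivative_continuous_on) (rule has_derivative_at_withinI[OF Df])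

lemma Df_cont: "continuous_on UNIV (Df k)"
  by (rule has_derivative_continuous_on) (rule has_derivative_at_withinI[OF D2f])

lemma l_cont: "continuous_on UNIV l"
  by (rule has_derivative_continuous_on) (rule has_derivative_at_withinI[OF Dl])

lemma Dl_cont: "continuous_on UNIV Dl"
  by (rule has_derivative_continuous_on) (rule has_derivative_at_withinI[OF D2l])

lemma f_quad: "norm (f k z - f k y - blinfun_apply (Df k y) (z - y)) \<le> K * (norm (z - y))\<^sup>2"
  by (rule quadratic_remainder) (rule Df D2f D2f_bound)+

lemma l_quad: "norm (l z - l y - blinfun_apply (Dl y) (z - y)) \<le> K' * (norm (z - y))\<^sup>2"
  by (rule quadratic_remainder) (rule Dl D2l D2l_bound)+

lemma lipschitz: "locally_lipschitz f"
  unfolding locally_lipschitz_def using C1_lipschitz_on_cball[OF Df Df_cont] by blast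

lemma trajectory_x: "trajectory f x0 T m x"
  using iffD1[OF solves_state_iff_trajectory[OF T P(1)] state] u_off_P by blast

lemma cont_x: "continuous_on {0..T} x"
  using trajectory_x by (simp add: trajectory_def)

lemma primitive_x: "primitive T (\<lambda>t. f (m t) (x t)) x"
  by (rule primitive_from_start) (use trajectory_x in \<open>auto simp: trajectory_def\<close>)

text \<open>
The right-hand side of the adjoint equation in coordinates. In contrast to the transposed Frechet
derivative it depends visibly continuously on time.
\<close>

definition costate_rate :: "'k \<Rightarrow> real \<Rightarrow> real ^ 'n" where
  "costate_rate k t = (\<Sum>b\<in>Basis. (- (\<rho> t \<bullet> Df k (x t) b) - Dl (x t) b) *\<^sub>R b)"

definition costate_field :: "real \<Rightarrow> real ^ 'n" where
  "costate_field t = - adjoint (frechet_derivative (\<lambda>y. vfield f y (u t)) (at (x t))) (\<rho> t)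
              - adjoint (frechet_derivative l (at (x t))) 1"

lemma costate_field_eq:
  assumes "t \<in> {0..T} - P"
  shows "costate_field t = costate_rate (m t) t"
proof -
  have "frechet_derivative (\<lambda>y. vfield f y (u t)) (at (x t)) = blinfun_apply (Df (m t) (x t))"
    unfolding u_off_P[OF assms] vfield_axis by (rule frechet_derivative_at[OF Df, symmetric])
  moreover have "frechet_derivative l (at (x t)) = blinfun_apply (Dl (x t))"
    by (rule frechet_derivative_at[OF Dl, symmetric])
  ultimately show ?thesis
    by (simp add: costate_field_def costate_rate_def adjoint_eq_sum sum_negf scaleR_diff_left sum_subtractf)
qed

lemma primitive_\<rho>: "primitive T costate_field \<rho>"
  by (rule primitive_to_end[of _ _ "\<rho> T"])
    (use costate in \<open>auto simp: solves_costate_def costate_field_def[abs_def]\<close>)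

lemma \<rho>_end: "\<rho> T = 0"
  using costate by (simp add: solves_costate_def)

lemma cont_\<rho>: "continuous_on {0..T} \<rho>"
  by (rule primitive_continuous[OF primitive_\<rho>]) (use T in simp)

lemma cont_costate_rate: "continuous_on {0..T} (costate_rate k)"
  unfolding costate_rate_def[abs_def]
  by (intro continuous_intros cont_\<rho> continuous_on_compose2[OF Df_cont cont_x]
      continuous_on_compose2[OF Dl_cont cont_x]) auto

lemma inner_costate_rate:
  "costate_rate k t \<bullet> v = - (\<rho> t \<bullet> Df k (x t) v) - Dl (x t) v"
proof -
  have "Df k (x t) v = (\<Sum>b\<in>Basis. (v \<bullet> b) *\<^sub>R Df k (x t) b)"
    "Dl (x t) v = (\<Sum>b\<in>Basis. (v \<bullet> b) *\<^sub>R Dl (x t) b)"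
    using euclidean_representation[of v]
    by (metis (no_types, lifting) blinfun.scaleR_right blinfun.sum_right sum.cong)+
  then show ?thesis
    by (simp add: costate_rate_def inner_sum_left inner_sum_right algebra_simps sum.distrib
        sum_negf sum_subtractf inner_commute)
qed

lemma gradient_C2_on_gap:
  assumes I: "I \<in> gaps P"
  shows "\<exists>g1 g2. (\<forall>t\<in>{fst I..snd I}.
      ((\<lambda>t. \<rho> t \<bullet> (f b (x t) - f (s I) (x t))) has_real_derivative g1 t) (at t within {fst I..snd I}) \<and>
      (g1 has_real_derivative g2 t) (at t within {fst I..snd I})) \<and> continuous_on {fst I..snd I} g2"
proof -
  note B = gap_bounds[OF I]
  have sub: "{fst I..snd I} \<subseteq> {0..T}" using B by auto
  have dx: "(x has_vector_derivative f (s I) (x t)) (at t within {fst I..snd I})" if "t \<in> {fst I..snd I}" for t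
    by (rule primitive_derivative[OF primitive_x])
      (use B that base_mode_eq[OF I, of _ s] in
        \<open>auto intro!: continuous_on_compose2[OF f_cont continuous_on_subset[OF cont_x sub]]\<close>)
  have d\<rho>: "(\<rho> has_vector_derivative costate_rate (s I) t) (at t within {fst I..snd I})"
    if "t \<in> {fst I..snd I}" for t
  proof (rule primitive_derivative[OF primitive_\<rho> _ _ _ _ that])
    show "continuous_on {fst I..snd I} (costate_rate (s I))"
      by (rule continuous_on_subset[OF cont_costate_rate sub])
    show "costate_field t = costate_rate (s I) t" if "t \<in> {fst I<..<snd I}" for t
    proof -
      have "t \<in> {0..T} - P" "m t = s I"
        using gap_disjoint[OF I, of t] base_mode_eq[OF I, of t s] that B by auto
      then show ?thesis by (simp add: costate_field_eq)
    qed
  qed (use B in auto)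
  show ?thesis
  proof (rule insertion_gradient_C2[where A = "{fst I..snd I}" and a = b and s = "s I" and x = x
        and \<rho> = \<rho> and \<rho>' = "costate_rate (s I)" and f = f and Df = Df and Dl = Dl])
    show "continuous_on {fst I..snd I} (costate_rate (s I))"
      by (rule continuous_on_subset[OF cont_costate_rate sub])
  qed (rule Df D2f D2f_cont D2l D2l_cont dx d\<rho> inner_costate_rate | assumption | blast)+
qed

lemma unperturbed_cost:
  assumes "finite F" "\<And>t. t \<in> {0..T} - F \<Longrightarrow> max_select \<mu> t = axis (m t) 1"
  shows "cost l T (projection f x0 T (\<alpha>, \<mu>)) = integral {0..T} (\<lambda>t. l (x t))"
  by (rule projection_cost[OF T lipschitz assms trajectory_x])

lemma descent_estimate:
  obtains C e where "C \<ge> 0" "e > 0"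
    "\<And>\<alpha> \<mu> m' S' F \<eta>. constant_off T S' m' \<Longrightarrow> finite F \<Longrightarrow>
       (\<And>t. t \<in> {0..T} - F \<Longrightarrow> max_select \<mu> t = axis (m' t) 1) \<Longrightarrow>
       switch_distance T m m' < e \<Longrightarrow>
       (\<And>t. t \<in> {0..T} - F \<Longrightarrow> m' t \<noteq> m t \<Longrightarrow> \<rho> t \<bullet> (f (m' t) (x t) - f (m t) (x t)) \<le> - \<eta>) \<Longrightarrow>
       cost l T (projection f x0 T (\<alpha>, \<mu>)) - integral {0..T} (\<lambda>t. l (x t))
         \<le> - \<eta> * switch_distance T m m' + C * (switch_distance T m m')\<^sup>2"
proof -
  obtain C0 e where C0: "C0 \<ge> 0" and e: "e > 0"
    and ex: "\<And>m' S'. constant_off T S' m' \<Longrightarrow> switch_distance T m m' < e \<Longrightarrow>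
       \<exists>y. trajectory f x0 T m' y \<and> (\<forall>t\<in>{0..T}. norm (y t - x t) \<le> C0 * switch_distance T m m')"
    using perturbed_trajectory[OF T lipschitz base_mode_constant_off trajectory_x] by blast
  have d\<rho>: "(\<rho> has_vector_derivative costate_rate (m t) t) (at t)" if "t \<in> {0<..<T} - P" for t
    by (rule primitive_derivative_switched[where G = costate_rate, OF primitive_\<rho>
          base_mode_constant_off cont_costate_rate _ that]) (rule costate_field_eq)
  obtain C where C: "C \<ge> 0"
    and exp: "\<And>m' S' y F \<eta>. constant_off T S' m' \<Longrightarrow> trajectory f x0 T m' y \<Longrightarrow>
       (\<forall>t\<in>{0..T}. norm (y t - x t) \<le> C0 * switch_distance T m m') \<Longrightarrow> finite F \<Longrightarrow>
       (\<And>t. t \<in> {0..T} - F \<Longrightarrow> m' t \<noteq> m t \<Longrightarrow> \<rho> t \<bullet> (f (m' t) (x t) - f (m t) (x t)) \<le> - \<eta>) \<Longrightarrow>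
       integral {0..T} (\<lambda>t. l (y t)) - integral {0..T} (\<lambda>t. l (x t))
         \<le> - \<eta> * switch_distance T m m' + C * (switch_distance T m m')\<^sup>2"
    by (rule cost_expansion[where f = f and l = l and Df = Df and Dl = Dl and K = K and K' = K'
          and m = m and S = P and x = x and \<rho> = \<rho> and T = T
          and \<rho>' = "\<lambda>t. costate_rate (m t) t" and ?C0.0 = C0])
      (rule T f_quad f_cont Df_cont l_quad l_cont base_mode_constant_off trajectory_x cont_\<rho> \<rho>_end
        d\<rho> inner_costate_rate C0 | assumption | blast)+
  show ?thesis
  proof (rule that[OF C e])
    fix \<alpha> \<mu> m' S' F \<eta>
    assume m': "constant_off T S' m'" and F: "finite F"
      and v: "\<And>t. t \<in> {0..T} - F \<Longrightarrow> max_select \<mu> t = axis (m' t) 1"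
      and small: "switch_distance T m m' < e"
      and \<eta>: "\<And>t. t \<in> {0..T} - F \<Longrightarrow> m' t \<noteq> m t \<Longrightarrow> \<rho> t \<bullet> (f (m' t) (x t) - f (m t) (x t)) \<le> - \<eta>"
    obtain y where y: "trajectory f x0 T m' y"
      "\<forall>t\<in>{0..T}. norm (y t - x t) \<le> C0 * switch_distance T m m'" using ex[OF m' small] by blast
    have "cost l T (projection f x0 T (\<alpha>, \<mu>)) = integral {0..T} (\<lambda>t. l (y t))"
      by (rule projection_cost[OF T lipschitz F _ y(1)]) (rule v)
    then show "cost l T (projection f x0 T (\<alpha>, \<mu>)) - integral {0..T} (\<lambda>t. l (x t))
         \<le> - \<eta> * switch_distance T m m' + C * (switch_distance T m m')\<^sup>2"
      using exp[OF m' y F \<eta>] by simp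
  qed
qed

end

section \<open>Right limits at moving switching times and the decrease test\<close>

lemma derivs_on_open:
  fixes h g g1 g2 :: "real \<Rightarrow> real"
  assumes eq: "\<And>t. t \<in> {p<..<q} \<Longrightarrow> h t = g t"
    and g: "\<And>t. t \<in> {p..q} \<Longrightarrow> (g has_real_derivative g1 t) (at t within {p..q})"
    and g1: "\<And>t. t \<in> {p..q} \<Longrightarrow> (g1 has_real_derivative g2 t) (at t within {p..q})"
    and t: "t \<in> {p<..<q}"
  shows "(h has_real_derivative g1 t) (at t)" "deriv (deriv h) t = g2 t"
proof -
  have h1: "(h has_real_derivative g1 t) (at t)" if t: "t \<in> {p<..<q}" for t
  proof (rule has_field_derivative_transform_within_open[OF _ open_greaterThanLessThan t])
    show "(g has_real_derivative g1 t) (at t)" using g[of t] t by (simp add: at_within_Icc_at)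
  qed (simp add: eq)
  then have d1: "deriv h t = g1 t" if "t \<in> {p<..<q}" for t using that DERIV_imp_deriv by blast
  have "(deriv h has_real_derivative g2 t) (at t)"
  proof (rule has_field_derivative_transform_within_open[OF _ open_greaterThanLessThan t])
    show "(g1 has_real_derivative g2 t) (at t)" using g1[of t] t by (simp add: at_within_Icc_at)
  qed (simp add: d1)
  then show "deriv (deriv h) t = g2 t" by (rule DERIV_imp_deriv)
  show "(h has_real_derivative g1 t) (at t)" by (rule h1[OF t])
qed

lemma C2_bounded_family:
  assumes "\<And>i. C2_bounded K (f i)"
  obtains Df D2f where "\<And>i y. (f i has_derivative blinfun_apply (Df i y)) (at y)"
    "\<And>i y. (Df i has_derivative blinfun_apply (D2f i y)) (at y)"
    "\<And>i. continuous_on UNIV (D2f i)" "\<And>i y. norm (D2f i y) \<le> K"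
proof -
  have "\<forall>i. \<exists>p. (\<forall>y. (f i has_derivative blinfun_apply (fst p y)) (at y)) \<and>
      (\<forall>y. (fst p has_derivative blinfun_apply (snd p y)) (at y)) \<and>
      continuous_on UNIV (snd p) \<and> (\<forall>y. norm (snd p y) \<le> K)"
    using assms unfolding C2_bounded_def by (metis fst_conv snd_conv)
  from choice[OF this] obtain p where p: "\<And>i. (\<forall>y. (f i has_derivative blinfun_apply (fst (p i) y)) (at y)) \<and>
      (\<forall>y. (fst (p i) has_derivative blinfun_apply (snd (p i) y)) (at y)) \<and>
      continuous_on UNIV (snd (p i)) \<and> (\<forall>y. norm (snd (p i) y) \<le> K)" by blast
  show ?thesis by (rule that[of "\<lambda>i. fst (p i)" "\<lambda>i. snd (p i)"]) (use p in blast)+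
qed

text \<open>
Dividing the descent estimate by \<open>sqrt (\<gamma> - \<gamma>0)\<close> gives, in the limit, at most
\<open>- (1 / \<gamma>0)\<close> times the sum of the \<open>c i\<close>, since the quadratic term is a multiple of \<open>\<epsilon>\<close> with a factor
that tends to 0. This limit is negative, so asking only for the fraction \<open>\<alpha> < 1\<close> of it leaves room.
\<close>

lemma armijo_eventually:
  fixes J \<epsilon> :: "real \<Rightarrow> real" and r :: "'i \<Rightarrow> real \<Rightarrow> real"
  assumes \<gamma>0: "\<gamma>0 > 0" and I: "finite I" "I \<noteq> {}"
    and \<epsilon>: "(\<epsilon> \<longlongrightarrow> 0) (at_right \<gamma>0)" and C: "C \<ge> 0"
    and descent: "\<forall>\<^sub>F \<gamma> in at_right \<gamma>0. J \<gamma> - J0 \<le> - (1 / \<gamma>) * \<epsilon> \<gamma> + C * (\<epsilon> \<gamma>)\<^sup>2"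
    and r_le: "\<forall>\<^sub>F \<gamma> in at_right \<gamma>0. (\<Sum>i\<in>I. r i \<gamma>) \<le> \<epsilon> \<gamma>"
    and rate: "\<And>i. i \<in> I \<Longrightarrow> ((\<lambda>\<gamma>. r i \<gamma> / sqrt (\<gamma> - \<gamma>0)) \<longlongrightarrow> c i) (at_right \<gamma>0)"
    and c: "\<And>i. i \<in> I \<Longrightarrow> c i > 0" and \<alpha>: "\<alpha> < 1"
  shows "\<forall>\<^sub>F \<gamma> in at_right \<gamma>0. J \<gamma> - J0 < \<alpha> * (- (\<Sum>i\<in>I. c i / \<gamma>0)) * sqrt (\<gamma> - \<gamma>0)"
proof -
  define L where "L = (\<Sum>i\<in>I. c i)"
  have L: "L > 0" unfolding L_def by (rule sum_pos[OF I c])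
  have lim1: "((\<lambda>\<gamma>. 1 / \<gamma> - C * \<epsilon> \<gamma>) \<longlongrightarrow> 1 / \<gamma>0) (at_right \<gamma>0)"
    by (rule tendsto_eq_intros \<epsilon> refl | use \<gamma>0 in simp)+
  then have pos: "\<forall>\<^sub>F \<gamma> in at_right \<gamma>0. 0 < 1 / \<gamma> - C * \<epsilon> \<gamma>"
    by (rule order_tendstoD(1)) (use \<gamma>0 in simp)
  have "((\<lambda>\<gamma>. (\<Sum>i\<in>I. r i \<gamma> / sqrt (\<gamma> - \<gamma>0)) * (1 / \<gamma> - C * \<epsilon> \<gamma>)) \<longlongrightarrow> L * (1 / \<gamma>0)) (at_right \<gamma>0)"
    unfolding L_def by (intro tendsto_mult tendsto_sum rate lim1)
  moreover have "\<alpha> * (L / \<gamma>0) < L * (1 / \<gamma>0)" using \<alpha> L \<gamma>0 by (simp add: divide_strict_right_mono)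
  ultimately have
    "\<forall>\<^sub>F \<gamma> in at_right \<gamma>0. \<alpha> * (L / \<gamma>0) < (\<Sum>i\<in>I. r i \<gamma> / sqrt (\<gamma> - \<gamma>0)) * (1 / \<gamma> - C * \<epsilon> \<gamma>)"
    by (rule order_tendstoD(1))
  with pos descent r_le eventually_at_right_less show ?thesis
  proof eventually_elim
    case (elim \<gamma>)
    let ?q = "sqrt (\<gamma> - \<gamma>0)"
    have q: "?q > 0" using elim(4) by simp
    have "\<alpha> * (L / \<gamma>0) * ?q < ((\<Sum>i\<in>I. r i \<gamma> / ?q) * (1 / \<gamma> - C * \<epsilon> \<gamma>)) * ?q"
      using elim(5) q by (rule mult_strict_right_mono)
    also have "\<dots> = (\<Sum>i\<in>I. r i \<gamma>) * (1 / \<gamma> - C * \<epsilon> \<gamma>)"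
      using q by (simp add: sum_divide_distrib[symmetric])
    also have "\<dots> \<le> \<epsilon> \<gamma> * (1 / \<gamma> - C * \<epsilon> \<gamma>)"
      using elim(1,3) by (intro mult_right_mono) auto
    finally have "- (\<epsilon> \<gamma> * (1 / \<gamma> - C * \<epsilon> \<gamma>)) < - (\<alpha> * (L / \<gamma>0) * ?q)" by simp
    moreover have "J \<gamma> - J0 \<le> - (\<epsilon> \<gamma> * (1 / \<gamma> - C * \<epsilon> \<gamma>))"
      using elim(2) by (simp add: algebra_simps power2_eq_square)
    ultimately have "J \<gamma> - J0 < - (\<alpha> * (L / \<gamma>0) * ?q)" by linarith
    then show ?case by (simp add: L_def sum_divide_distrib[symmetric])
  qed
qed

lemma armijo_steps:
  fixes \<gamma>0 \<alpha> \<beta> :: real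
  assumes \<gamma>0: "\<gamma>0 > 0" and \<alpha>: "0 < \<alpha>" "\<alpha> < 1" and \<beta>: "0 < \<beta>" "\<beta> < 1"
  defines "\<gamma>3 \<equiv> \<gamma>0 * (2 - root 3 (\<alpha> * (3 * sqrt 2 / 2)) / 3)"
  shows "filterlim (\<lambda>j. (\<gamma>3 - \<gamma>0) * \<beta> ^ j + \<gamma>0) (at_right \<gamma>0) sequentially"
proof -
  have "sqrt 2 < 2" using real_sqrt_less_mono[of 2 4] by simp
  then have "\<alpha> * (3 * sqrt 2 / 2) < 1 * 27" using \<alpha> by (intro mult_strict_mono) auto
  then have "root 3 (\<alpha> * (3 * sqrt 2 / 2)) < root 3 (3 ^ 3)" by (intro real_root_less_mono) auto
  then have "root 3 (\<alpha> * (3 * sqrt 2 / 2)) < 3" by (simp only: real_root_power_cancel)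
  then have "1 < 2 - root 3 (\<alpha> * (3 * sqrt 2 / 2)) / 3" by simp
  then have \<gamma>3: "\<gamma>3 - \<gamma>0 > 0" unfolding \<gamma>3_def using \<gamma>0 by simp
  show ?thesis
  proof (rule tendsto_imp_filterlim_at_right)
    have "(\<lambda>j. (\<gamma>3 - \<gamma>0) * \<beta> ^ j + \<gamma>0) \<longlonglongrightarrow> (\<gamma>3 - \<gamma>0) * 0 + \<gamma>0"
      using \<beta> by (intro tendsto_intros LIMSEQ_realpow_zero) auto
    then show "(\<lambda>j. (\<gamma>3 - \<gamma>0) * \<beta> ^ j + \<gamma>0) \<longlonglongrightarrow> \<gamma>0" by simp
    show "\<forall>\<^sub>F j in sequentially. (\<gamma>3 - \<gamma>0) * \<beta> ^ j + \<gamma>0 > \<gamma>0"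
      using \<gamma>3 \<beta> by simp
  qed
qed

lemma SUP_enat_eq_2_attained:
  fixes t :: "nat \<Rightarrow> enat"
  assumes "(SUP i\<in>A. t i) = 2"
  shows "\<exists>i\<in>A. t i = 2"
proof (rule ccontr)
  assume no: "\<not> (\<exists>i\<in>A. t i = 2)"
  have "t i \<le> 1" if "i \<in> A" for i
  proof -
    have "t i \<le> 2" using SUP_upper[OF that, of t] assms by simp
    moreover have "t i \<noteq> 2" using no that by blast
    ultimately have "t i < 2" by simp
    then show ?thesis by (cases "t i") (auto simp: numeral_eq_enat one_enat_def)
  qed
  then have "(SUP i\<in>A. t i) \<le> 1" by (rule SUP_least)
  then show False using assms by (simp add: numeral_eq_enat one_enat_def)
qed

text \<open>
The two consequences of type 2 that enter the square-root law: the switching time moves, and the first derivative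
vanishes in the limit.
\<close>

lemma switch_type_2D:
  assumes "switch_type d \<gamma>0 \<sigma> \<tau> i = 2"
  shows "\<not> (\<exists>c. \<forall>\<^sub>F \<gamma> in at_right \<gamma>0. \<tau> \<gamma> i = c)"
    "value_plus \<gamma>0 \<tau> i (deriv (\<lambda>t. d t $ \<sigma> i - d t $ \<sigma> (i + 1))) = 0"
proof -
  show moving: "\<not> (\<exists>c. \<forall>\<^sub>F \<gamma> in at_right \<gamma>0. \<tau> \<gamma> i = c)"
    using assms by (auto simp: switch_type_def split: if_splits)
  show "value_plus \<gamma>0 \<tau> i (deriv (\<lambda>t. d t $ \<sigma> i - d t $ \<sigma> (i + 1))) = 0"
  proof (rule ccontr)
    let ?X = "{m. 1 \<le> m \<and> value_plus \<gamma>0 \<tau> i ((deriv ^^ m) (\<lambda>t. d t $ \<sigma> i - d t $ \<sigma> (i + 1))) \<noteq> 0}"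
    assume "value_plus \<gamma>0 \<tau> i (deriv (\<lambda>t. d t $ \<sigma> i - d t $ \<sigma> (i + 1))) \<noteq> 0"
    then have "enat 1 \<in> enat ` ?X" by (intro imageI) simp
    then have "Inf (enat ` ?X) \<le> enat 1" by (rule Inf_lower)
    moreover have "Inf (enat ` ?X) = 2" using assms moving by (simp add: switch_type_def)
    ultimately show False by (simp add: numeral_eq_enat)
  qed
qed

text \<open>
The one-sided limits exist because the switching time tends to \<open>z\<close> from inside the gap, and functions that extend
continuously to the closed gap converge along it.
\<close>

lemma limits_at_moving_time:
  fixes \<tau> :: "real \<Rightarrow> nat \<Rightarrow> real" and r :: "real \<Rightarrow> real"
  assumes pq: "p < q" and z: "z = p \<or> z = q"
    and \<tau>: "\<forall>\<^sub>F \<gamma> in at_right \<gamma>0. \<tau> \<gamma> i = (if z = p then z + r \<gamma> else z - r \<gamma>)"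
    and r: "\<forall>\<^sub>F \<gamma> in at_right \<gamma>0. 0 < r \<gamma> \<and> r \<gamma> < q - p" and r0: "(r \<longlongrightarrow> 0) (at_right \<gamma>0)"
  shows "switch_side \<gamma>0 \<tau> i = (if z = p then 0 else 1)"
    and "\<And>h \<phi>. (\<And>t. t \<in> {p<..<q} \<Longrightarrow> h t = \<phi> t) \<Longrightarrow> continuous_on {p..q} \<phi> \<Longrightarrow> value_plus \<gamma>0 \<tau> i h = \<phi> z"
proof -
  have "((\<lambda>\<gamma>. if z = p then z + r \<gamma> else z - r \<gamma>) \<longlongrightarrow> z) (at_right \<gamma>0)"
    using tendsto_add[OF tendsto_const r0, of z] tendsto_diff[OF tendsto_const r0, of z]
    by (cases "z = p") simp_all
  moreover have "\<forall>\<^sub>F \<gamma> in at_right \<gamma>0. (if z = p then z + r \<gamma> else z - r \<gamma>) = \<tau> \<gamma> i"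
    using \<tau> by eventually_elim simp
  ultimately have lim: "((\<lambda>\<gamma>. \<tau> \<gamma> i) \<longlongrightarrow> z) (at_right \<gamma>0)" by (rule Lim_transform_eventually)
  then have tp: "time_plus \<gamma>0 \<tau> i = z" unfolding time_plus_def by (intro tendsto_Lim) auto
  have inside: "\<forall>\<^sub>F \<gamma> in at_right \<gamma>0. \<tau> \<gamma> i \<in> {p<..<q}"
    using \<tau> r by eventually_elim (use z pq in auto)
  show "switch_side \<gamma>0 \<tau> i = (if z = p then 0 else 1)"
  proof (cases "z = p")
    case True
    have "\<forall>\<^sub>F \<gamma> in at_right \<gamma>0. \<tau> \<gamma> i > z" using \<tau> r by eventually_elim (use True in auto)
    then show ?thesis using True by (simp add: switch_side_def tp)
  next
    case False
    have lt: "\<forall>\<^sub>F \<gamma> in at_right \<gamma>0. \<tau> \<gamma> i < z" using \<tau> r by eventually_elim (use False in auto)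
    have "\<not> (\<forall>\<^sub>F \<gamma> in at_right \<gamma>0. \<tau> \<gamma> i > z)"
    proof
      assume "\<forall>\<^sub>F \<gamma> in at_right \<gamma>0. \<tau> \<gamma> i > z"
      with lt have "\<forall>\<^sub>F \<gamma> in at_right \<gamma>0. False" by eventually_elim simp
      then show False by simp
    qed
    then show ?thesis using lt False by (simp add: switch_side_def tp)
  qed
  show "value_plus \<gamma>0 \<tau> i h = \<phi> z"
    if eq: "\<And>t. t \<in> {p<..<q} \<Longrightarrow> h t = \<phi> t" and cont: "continuous_on {p..q} \<phi>" for h \<phi>
  proof -
    have "z \<in> {p..q}" using z pq by auto
    have "((\<lambda>\<gamma>. \<phi> (\<tau> \<gamma> i)) \<longlongrightarrow> \<phi> z) (at_right \<gamma>0)"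
      by (rule continuous_on_tendsto_compose[OF cont lim \<open>z \<in> {p..q}\<close>])
        (use inside in eventually_elim, auto)
    moreover have "\<forall>\<^sub>F \<gamma> in at_right \<gamma>0. \<phi> (\<tau> \<gamma> i) = h (\<tau> \<gamma> i)"
      using inside by eventually_elim (simp add: eq)
    ultimately have "((\<lambda>\<gamma>. h (\<tau> \<gamma> i)) \<longlongrightarrow> \<phi> z) (at_right \<gamma>0)" by (rule Lim_transform_eventually)
    then show ?thesis unfolding value_plus_def by (intro tendsto_Lim) auto
  qed
qed

theorem lemma11:
  fixes f :: "'k::finite \<Rightarrow> real ^ 'n \<Rightarrow> real ^ 'n"
    and l :: "real ^ 'n \<Rightarrow> real"
    and x0 :: "real ^ 'n"
    and T K2 K2' \<alpha> \<beta> b1 b2 \<delta> \<theta> \<gamma>0 \<gamma>3 s2 :: real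
    and x \<rho> :: "real \<Rightarrow> real ^ 'n"
    and u d :: "real \<Rightarrow> real ^ 'k"
    and M :: nat
    and \<sigma> :: "nat \<Rightarrow> 'k"
    and \<tau> :: "real \<Rightarrow> nat \<Rightarrow> real"
    and I2 :: "nat set"
    and J :: "real \<Rightarrow> real"
    and D2 :: "nat \<Rightarrow> real"
    and \<gamma> :: "nat \<Rightarrow> real"
  assumes "T > 0"
    and "\<And>i. C2_bounded K2 (f i)"
    and "C2_bounded K2' l"
    and "(x, u) \<in> feasible_pairs f x0 T"
    and "solves_costate f l T x u \<rho>"
    and "d = mode_insertion_gradient f \<rho> x u"
    and "piecewise_continuous T d"
    and "\<And>i j. i \<noteq> j \<Longrightarrow> finite (critical_points T (\<lambda>t. d t $ i - d t $ j))"
    and "J = (\<lambda>g. cost l T (projection f x0 T (x, \<lambda>t. u t - g *\<^sub>R d t)))"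
    and "\<theta> = optimality_function T d"
    and "\<gamma>0 = - 1 / \<theta>"
    and "\<delta> > 0"
    and "\<And>g. g \<in> {\<gamma>0<..<\<gamma>0 + \<delta>} \<Longrightarrow>
           mode_schedule T (max_select (\<lambda>t. u t - g *\<^sub>R d t)) M \<sigma> (\<tau> g)"
    and "(SUP i\<in>{1..<M}. switch_type d \<gamma>0 \<sigma> \<tau> i) = 2"
    and "I2 = {i\<in>{1..<M}. switch_type d \<gamma>0 \<sigma> \<tau> i = 2}"
    and "D2 = (\<lambda>i. value_plus \<gamma>0 \<tau> i
           ((deriv ^^ 2) (\<lambda>t. d t $ \<sigma> (i + switch_side \<gamma>0 \<tau> i))))"
    and "0 < \<alpha>" "\<alpha> < 1" "0 < \<beta>" "\<beta> < 1"
    and "b1 > 0" "b2 > 0"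
    and "\<theta> < - b1"
    and "\<And>i. i \<in> I2 \<Longrightarrow> D2 i > b2"
    and "\<gamma>3 = \<gamma>0 * (2 - root 3 (\<alpha> * (3 * sqrt 2 / 2)) / 3)"
    and "\<gamma> = (\<lambda>j. (\<gamma>3 - \<gamma>0) * \<beta> ^ j + \<gamma>0)"
    and "s2 = - (\<Sum>i\<in>I2. sqrt 2 * \<theta>\<^sup>2 / sqrt (D2 i))"
  shows "{j::nat. J (\<gamma> j) - J 0 < \<alpha> * s2 * sqrt (\<gamma> j - \<gamma>0)} \<noteq> {}"
proof -
  note T = \<open>T > 0\<close> and d = \<open>d = mode_insertion_gradient f \<rho> x u\<close>
  have \<theta>: "\<theta> < 0" using \<open>b1 > 0\<close> \<open>\<theta> < - b1\<close> by simp
  have \<gamma>0: "\<gamma>0 = - 1 / \<theta>" "\<gamma>0 > 0" using \<open>\<gamma>0 = - 1 / \<theta>\<close> \<theta> by auto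
  have sw: "switching_control T u" and state: "solves_state f x0 T u x"
    using \<open>(x, u) \<in> feasible_pairs f x0 T\<close> by (auto simp: feasible_pairs_def nonchattering_controls_def)
  obtain Df D2f where Df: "\<And>i y. (f i has_derivative blinfun_apply (Df i y)) (at y)"
    "\<And>i y. (Df i has_derivative blinfun_apply (D2f i y)) (at y)"
    "\<And>i. continuous_on UNIV (D2f i)" "\<And>i y. norm (D2f i y) \<le> K2"
    by (rule C2_bounded_family[where f = f and K = K2, OF \<open>\<And>i. C2_bounded K2 (f i)\<close>]) blast
  obtain Dl D2l where Dl: "\<And>y. (l has_derivative blinfun_apply (Dl y)) (at y)"
    "\<And>y. (Dl has_derivative blinfun_apply (D2l y)) (at y)"
    "continuous_on UNIV D2l" "\<And>y. norm (D2l y) \<le> K2'"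
    using \<open>C2_bounded K2' l\<close> unfolding C2_bounded_def by blast
  obtain P s where part: "gap_partition T P"
    and u_gap: "\<And>I t. I \<in> gaps P \<Longrightarrow> fst I < t \<Longrightarrow> t < snd I \<Longrightarrow> u t = axis (s I) 1"
    and d_neq: "\<And>I t i j. I \<in> gaps P \<Longrightarrow> fst I < t \<Longrightarrow> t < snd I \<Longrightarrow> i \<noteq> j \<Longrightarrow> d t $ i \<noteq> d t $ j"
    and d_noncrit: "\<And>I t i j. I \<in> gaps P \<Longrightarrow> fst I < t \<Longrightarrow> t < snd I \<Longrightarrow> i \<noteq> j \<Longrightarrow>
       \<exists>D. D \<noteq> 0 \<and> ((\<lambda>t. d t $ i - d t $ j) has_real_derivative D) (at t)"
    by (rule refined_partition[where d = d, OF T sw])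
      (rule \<open>\<And>i j. i \<noteq> j \<Longrightarrow> finite (critical_points T (\<lambda>t. d t $ i - d t $ j))\<close> | assumption | blast)+
  interpret gap_partition T P by (rule part)
  interpret S: insertion_setup T P f l x0 x \<rho> u Df D2f Dl D2l K2 K2' s
    by unfold_locales
      (rule T Df Dl state \<open>solves_costate f l T x u \<rho>\<close> u_gap | assumption)+

  \<comment> \<open>On the open gap \<open>I\<close> the components of \<open>d\<close> are the functions \<open>g I b\<close>, which are defined, and twice
    continuously differentiable, on the closed gap.\<close>
  define g where "g = (\<lambda>I b t. \<rho> t \<bullet> (f b (x t) - f (s I) (x t)))"
  have d_gap: "d t $ b = g I b t" if "I \<in> gaps P" "fst I < t" "t < snd I" for I b t
    using that by (simp add: d mode_insertion_gradient_def u_gap vfield_axis g_def)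
  have gs: "g I (s I) t = 0" for I t by (simp add: g_def)
  define C2 where "C2 = (\<lambda>I b p. (\<forall>t\<in>{fst I..snd I}.
      (g I b has_real_derivative fst p t) (at t within {fst I..snd I}) \<and>
      (fst p has_real_derivative snd p t) (at t within {fst I..snd I})) \<and>
      continuous_on {fst I..snd I} (snd p))"
  have "\<exists>p. C2 I b p" if I: "I \<in> gaps P" for I b
  proof -
    obtain g1 g2 where "(\<forall>t\<in>{fst I..snd I}. (g I b has_real_derivative g1 t) (at t within {fst I..snd I}) \<and>
        (g1 has_real_derivative g2 t) (at t within {fst I..snd I})) \<and> continuous_on {fst I..snd I} g2"
      using S.gradient_C2_on_gap[OF I, of b] unfolding g_def by blast
    then have "C2 I b (g1, g2)" by (simp add: C2_def)
    then show ?thesis by blast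
  qed
  then obtain gp where gp: "\<And>I b. I \<in> gaps P \<Longrightarrow> C2 I b (gp I b)" by metis
  define g1 g2 where "g1 = (\<lambda>I b. fst (gp I b))" and "g2 = (\<lambda>I b. snd (gp I b))"
  have g1: "(g I b has_real_derivative g1 I b t) (at t within {fst I..snd I})"
    and g2: "(g1 I b has_real_derivative g2 I b t) (at t within {fst I..snd I})"
    if "I \<in> gaps P" "t \<in> {fst I..snd I}" for I b t
    using gp[OF that(1), of b] that(2) by (simp_all add: g1_def g2_def C2_def)
  have cont_g: "continuous_on {fst I..snd I} (g I b)" and cont_g1: "continuous_on {fst I..snd I} (g1 I b)"
    and cont_g2: "continuous_on {fst I..snd I} (g2 I b)" if "I \<in> gaps P" for I b
  proof -
    show "continuous_on {fst I..snd I} (g I b)" by (rule DERIV_continuous_on[OF g1[OF that]])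
    show "continuous_on {fst I..snd I} (g1 I b)" by (rule DERIV_continuous_on[OF g2[OF that]])
    show "continuous_on {fst I..snd I} (g2 I b)"
      using gp[OF that, of b] by (simp add: g2_def C2_def)
  qed

  \<comment> \<open>The infimum that defines \<open>\<theta>\<close> is a lower bound only if \<open>d\<close> is bounded below. The values of \<open>d\<close>
    on \<open>P\<close> are arbitrary, but finite in number.\<close>
  have "bounded (\<Union>b. \<Union>I\<in>gaps P. g I b ` {fst I..snd I})"
    using finite_gaps[OF P(1)]
    by (intro bounded_UN ballI compact_imp_bounded compact_continuous_image cont_g) auto
  moreover have "bounded (\<Union>b. (\<lambda>t. d t $ b) ` P)"
    using P(1) by (intro bounded_UN ballI finite_imp_bounded) auto
  ultimately have "bounded ((\<Union>b. \<Union>I\<in>gaps P. g I b ` {fst I..snd I}) \<union> (\<Union>b. (\<lambda>t. d t $ b) ` P))"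
    by simp
  moreover have "(\<lambda>(a, t). d t $ a) ` (UNIV \<times> {0..T})
      \<subseteq> (\<Union>b. \<Union>I\<in>gaps P. g I b ` {fst I..snd I}) \<union> (\<Union>b. (\<lambda>t. d t $ b) ` P)"
  proof clarsimp
    fix b t assume t: "0 \<le> t" "t \<le> T" and off: "\<forall>b'. d t $ b \<notin> (\<lambda>t. d t $ b') ` P"
    then have "t \<in> {0..T} - P" by auto
    from gap_of[OF this] show "\<exists>b'. \<exists>I\<in>gaps P. d t $ b \<in> g I b' ` {fst I..snd I}"
      using d_gap[of "gap_of t" t b] by (intro exI[of _ b] bexI[of _ "gap_of t"] image_eqI[of _ _ t]) auto
  qed
  ultimately have "bdd_below ((\<lambda>(a, t). d t $ a) ` (UNIV \<times> {0..T}))"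
    by (meson bounded_imp_bdd_below bounded_subset)
  then have \<theta>_le: "\<theta> \<le> d t $ b" if "t \<in> {0..T}" for t b
    unfolding \<open>\<theta> = optimality_function T d\<close> optimality_function_def
    using cINF_lower[of "\<lambda>(a, t). d t $ a" "UNIV \<times> {0..T}" "(b, t)"] that by simp

  \<comment> \<open>The dichotomy on each gap, packaged so that its witnesses can be chosen for all gaps at once.\<close>
  define Q where "Q = (\<lambda>I z a r \<gamma>1. (z = fst I \<or> z = snd I) \<and> \<gamma>1 > - 1 / \<theta> \<and>
    (\<forall>\<gamma>\<in>{- 1 / \<theta><..<\<gamma>1}. 0 \<le> r \<gamma> \<and> r \<gamma> < snd I - fst I \<and>
       (\<forall>t\<in>{fst I<..<snd I}. t \<noteq> (if z = fst I then z + r \<gamma> else z - r \<gamma>) \<longrightarrow>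
          dominates (s I) \<gamma> (\<lambda>b. g I b t) (if \<bar>t - z\<bar> < r \<gamma> then a else s I))) \<and>
    ((\<forall>\<gamma>\<in>{- 1 / \<theta><..<\<gamma>1}. r \<gamma> = 0) \<or>
     a \<noteq> s I \<and> g I a z = \<theta> \<and> (r \<longlongrightarrow> 0) (at_right (- 1 / \<theta>)) \<and>
     (\<forall>\<gamma>\<in>{- 1 / \<theta><..<\<gamma>1}. 0 < r \<gamma> \<and> g I a (if z = fst I then z + r \<gamma> else z - r \<gamma>) = - 1 / \<gamma>)))"
  have "\<exists>z a r \<gamma>1. Q I z a r \<gamma>1" if I: "I \<in> gaps P" for I
    unfolding Q_def
  proof (rule gap_dichotomy[where g = "g I" and g' = "g1 I" and s = "s I"])
    note B = gap_bounds[OF I]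
    show "fst I < snd I" using B by simp
    show "continuous_on {fst I..snd I} (g I b)" "continuous_on {fst I..snd I} (g1 I b)" for b
      by (rule cont_g[OF I] cont_g1[OF I])+
    show der: "(g I b has_real_derivative g1 I b t) (at t)" if "t \<in> {fst I<..<snd I}" for b t
      using g1[OF I, of t b] that by (simp add: at_within_Icc_at)
    show "g1 I b t \<noteq> 0" if b: "b \<noteq> s I" and t: "t \<in> {fst I<..<snd I}" for b t
    proof -
      obtain D where D: "D \<noteq> 0" "((\<lambda>t. d t $ b - d t $ s I) has_real_derivative D) (at t)"
        using d_noncrit[OF I _ _ b] t by auto
      have "(g I b has_real_derivative D) (at t)"
        by (rule has_field_derivative_transform_within_open[OF D(2) open_greaterThanLessThan t])
          (use d_gap[OF I] gs in auto)
      then show ?thesis using DERIV_unique[OF der[OF t]] D(1) by blast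
    qed
    show "g I b t \<noteq> g I c t" if "b \<noteq> c" "t \<in> {fst I<..<snd I}" for b c t
      using d_neq[OF I _ _ that(1), of t] d_gap[OF I] that(2) by auto
    show "\<theta> \<le> g I b t" if "t \<in> {fst I<..<snd I}" for b t
      using \<theta>_le[of t b] d_gap[OF I, of t b] that B by auto
  qed (use gs \<theta> in auto)
  then have "\<exists>w. I \<in> gaps P \<longrightarrow> Q I (fst w) (fst (snd w)) (fst (snd (snd w))) (snd (snd (snd w)))" for I
    by (metis fst_conv snd_conv)
  then obtain w where w: "\<And>I. I \<in> gaps P \<Longrightarrow>
      Q I (fst (w I)) (fst (snd (w I))) (fst (snd (snd (w I)))) (snd (snd (snd (w I))))" by metis
  define z a r \<gamma>1 where "z = (\<lambda>I. fst (w I))" and "a = (\<lambda>I. fst (snd (w I)))"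
    and "r = (\<lambda>\<gamma> I. fst (snd (snd (w I))) \<gamma>)" and "\<gamma>1 = (\<lambda>I. snd (snd (snd (w I))))"
  have Q: "Q I (z I) (a I) (\<lambda>\<gamma>. r \<gamma> I) (\<gamma>1 I)" if "I \<in> gaps P" for I
    using w[OF that] by (simp add: z_def a_def r_def \<gamma>1_def)

  \<comment> \<open>A common range of step sizes for the finitely many gaps and for the given schedules.\<close>
  define \<Gamma>1 where "\<Gamma>1 = Min (insert (\<gamma>0 + \<delta>) (\<gamma>1 ` gaps P))"
  define \<Gamma> where "\<Gamma> = {\<gamma>0<..<\<Gamma>1}"
  have fin_gaps: "finite (gaps P)" by (rule finite_gaps[OF P(1)])
  have "\<gamma>0 < \<Gamma>1"
    unfolding \<Gamma>1_def using fin_gaps Q \<open>\<delta> > 0\<close> by (subst Min_gr_iff) (auto simp: Q_def \<gamma>0(1))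
  then have ev\<Gamma>: "\<forall>\<^sub>F \<gamma> in at_right \<gamma>0. \<gamma> \<in> \<Gamma>" and "\<Gamma> \<noteq> {}"
    unfolding \<Gamma>_def by (auto intro: eventually_at_rightI)
  then obtain \<gamma>r where \<gamma>r: "\<gamma>r \<in> \<Gamma>" by blast
  have \<Gamma>_le: "\<gamma> \<in> {- 1 / \<theta><..<\<gamma>1 I}" if "\<gamma> \<in> \<Gamma>" "I \<in> gaps P" for \<gamma> I
  proof -
    have "\<Gamma>1 \<le> \<gamma>1 I" unfolding \<Gamma>1_def using fin_gaps that(2) by (intro Min_le) auto
    then show ?thesis using that(1) by (auto simp: \<Gamma>_def \<gamma>0(1))
  qed
  have \<Gamma>_\<delta>: "\<gamma> \<in> {\<gamma>0<..<\<gamma>0 + \<delta>}" if "\<gamma> \<in> \<Gamma>" for \<gamma>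
  proof -
    have "\<Gamma>1 \<le> \<gamma>0 + \<delta>" unfolding \<Gamma>1_def using fin_gaps by (intro Min_le) auto
    then show ?thesis using that by (auto simp: \<Gamma>_def)
  qed
  have r_moving: "a I \<noteq> s I \<and> g I (a I) (z I) = \<theta> \<and> ((\<lambda>\<gamma>. r \<gamma> I) \<longlongrightarrow> 0) (at_right \<gamma>0) \<and>
      (\<forall>\<gamma>\<in>\<Gamma>. 0 < r \<gamma> I \<and> g I (a I) (if z I = fst I then z I + r \<gamma> I else z I - r \<gamma> I) = - 1 / \<gamma>)"
    if \<gamma>: "\<gamma> \<in> \<Gamma>" and I: "I \<in> gaps P" and pos: "0 < r \<gamma> I" for \<gamma> I
  proof -
    have "\<not> (\<forall>\<gamma>\<in>{- 1 / \<theta><..<\<gamma>1 I}. r \<gamma> I = 0)" using \<Gamma>_le[OF \<gamma> I] pos by force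
    then show ?thesis using Q[OF I] \<Gamma>_le[OF _ I] unfolding Q_def \<gamma>0(1) by blast
  qed
  \<comment> \<open>The projected controls form a family with one moving edge per active gap.\<close>
  interpret G: gap_switching T P s a z r \<Gamma>
  proof unfold_locales
    fix \<gamma> \<gamma>' I assume I: "I \<in> gaps P"
    show "z I = fst I \<or> z I = snd I" using Q[OF I] by (simp add: Q_def)
    assume \<gamma>: "\<gamma> \<in> \<Gamma>"
    show "0 \<le> r \<gamma> I \<and> r \<gamma> I < snd I - fst I" using Q[OF I] \<Gamma>_le[OF \<gamma> I] unfolding Q_def by blast
    show "a I \<noteq> s I" if "0 < r \<gamma> I" using r_moving[OF \<gamma> I that] by blast
    show "0 < r \<gamma>' I" if "\<gamma>' \<in> \<Gamma>" "0 < r \<gamma> I" using r_moving[OF \<gamma> I that(2)] that(1) by blast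
  qed
  have dom: "dominates (s I) \<gamma> (\<lambda>b. g I b t) (G.mode \<gamma> t)"
    if \<gamma>: "\<gamma> \<in> \<Gamma>" and I: "I \<in> gaps P" and t: "fst I < t" "t < snd I" "t \<noteq> G.edge \<gamma> I" for \<gamma> I t
    using Q[OF I] \<Gamma>_le[OF \<gamma> I] t unfolding Q_def G.edge_def G.mode_eq[OF I t(1,2)] by auto

  define \<mu> where "\<mu> = (\<lambda>\<gamma> t. u t - \<gamma> *\<^sub>R d t)"
  have \<mu>_comp: "\<mu> \<gamma> t $ b = (if b = s I then 1 else - \<gamma> * g I b t)"
    if "I \<in> gaps P" "fst I < t" "t < snd I" for \<gamma> I t b
    using that by (simp add: \<mu>_def u_gap[OF that] d_gap[OF that] gs axis_def)
  have select: "max_select (\<mu> \<gamma>) t = axis (G.mode \<gamma> t) 1"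
    if \<gamma>: "\<gamma> \<in> \<Gamma>" and t: "t \<in> {0..T} - G.exceptional \<gamma>" for \<gamma> t
  proof -
    define I where "I = gap_of t"
    have I: "I \<in> gaps P" "fst I < t" "t < snd I"
      using gap_of[of t] t by (auto simp: I_def G.exceptional_def)
    then have "t \<noteq> G.edge \<gamma> I" using t by (auto simp: G.exceptional_def)
    then show ?thesis
      using dom[OF \<gamma> I] by (intro max_select_eq_axis) (auto simp: \<mu>_comp[OF I] dominates_def)
  qed
  have select0: "max_select (\<mu> 0) t = axis (base_mode s t) 1" if "t \<in> {0..T} - P" for t
  proof (rule max_select_eq_axis)
    have I: "gap_of t \<in> gaps P" "fst (gap_of t) < t" "t < snd (gap_of t)" using gap_of[OF that] by auto
    show "\<mu> 0 t $ b < \<mu> 0 t $ base_mode s t" if "b \<noteq> base_mode s t" for b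
      using that unfolding \<mu>_comp[OF I] base_mode_eq[OF I] by simp
  qed
  have J: "J \<gamma> = cost l T (projection f x0 T (x, \<mu> \<gamma>))" for \<gamma>
    unfolding \<mu>_def \<open>J = _\<close> by simp
  have J0: "J 0 = integral {0..T} (\<lambda>t. l (x t))"
    unfolding J by (rule S.unperturbed_cost[OF P(1)]) (rule select0)

  \<comment> \<open>The measure of the set where the projected control differs from \<open>u\<close>.\<close>
  define \<epsilon> where "\<epsilon> = (\<lambda>\<gamma>. \<Sum>I\<in>gaps P. r \<gamma> I)"
  have \<epsilon>: "(\<epsilon> \<longlongrightarrow> 0) (at_right \<gamma>0)"
  proof -
    have "((\<lambda>\<gamma>. r \<gamma> I) \<longlongrightarrow> 0) (at_right \<gamma>0)" if I: "I \<in> gaps P" for I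
    proof (cases "0 < r \<gamma>r I")
      case True
      then show ?thesis using r_moving[OF \<gamma>r I] by blast
    next
      case False
      have "\<forall>\<^sub>F \<gamma> in at_right \<gamma>0. 0 = r \<gamma> I"
        using ev\<Gamma>
      proof eventually_elim
        case (elim \<gamma>)
        then show ?case using G.r[OF elim I] G.r_pos[OF elim \<gamma>r I] False by force
      qed
      then show ?thesis by (rule Lim_transform_eventually[OF tendsto_const])
    qed
    then have "(\<epsilon> \<longlongrightarrow> (\<Sum>I\<in>gaps P. 0)) (at_right \<gamma>0)" unfolding \<epsilon>_def by (intro tendsto_sum)
    then show ?thesis by simp
  qed
  obtain C e where C: "C \<ge> 0" and e: "e > 0"
    and descent: "\<And>\<alpha> \<mu> m' S' F \<eta>. constant_off T S' m' \<Longrightarrow> finite F \<Longrightarrow>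
       (\<And>t. t \<in> {0..T} - F \<Longrightarrow> max_select \<mu> t = axis (m' t) 1) \<Longrightarrow>
       switch_distance T (base_mode s) m' < e \<Longrightarrow>
       (\<And>t. t \<in> {0..T} - F \<Longrightarrow> m' t \<noteq> base_mode s t \<Longrightarrow>
          \<rho> t \<bullet> (f (m' t) (x t) - f (base_mode s t) (x t)) \<le> - \<eta>) \<Longrightarrow>
       cost l T (projection f x0 T (\<alpha>, \<mu>)) - integral {0..T} (\<lambda>t. l (x t))
         \<le> - \<eta> * switch_distance T (base_mode s) m' + C * (switch_distance T (base_mode s) m')\<^sup>2"
    by (rule S.descent_estimate) blast
  have "\<forall>\<^sub>F \<gamma> in at_right \<gamma>0. \<epsilon> \<gamma> < e" using order_tendstoD(2)[OF \<epsilon> e] .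
  \<comment> \<open>Where the projected control is in another mode, that mode won against the entry 1 of the active one, so its
    component of \<open>d\<close> is below \<open>- 1 / \<gamma>\<close>.\<close>
  with ev\<Gamma> have J_le: "\<forall>\<^sub>F \<gamma> in at_right \<gamma>0. J \<gamma> - J 0 \<le> - (1 / \<gamma>) * \<epsilon> \<gamma> + C * (\<epsilon> \<gamma>)\<^sup>2"
  proof eventually_elim
    case (elim \<gamma>)
    have dist: "switch_distance T (base_mode s) (G.mode \<gamma>) = \<epsilon> \<gamma>"
      unfolding \<epsilon>_def by (rule G.switch_distance_mode[OF elim(1)])
    have \<gamma>pos: "\<gamma> > 0" using elim(1) \<gamma>0(2) by (auto simp: \<Gamma>_def)
    show ?case
      unfolding J0 unfolding J dist[symmetric]
    proof (rule descent[OF G.mode_constant_off[OF elim(1)] G.finite_exceptional])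
      show "max_select (\<mu> \<gamma>) t = axis (G.mode \<gamma> t) 1" if "t \<in> {0..T} - G.exceptional \<gamma>" for t
        by (rule select[OF elim(1) that])
      show "switch_distance T (base_mode s) (G.mode \<gamma>) < e" using elim(2) dist by simp
      fix t assume t: "t \<in> {0..T} - G.exceptional \<gamma>" and neq: "G.mode \<gamma> t \<noteq> base_mode s t"
      define I where "I = gap_of t"
      have I: "I \<in> gaps P" "fst I < t" "t < snd I"
        using gap_of[of t] t by (auto simp: I_def G.exceptional_def)
      then have "t \<noteq> G.edge \<gamma> I" using t by (auto simp: G.exceptional_def)
      note dominant = dom[OF elim(1) I this]
      have "G.mode \<gamma> t \<noteq> s I" using neq unfolding base_mode_eq[OF I] .
      then have "1 < - \<gamma> * g I (G.mode \<gamma> t) t"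
        using dominant[unfolded dominates_def, rule_format, of "s I"] by simp
      then have "g I (G.mode \<gamma> t) t \<le> - (1 / \<gamma>)" using \<gamma>pos by (simp add: field_simps)
      then show "\<rho> t \<bullet> (f (G.mode \<gamma> t) (x t) - f (base_mode s t) (x t)) \<le> - (1 / \<gamma>)"
        by (simp add: g_def base_mode_eq[OF I])
    qed
  qed

  have sch: "mode_schedule T (max_select (\<mu> \<gamma>)) M \<sigma> (\<tau> \<gamma>)" if "\<gamma> \<in> \<Gamma>" for \<gamma>
    unfolding \<mu>_def 
    by (rule \<open>\<And>g. g \<in> {\<gamma>0<..<\<gamma>0 + \<delta>} \<Longrightarrow>
      mode_schedule T (max_select (\<lambda>t. u t - g *\<^sub>R d t)) M \<sigma> (\<tau> g)\<close>[OF \<Gamma>_\<delta>[OF that]])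
  \<comment> \<open>The gap whose edge is the switching time with index \<open>i\<close>, read off at the reference step size \<open>\<gamma>r\<close>.\<close>
  define Ii where "Ii = (\<lambda>i. gap_of (\<tau> \<gamma>r i))"
  have moving: "Ii i \<in> gaps P \<and> 0 < r \<gamma>r (Ii i) \<and> (\<forall>\<gamma>\<in>\<Gamma>. \<tau> \<gamma> i = G.edge \<gamma> (Ii i))"
    if i: "i \<in> I2" for i
  proof -
    have iM: "i \<in> {1..<M}" and type: "switch_type d \<gamma>0 \<sigma> \<tau> i = 2" using i \<open>I2 = _\<close> by auto
    have transport: "\<tau> \<gamma> i = G.transport \<gamma> (\<tau> \<gamma>r i)" if "\<gamma> \<in> \<Gamma>" for \<gamma>
      by (rule G.schedule_times_transport[OF \<gamma>r that sch[OF \<gamma>r] sch[OF that] _ _ iM])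
        (rule select \<gamma>r that | assumption)+
    have "\<tau> \<gamma>r i \<notin> P"
    proof
      assume onP: "\<tau> \<gamma>r i \<in> P"
      have "\<forall>\<^sub>F \<gamma> in at_right \<gamma>0. \<tau> \<gamma> i = \<tau> \<gamma>r i"
        using ev\<Gamma> by eventually_elim (simp add: transport G.transport_def onP)
      then show False using switch_type_2D(1)[OF type] by blast
    qed
    moreover have "\<tau> \<gamma>r i \<in> switch_points T (G.mode \<gamma>r)"
    proof -
      have "\<tau> \<gamma>r ` {1..<M} = switch_points T (G.mode \<gamma>r)"
        by (rule schedule_switch_points[OF sch[OF \<gamma>r] G.mode_constant_off[OF \<gamma>r]])
          (rule select[OF \<gamma>r])
      then show ?thesis using iM by blast
    qed
    ultimately show ?thesis
      using G.switch_point_cases[OF \<gamma>r] transport by (simp add: Ii_def G.transport_def)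
  qed
  have inj: "inj_on Ii I2"
  proof (rule inj_onI)
    fix i j assume ij: "i \<in> I2" "j \<in> I2" "Ii i = Ii j"
    then have "\<tau> \<gamma>r i = \<tau> \<gamma>r j" using moving \<gamma>r by metis
    moreover have "i < M" "j < M" using ij \<open>I2 = _\<close> by auto
    ultimately show "i = j"
      using schedule_mono[OF sch[OF \<gamma>r], of i j] schedule_mono[OF sch[OF \<gamma>r], of j i]
      by (metis less_imp_le_nat linorder_neqE_nat order_less_irrefl)
  qed
  have finI2: "finite I2" using \<open>I2 = _\<close> by auto
  \<comment> \<open>Distinct indices belong to distinct gaps, and the remaining gaps can only add to \<open>\<epsilon>\<close>.\<close>
  have r_le: "\<forall>\<^sub>F \<gamma> in at_right \<gamma>0. (\<Sum>i\<in>I2. r \<gamma> (Ii i)) \<le> \<epsilon> \<gamma>"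
    using ev\<Gamma>
  proof eventually_elim
    case (elim \<gamma>)
    have "(\<Sum>i\<in>I2. r \<gamma> (Ii i)) = (\<Sum>I\<in>Ii ` I2. r \<gamma> I)" by (simp add: sum.reindex[OF inj])
    also have "\<dots> \<le> \<epsilon> \<gamma>" unfolding \<epsilon>_def
      by (rule sum_mono2[OF fin_gaps]) (use moving G.r[OF elim] in auto)
    finally show ?case .
  qed
  have rate: "((\<lambda>\<gamma>. r \<gamma> (Ii i) / sqrt (\<gamma> - \<gamma>0)) \<longlongrightarrow> sqrt 2 * \<bar>\<theta>\<bar> / sqrt (D2 i)) (at_right \<gamma>0)"
    if i: "i \<in> I2" for i
  proof -
    define I where "I = Ii i"
    have I: "I \<in> gaps P" "0 < r \<gamma>r I" and edge: "\<And>\<gamma>. \<gamma> \<in> \<Gamma> \<Longrightarrow> \<tau> \<gamma> i = G.edge \<gamma> I"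
      using moving[OF i] by (auto simp: I_def)
    have iM: "i \<in> {1..<M}" and type: "switch_type d \<gamma>0 \<sigma> \<tau> i = 2" using i \<open>I2 = _\<close> by auto
    note mv = r_moving[OF \<gamma>r I] and zI = G.z[OF I(1)] and B = gap_bounds[OF I(1)]
    have modes: "\<sigma> i = (if z I = fst I then a I else s I)" "\<sigma> (i + 1) = (if z I = fst I then s I else a I)"
      by (rule G.schedule_modes_at_edge[OF \<gamma>r sch[OF \<gamma>r] _ iM I edge[OF \<gamma>r]]; rule select[OF \<gamma>r]; assumption)+
    have ev_\<tau>: "\<forall>\<^sub>F \<gamma> in at_right \<gamma>0. \<tau> \<gamma> i = (if z I = fst I then z I + r \<gamma> I else z I - r \<gamma> I)"
      using ev\<Gamma> by eventually_elim (simp add: edge G.edge_def)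
    have ev_r: "\<forall>\<^sub>F \<gamma> in at_right \<gamma>0. 0 < r \<gamma> I \<and> r \<gamma> I < snd I - fst I"
      using ev\<Gamma> by eventually_elim (use mv G.r I(1) in blast)
    have "fst I < snd I" and r0: "((\<lambda>\<gamma>. r \<gamma> I) \<longlongrightarrow> 0) (at_right \<gamma>0)" using B mv by auto
    note lims = limits_at_moving_time[where r = "\<lambda>\<gamma>. r \<gamma> I" and \<tau> = \<tau> and i = i and z = "z I"
        and p = "fst I" and q = "snd I", OF \<open>fst I < snd I\<close> zI ev_\<tau> ev_r r0]
    \<comment> \<open>The edge lies after \<open>z\<close> if \<open>z\<close> is the left end of the gap, and then it separates \<open>a\<close> from \<open>s\<close> in this order;
      at a right end both are reversed. In either case the index shift selects the inserted mode \<open>a\<close>.\<close>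
    have side: "\<sigma> (i + switch_side \<gamma>0 \<tau> i) = a I"
      using lims(1) modes by auto
    have on_gap: "(h has_real_derivative g1 I b t) (at t)" "deriv (deriv h) t = g2 I b t"
      if "\<And>t. t \<in> {fst I<..<snd I} \<Longrightarrow> h t = g I b t" "t \<in> {fst I<..<snd I}" for h b t
    proof -
      note der = derivs_on_open[where p = "fst I" and q = "snd I" and g = "g I b" and ?g1.0 = "g1 I b"
          and ?g2.0 = "g2 I b", OF _ _ _ that(2)]
      show "(h has_real_derivative g1 I b t) (at t)"
        by (rule der(1)) (rule that(1) g1[OF I(1)] g2[OF I(1)]; assumption)+
      show "deriv (deriv h) t = g2 I b t"
        by (rule der(2)) (rule that(1) g1[OF I(1)] g2[OF I(1)]; assumption)+
    qed
    have da: "(\<lambda>t. d t $ a I) t = g I (a I) t" if "t \<in> {fst I<..<snd I}" for t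
      using d_gap[OF I(1)] that by auto
    have D2i: "D2 i = g2 I (a I) (z I)"
    proof -
      have "value_plus \<gamma>0 \<tau> i (deriv (deriv (\<lambda>t. d t $ a I))) = g2 I (a I) (z I)"
        by (rule lims(2)[OF on_gap(2)[OF da] cont_g2[OF I(1)]])
      then show ?thesis using \<open>D2 = _\<close> side by (simp add: numeral_2_eq_2)
    qed
    have g1z: "g1 I (a I) (z I) = 0"
    proof -
      define c :: real where "c = (if z I = fst I then 1 else - 1)"
      have "deriv (\<lambda>t. d t $ \<sigma> i - d t $ \<sigma> (i + 1)) t = c * g1 I (a I) t" if t: "t \<in> {fst I<..<snd I}" for t
      proof (rule DERIV_imp_deriv)
        have "((\<lambda>t. c * g I (a I) t) has_real_derivative c * g1 I (a I) t) (at t)"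
          using on_gap(1)[OF refl t] by (rule DERIV_cmult)
        then show "((\<lambda>t. d t $ \<sigma> i - d t $ \<sigma> (i + 1)) has_real_derivative c * g1 I (a I) t) (at t)"
          by (rule has_field_derivative_transform_within_open[OF _ open_greaterThanLessThan t])
            (auto simp: d_gap[OF I(1)] modes[unfolded Suc_eq_plus1[symmetric]] c_def gs)
      qed
      then have "value_plus \<gamma>0 \<tau> i (deriv (\<lambda>t. d t $ \<sigma> i - d t $ \<sigma> (i + 1))) = c * g1 I (a I) (z I)"
        by (rule lims(2)) (assumption | intro continuous_intros cont_g1[OF I(1)])+
      then show ?thesis using switch_type_2D(2)[OF type] by (auto simp: c_def split: if_splits)
    qed
    have g2z: "g2 I (a I) (z I) > 0"
      using \<open>\<And>i. i \<in> I2 \<Longrightarrow> D2 i > b2\<close>[OF i] \<open>b2 > 0\<close> D2i by simp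
    have "((\<lambda>\<gamma>. r \<gamma> I / sqrt (\<gamma> - (- 1 / \<theta>))) \<longlongrightarrow> sqrt 2 * \<bar>\<theta>\<bar> / sqrt (g2 I (a I) (z I)))
        (at_right (- 1 / \<theta>))"
    proof (rule edge_rate[where p = "fst I" and q = "snd I" and h = "g I (a I)" and ?h1.0 = "g1 I (a I)"
          and ?h2.0 = "g2 I (a I)", OF \<open>fst I < snd I\<close> zI _ _ \<theta> _ g1z g2z])
      show "\<forall>\<^sub>F \<gamma> in at_right (- 1 / \<theta>). 0 < r \<gamma> I \<and>
          g I (a I) (if z I = fst I then z I + r \<gamma> I else z I - r \<gamma> I) = - 1 / \<gamma>"
        using ev\<Gamma> unfolding \<gamma>0(1) by eventually_elim (use mv in blast)
      show "((\<lambda>\<gamma>. r \<gamma> I) \<longlongrightarrow> 0) (at_right (- 1 / \<theta>))" using r0 unfolding \<gamma>0(1) .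
    qed (use mv in blast | rule g1[OF I(1)] g2[OF I(1)]; assumption)+
    then show ?thesis by (simp only: D2i I_def \<gamma>0(1))
  qed
  have "I2 \<noteq> {}"
    using SUP_enat_eq_2_attained[OF \<open>(SUP i\<in>{1..<M}. switch_type d \<gamma>0 \<sigma> \<tau> i) = 2\<close>] \<open>I2 = _\<close> by auto
  have D2_pos: "D2 i > 0" if "i \<in> I2" for i
    using \<open>\<And>i. i \<in> I2 \<Longrightarrow> D2 i > b2\<close>[OF that] \<open>b2 > 0\<close> by simp
  have "\<forall>\<^sub>F \<gamma> in at_right \<gamma>0. J \<gamma> - J 0 < \<alpha> * (- (\<Sum>i\<in>I2. sqrt 2 * \<bar>\<theta>\<bar> / sqrt (D2 i) / \<gamma>0)) * sqrt (\<gamma> - \<gamma>0)"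
  proof (rule armijo_eventually[OF \<gamma>0(2) finI2 \<open>I2 \<noteq> {}\<close> \<epsilon> C J_le r_le rate])
    show "0 < sqrt 2 * \<bar>\<theta>\<bar> / sqrt (D2 i)" if "i \<in> I2" for i
      using D2_pos[OF that] \<theta> by (intro divide_pos_pos mult_pos_pos) auto
  qed (use \<open>\<alpha> < 1\<close> in auto)
  moreover have "- (\<Sum>i\<in>I2. sqrt 2 * \<bar>\<theta>\<bar> / sqrt (D2 i) / \<gamma>0) = s2"
    unfolding \<open>s2 = _\<close> using \<theta> by (simp add: \<gamma>0(1) power2_eq_square algebra_simps)
  ultimately have ev: "\<forall>\<^sub>F \<gamma> in at_right \<gamma>0. J \<gamma> - J 0 < \<alpha> * s2 * sqrt (\<gamma> - \<gamma>0)"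
    by (simp only:)
  have "filterlim \<gamma> (at_right \<gamma>0) sequentially"
    unfolding \<open>\<gamma> = _\<close> \<open>\<gamma>3 = _\<close>
    by (rule armijo_steps[OF \<gamma>0(2) \<open>0 < \<alpha>\<close> \<open>\<alpha> < 1\<close> \<open>0 < \<beta>\<close> \<open>\<beta> < 1\<close>])
  then have "\<forall>\<^sub>F j in sequentially. J (\<gamma> j) - J 0 < \<alpha> * s2 * sqrt (\<gamma> j - \<gamma>0)"
    using ev unfolding filterlim_iff by blast
  then obtain j where "J (\<gamma> j) - J 0 < \<alpha> * s2 * sqrt (\<gamma> j - \<gamma>0)"
    using eventually_happens'[OF sequentially_bot] by blast
  then show ?thesis by blast
qed

end
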